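(* Let $A,B,C,D,E,F,G,H$ be nonzero complex numbers with $BCDEFGH=A^3q^2$. Then $$\Phi^{(G)}(A;B,C,D,E,F,G,H;q)=K_1\,\Phi^{(\frac qH)}\Bigl(\tfrac qA;\tfrac qB,\tfrac qC,\tfrac qD,\tfrac qE,\tfrac qF,\tfrac qG,\tfrac qH;q\Bigr)+K_2\,\Phi^{(\frac{BG}{A})}\Bigl(\tfrac{G^2}{A};\tfrac{GB}{A},\tfrac{GC}{A},\tfrac{GD}{A},\tfrac{GE}{A},\tfrac{GF}{A},G,\tfrac{GH}{A};q\Bigr),$$ where $$K_1=\frac{(Aq,B,G,\frac BA,\frac GA,\frac{Bq}{A},\frac{Cq}{A},\frac{Dq}{A},\frac{Eq}{A},\frac{Fq}{A},\frac{Gq}{A})_\infty}{(\frac{q^2}{A},\frac qC,\frac qD,\frac qE,\frac qF,\frac qH,\frac AH,\frac{Aq}{C},\frac{Aq}{D},\frac{Aq}{E},\frac{Aq}{F},\frac{Aq}{H})_\infty}$$ $$\times\frac{(\frac{Aq}{CD},\frac{Aq}{CE},\frac{Aq}{CF},\frac{Aq}{DE},\frac{Aq}{DF},\frac{Aq}{EF},\frac{Aq}{BH},\frac{Aq}{CH},\frac{Aq}{DH},\frac{Aq}{EH},\frac{Aq}{FH},\frac{Aq}{GH})_\infty}{(\frac{BC}{A},\frac{BD}{A},\frac{BE}{A},\frac{BF}{A},\frac{BG}{A},\frac{CG}{A},\frac{DG}{A},\frac{EG}{A},\frac{FG}{A},\frac{CDEF}{A^2},\frac{A^2q}{CDEF})_\infty},$$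 $$K_2=\frac{(Aq,B,C,\frac CA,\frac GA,\frac{Gq}{A},\frac{Gq}{C},\frac{Gq}{D},\frac{Gq}{E},\frac{Gq}{F},\frac{Gq}{H})_\infty}{(\frac{G^2q}{A},\frac qD,\frac qE,\frac qF,\frac qH,\frac{Aq}{B},\frac{Aq}{D},\frac{Aq}{E},\frac{Aq}{F},\frac{Aq}{H},\frac BG)_\infty}\cdot\frac{(\frac{BD}{A},\frac{Aq}{BD},\frac{BE}{A},\frac{Aq}{BE},\frac{BF}{A},\frac{Aq}{BF},\frac{BH}{A},\frac{Aq}{BH})_\infty}{(\frac CB,\frac{Bq}{C},\frac{GB}{A},\frac{GC}{A},\frac{GD}{A},\frac{GE}{A},\frac{GF}{A},\frac{GH}{A})_\infty}$$ $$\times\left[1-\frac{(B,\frac qB,\frac AB,\frac{Bq}{A},\frac{CD}{A},\frac{Aq}{CD},\frac{CE}{A},\frac{Aq}{CE},\frac{CFq}{A},\frac{A}{CF},\frac{BDEF}{A^2},\frac{A^2q}{BDEF})_\infty}{(C,\frac qC,\frac AC,\frac{Cq}{A},\frac{BD}{A},\frac{Aq}{BD},\frac{BE}{A},\frac{Aq}{BE},\frac{BFq}{A},\frac{A}{BF},\frac{CDEF}{A^2},\frac{A^2q}{CDEF})_\infty}\right].$$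
   Context: Throughout $q\in\mathbb C$, $0<|q|<1$; $(x)_0=1$, $(x)_k=\prod_{j=0}^{k-1}(1-xq^j)$, $(x)_\infty=\prod_{j\ge 0}(1-xq^j)$, and $(x_1,\dots,x_r)_k=\prod_i (x_i)_k$ for $k\in\mathbb{Z}_{\ge0}\cup\{\infty\}$. The balanced very-well-poised series is $${}_{10}W_9(a;p_1,\dots,p_7;q)=\sum_{k=0}^\infty \frac{1-aq^{2k}}{1-a}\,\frac{(a,p_1,\dots,p_7)_k}{(q,aq/p_1,\dots,aq/p_7)_k}\,q^k,\qquad p_1p_2\cdots p_7=a^3q^2 .$$ For a distinguished parameter $p=p_i$ (the superscript names which parameter in the list is distinguished), $$\Phi^{(p)}(a;p_1,\dots,p_7;q)={}_{10}W_9(a;p_1,\dots,p_7;q)+\frac{(aq,\,p_i/a)_\infty}{(p_i^2q/a,\,a/p_i)_\infty}\prod_{j\ne i}\frac{(p_j,\;p_iq/p_j)_\infty}{(aq/p_j,\;p_ip_j/a)_\infty}\;{}_{10}W_9\Bigl(\tfrac{p_i^2}{a};\,p_i,\bigl(\tfrac{p_ip_j}{a}\bigr)_{j\ne i};q\Bigr).$$ Standing assumption: parameters are such that no zero denominators (singularities) occur. *)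

theory Defs
  imports "HOL-Analysis.Analysis"
begin

definition qpoch :: "complex \<Rightarrow> complex \<Rightarrow> nat \<Rightarrow> complex" where
  "qpoch q x k = (\<Prod>j<k. 1 - x * q ^ j)"

definition qpoch_inf :: "complex \<Rightarrow> complex \<Rightarrow> complex" where
  "qpoch_inf q x = (\<Prod>j. 1 - x * q ^ j)"

lemma convergent_prod_qpoch_inf:
  fixes q x :: complex
  assumes "norm q < 1"
  shows "convergent_prod (\<lambda>j. 1 - x * q ^ j)"
proof -
  have "summable (\<lambda>j. norm (- x * q ^ j))"
    using assms by (simp add: norm_mult norm_power summable_mult summable_geometric)
  then have "abs_convergent_prod (\<lambda>j. 1 + (- x * q ^ j))"
    by (intro summable_imp_abs_convergent_prod) simp
  then show ?thesis
    using abs_convergent_prod_imp_convergent_prod by fastforce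
qed

text \<open>The multi-argument symbols $(x_1,\dots,x_r)_k$ and $(x_1,\dots,x_r)_\infty$.\<close>

definition qpochs :: "complex \<Rightarrow> complex list \<Rightarrow> nat \<Rightarrow> complex" where
  "qpochs q xs k = (\<Prod>x\<leftarrow>xs. qpoch q x k)"

definition qpochs_inf :: "complex \<Rightarrow> complex list \<Rightarrow> complex" where
  "qpochs_inf q xs = (\<Prod>x\<leftarrow>xs. qpoch_inf q x)"

text \<open>
  The series ${}_{10}W_9(a;p_1,\dots,p_7;q)$, with \<open>ps\<close> the list of the seven parameters
  $p_1,\dots,p_7$. The balancing condition $p_1\cdots p_7 = a^3q^2$ is not built in.
  \<open>W_regular\<close> says that no term of the series has a zero denominator.
\<close>

definition W :: "complex \<Rightarrow> complex \<Rightarrow> complex list \<Rightarrow> complex" where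
  "W q a ps = (\<Sum>k. (1 - a * q ^ (2 * k)) / (1 - a)
      * (qpochs q (a # ps) k / qpochs q (q # map (\<lambda>p. a * q / p) ps) k) * q ^ k)"

definition W_regular :: "complex \<Rightarrow> complex \<Rightarrow> complex list \<Rightarrow> bool" where
  "W_regular q a ps \<longleftrightarrow> a \<noteq> 1 \<and> (\<forall>p\<in>set ps. p \<noteq> 0)
      \<and> (\<forall>k. qpochs q (q # map (\<lambda>p. a * q / p) ps) k \<noteq> 0)"

text \<open>
  The function $\Phi^{(p)}(a;p_1,\dots,p_7;q)$. The distinguished parameter is given by its
  position \<open>i\<close> in the list, counted from 0, because equal values may occur in the list.
\<close>

definition others :: "nat \<Rightarrow> complex list \<Rightarrow> complex list" where
  "others i ps = take i ps @ drop (Suc i) ps"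

definition Phi_num :: "complex \<Rightarrow> nat \<Rightarrow> complex \<Rightarrow> complex list \<Rightarrow> complex" where
  "Phi_num q i a ps = (let p = ps ! i in
      qpochs_inf q [a * q, p / a] * (\<Prod>x\<leftarrow>others i ps. qpochs_inf q [x, p * q / x]))"

definition Phi_den :: "complex \<Rightarrow> nat \<Rightarrow> complex \<Rightarrow> complex list \<Rightarrow> complex" where
  "Phi_den q i a ps = (let p = ps ! i in
      qpochs_inf q [p\<^sup>2 * q / a, a / p]
      * (\<Prod>x\<leftarrow>others i ps. qpochs_inf q [a * q / x, p * x / a]))"

definition Phi_params :: "nat \<Rightarrow> complex \<Rightarrow> complex list \<Rightarrow> complex list" where
  "Phi_params i a ps = (let p = ps ! i in p # map (\<lambda>x. p * x / a) (others i ps))"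

definition Phi :: "complex \<Rightarrow> nat \<Rightarrow> complex \<Rightarrow> complex list \<Rightarrow> complex" where
  "Phi q i a ps = W q a ps
      + Phi_num q i a ps / Phi_den q i a ps * W q ((ps ! i)\<^sup>2 / a) (Phi_params i a ps)"

definition Phi_regular :: "complex \<Rightarrow> nat \<Rightarrow> complex \<Rightarrow> complex list \<Rightarrow> bool" where
  "Phi_regular q i a ps \<longleftrightarrow> a \<noteq> 0 \<and> W_regular q a ps
      \<and> W_regular q ((ps ! i)\<^sup>2 / a) (Phi_params i a ps) \<and> Phi_den q i a ps \<noteq> 0"

text \<open>
  The coefficients $K_1$ and $K_2$. Their denominators are separate constants so that the
  standing assumption of non-vanishing denominators can refer to them.
\<close>

definition K1_num where
  "K1_num q A B C D E F G H =
     qpochs_inf q [A*q, B, G, B/A, G/A, B*q/A, C*q/A, D*q/A, E*q/A, F*q/A, G*q/A]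
   * qpochs_inf q [A*q/(C*D), A*q/(C*E), A*q/(C*F), A*q/(D*E), A*q/(D*F), A*q/(E*F),
       A*q/(B*H), A*q/(C*H), A*q/(D*H), A*q/(E*H), A*q/(F*H), A*q/(G*H)]"

definition K1_den where
  "K1_den q A B C D E F G H =
     qpochs_inf q [q\<^sup>2/A, q/C, q/D, q/E, q/F, q/H, A/H, A*q/C, A*q/D, A*q/E, A*q/F, A*q/H]
   * qpochs_inf q [B*C/A, B*D/A, B*E/A, B*F/A, B*G/A, C*G/A, D*G/A, E*G/A, F*G/A,
       C*D*E*F/A\<^sup>2, A\<^sup>2*q/(C*D*E*F)]"

definition K1 where
  "K1 q A B C D E F G H = K1_num q A B C D E F G H / K1_den q A B C D E F G H"

definition K2_num where
  "K2_num q A B C D E F G H =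
     qpochs_inf q [A*q, B, C, C/A, G/A, G*q/A, G*q/C, G*q/D, G*q/E, G*q/F, G*q/H]
   * qpochs_inf q [B*D/A, A*q/(B*D), B*E/A, A*q/(B*E), B*F/A, A*q/(B*F), B*H/A, A*q/(B*H)]"

definition K2_den where
  "K2_den q A B C D E F G H =
     qpochs_inf q [G\<^sup>2*q/A, q/D, q/E, q/F, q/H, A*q/B, A*q/D, A*q/E, A*q/F, A*q/H, B/G]
   * qpochs_inf q [C/B, B*q/C, G*B/A, G*C/A, G*D/A, G*E/A, G*F/A, G*H/A]"

definition K2_bracket_num where
  "K2_bracket_num q A B C D E F =
     qpochs_inf q [B, q/B, A/B, B*q/A, C*D/A, A*q/(C*D), C*E/A, A*q/(C*E), C*F*q/A, A/(C*F),
       B*D*E*F/A\<^sup>2, A\<^sup>2*q/(B*D*E*F)]"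

definition K2_bracket_den where
  "K2_bracket_den q A B C D E F =
     qpochs_inf q [C, q/C, A/C, C*q/A, B*D/A, A*q/(B*D), B*E/A, A*q/(B*E), B*F*q/A, A/(B*F),
       C*D*E*F/A\<^sup>2, A\<^sup>2*q/(C*D*E*F)]"

definition K2 where
  "K2 q A B C D E F G H = K2_num q A B C D E F G H / K2_den q A B C D E F G H
     * (1 - K2_bracket_num q A B C D E F / K2_bracket_den q A B C D E F)"

end

theory Submission
  imports Defs
begin

text \<open>
  Write $A=t_0^2$, $B=t_0t_1$, \dots, $H=t_0t_7$, so that $t_0\cdots t_7=q^2$. Up to an explicit
  factor, the function $\Phi$ with base $t_i^2$ and distinguished parameter $t_it_j$ is the $q$-integral
  from $t_i$ to $t_j$ of the single function $x(1-x^2)\prod_k (qx/t_k)_\infty/(t_kx)_\infty$.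
  Hence any three of these functions with indices $ij$, $jk$, $ki$ satisfy a trivial linear relation.
  Bailey's four-term ${}_{10}\phi_9$ transformation says that a normalisation $\Psi_{ij}(t)$ of this
  $q$-integral is invariant under multiplying four of the $t_k$ by $s$ and dividing the other four by $s$,
  where $s$ preserves the balancing condition and $i$, $j$ lie in different groups. Composing such transformations gives
  $\Psi_{ij}(t')=\Psi_{lm}(\sqrt q/t)$ if $t'$ arises by scaling the group $\{i,j,l,m\}$. So the trivial
  relation at $t'$ becomes one between $\Psi_{lm}(\sqrt q/t)$, $\Psi_{jk}(t)$, $\Psi_{ki}(t)$, and
  similarly one obtains a relation between three $\Psi$ that share one index. Eliminating $\Psi$ with the indices of
  $C$ and $G$ from two such relations yields the theorem; the two terms of $K_2$ come from the two relations.

  Bailey's transformation follows by summing a double series in both orders with the nonterminating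
  ${}_8\phi_7$ sum and its terminating case. Those two sums follow from a first-order contiguous relation
  that shifts two parameters by opposite powers of \<open>q\<close>. All this is done for multiplicatively
  independent parameters; the general case is a limit.
\<close>

text \<open>Scaling four parameters by \<open>s\<close> is admissible when \<open>s^2\<close> is
  \<open>q\<close> divided by their product; the scaling then exchanges the products of the two
  groups of four. Composing such scalings brings in new square roots, so a finite list of
  nonvanishing conditions would change with every composition. Multiplicative independence modulo
  powers of \<open>q\<close> is a single hypothesis that survives all scalings and the inversion,
  and it yields every condition of this kind.

  The kernel of the double series is that part of an 8phi7 integrand in \<open>x\<close> which
  belongs to the parameters \<open>y / s\<close> and \<open>1 / (y s)\<close>. Hence the sum over
  \<open>x\<close> for fixed \<open>y\<close> is the nonterminating one, while on the lattice from
  \<open>a0 / s\<close> the sum over \<open>y\<close> breaks off. Absolute convergence is available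
  for \<open>norm q < (norm s)^2\<close>. Exchanging the two groups replaces \<open>s\<close> by
  \<open>1 / s\<close>, and one of the two values always satisfies this bound.

  Up to the factors between \<open>Phi\<close> and \<open>Psi\<close>, the coefficients
  \<open>K1\<close> and \<open>K2\<close> are what linear elimination makes of the coefficients of
  the two three-term relations.\<close>

locale q_disc =
  fixes q :: complex
  assumes q_nz [simp]: "q \<noteq> 0" and norm_q: "norm q < 1"
begin

section \<open>Infinite q-products: recurrence, bounds, continuity\<close>

abbreviation P :: "complex \<Rightarrow> complex" where "P \<equiv> qpoch_inf q"

lemma P_has_prod: "(\<lambda>j. 1 - x * q ^ j) has_prod P x"
  unfolding qpoch_inf_def
  using convergent_prod_qpoch_inf[OF norm_q] convergent_prod_has_prod_iff by blast

lemma qpoch_tendsto_P: "(\<lambda>n. qpoch q x n) \<longlonglongrightarrow> P x"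
  using has_prod_imp_tendsto'[OF P_has_prod] by (simp add: qpoch_def)

lemma qpoch_0 [simp]: "qpoch q x 0 = 1"
  by (simp add: qpoch_def)

lemma qpoch_Suc: "qpoch q x (Suc n) = qpoch q x n * (1 - x * q ^ n)"
  by (simp add: qpoch_def)

lemma qpoch_Suc': "qpoch q x (Suc n) = (1 - x) * qpoch q (x * q) n"
proof (induction n)
  case (Suc n)
  have "qpoch q x (Suc (Suc n)) = (1 - x) * qpoch q (x * q) n * (1 - x * q ^ Suc n)"
    by (subst qpoch_Suc) (simp only: Suc)
  then show ?case
    by (simp add: qpoch_Suc mult.assoc)
qed (simp add: qpoch_Suc)

lemma P_rec: "P x = (1 - x) * P (x * q)"
proof -
  have "(\<lambda>n. qpoch q x (Suc n)) \<longlonglongrightarrow> (1 - x) * P (x * q)"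
    unfolding qpoch_Suc' by (intro tendsto_intros qpoch_tendsto_P)
  moreover have "(\<lambda>n. qpoch q x (Suc n)) \<longlonglongrightarrow> P x"
    by (rule LIMSEQ_Suc[OF qpoch_tendsto_P])
  ultimately show ?thesis
    by (rule LIMSEQ_unique[rotated])
qed

lemma P_shift: "P x = qpoch q x n * P (x * q ^ n)"
proof (induction n)
  case (Suc n)
  have "P (x * q ^ n) = (1 - x * q ^ n) * P (x * q ^ Suc n)"
    using P_rec[of "x * q ^ n"] by (simp add: mult.assoc mult.commute[of q])
  with Suc show ?case
    by (simp add: qpoch_Suc mult.assoc)
qed simp

lemma P_eq_0_iff: "P x = 0 \<longleftrightarrow> (\<exists>n. x * q ^ n = 1)"
  using has_prod_eq_0_iff[OF P_has_prod, of x] by (auto simp: eq_commute[of 1])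

lemma P_0 [simp]: "P 0 = 1"
  by (simp add: qpoch_inf_def)

lemma P_1 [simp]: "P 1 = 0"
  unfolding P_eq_0_iff by (intro exI[of _ 0]) simp

text \<open>Each factor is at most \<open>1 + norm x * norm q ^ j\<close>, hence at most an
  exponential, and the exponents form a geometric series. The bound is independent of
  \<open>n\<close>, as dominated convergence requires later.\<close>

lemma norm_qpoch_le: "norm (qpoch q x n) \<le> exp (norm x / (1 - norm q))"
proof -
  have "norm (qpoch q x n) \<le> (\<Prod>j<n. exp (norm x * norm q ^ j))"
    unfolding qpoch_def prod_norm[symmetric]
  proof (intro prod_mono conjI)
    fix j
    have "norm (1 - x * q ^ j) \<le> 1 + norm x * norm q ^ j"
      using norm_triangle_ineq4[of 1 "x * q ^ j"] by (simp add: norm_mult norm_power)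
    also have "\<dots> \<le> exp (norm x * norm q ^ j)"
      by (rule exp_ge_add_one_self)
    finally show "norm (1 - x * q ^ j) \<le> exp (norm x * norm q ^ j)" .
  qed simp
  also have "\<dots> = exp (norm x * (\<Sum>j<n. norm q ^ j))"
    by (simp add: exp_sum sum_distrib_left)
  also have "(\<Sum>j<n. norm q ^ j) \<le> 1 / (1 - norm q)"
    using sum_le_suminf[of "\<lambda>j. norm q ^ j" "{..<n}"] norm_q
    by (simp add: suminf_geometric summable_geometric)
  then have "exp (norm x * (\<Sum>j<n. norm q ^ j)) \<le> exp (norm x / (1 - norm q))"
    by (simp add: divide_inverse mult_left_mono)
  finally show ?thesis .
qed

lemma norm_P_le: "norm (P x) \<le> exp (norm x / (1 - norm q))"
  by (rule LIMSEQ_le_const2[OF tendsto_norm[OF qpoch_tendsto_P]]) (auto intro: norm_qpoch_le)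

lemma continuous_on_P_cball: "continuous_on (cball 0 R) P"
proof -
  have unif: "uniformly_convergent_on (cball 0 R) (\<lambda>N x. \<Prod>n<N. 1 - x * q ^ n)"
  proof (rule uniformly_convergent_on_prod')
    show "uniformly_convergent_on (cball 0 R) (\<lambda>N x. \<Sum>n<N. norm (1 - x * q ^ n - 1))"
    proof (rule Weierstrass_m_test')
      show "summable (\<lambda>n. R * norm q ^ n)"
        using norm_q by (intro summable_mult summable_geometric) simp
    qed (auto simp: norm_mult norm_power intro!: mult_right_mono)
  qed (auto intro!: continuous_intros)
  have "uniform_limit (cball 0 R) (\<lambda>N x. \<Prod>n<N. 1 - x * q ^ n) (\<lambda>x. lim (\<lambda>N. \<Prod>n<N. 1 - x * q ^ n)) sequentially"
    using unif uniformly_convergent_uniform_limit_iff by blast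
  moreover have "lim (\<lambda>N. \<Prod>n<N. 1 - x * q ^ n) = P x" for x
    using qpoch_tendsto_P[of x] by (simp add: qpoch_def limI)
  ultimately have "uniform_limit (cball 0 R) (\<lambda>N x. \<Prod>n<N. 1 - x * q ^ n) P sequentially"
    by simp
  then show ?thesis
    by (rule uniform_limit_theorem[rotated]) (auto intro!: always_eventually continuous_intros)
qed

lemma isCont_P: "isCont P x"
proof -
  have "x \<in> ball 0 (norm x + 1)" by simp
  moreover have "continuous_on (ball 0 (norm x + 1)) P"
    using continuous_on_P_cball ball_subset_cball continuous_on_subset by blast
  ultimately show ?thesis
    by (simp add: continuous_on_eq_continuous_at)
qed

lemma tendsto_P [tendsto_intros]: "(f \<longlongrightarrow> l) Fl \<Longrightarrow> ((\<lambda>n. P (f n)) \<longlongrightarrow> P l) Fl"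
  using isCont_P isCont_tendsto_compose by blast

lemma tendsto_q_power: "(\<lambda>n. q ^ n) \<longlonglongrightarrow> 0"
  using LIMSEQ_power_zero norm_q by blast

lemma tendsto_P_q_power: "(\<lambda>n. P (c * q ^ n)) \<longlonglongrightarrow> 1"
  using tendsto_P[OF tendsto_mult[OF tendsto_const[of c] tendsto_q_power]] by simp

section \<open>The lattice of powers of \<open>q\<close> and the theta function\<close>

definition Zq :: "complex set" where "Zq = range (\<lambda>n::int. q powi n)"

lemma q_powi_in_Zq [simp]: "q powi n \<in> Zq"
  by (simp add: Zq_def)

lemma Zq_simps [simp]: "1 \<in> Zq" "q \<in> Zq" "q ^ n \<in> Zq"
  using q_powi_in_Zq[of 0] q_powi_in_Zq[of 1] q_powi_in_Zq[of "int n"] by simp_all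

lemma Zq_mult: "x \<in> Zq \<Longrightarrow> y \<in> Zq \<Longrightarrow> x * y \<in> Zq"
proof -
  assume "x \<in> Zq" "y \<in> Zq"
  then obtain m n where "x = q powi m" "y = q powi n"
    unfolding Zq_def by blast
  then have "x * y = q powi (m + n)"
    by (simp add: power_int_add)
  then show ?thesis
    by simp
qed

lemma Zq_inverse: "x \<in> Zq \<Longrightarrow> inverse x \<in> Zq"
proof -
  assume "x \<in> Zq"
  then obtain m where "x = q powi m"
    unfolding Zq_def by blast
  then have "inverse x = q powi (- m)"
    by (simp add: power_int_minus)
  then show ?thesis
    by simp
qed

lemma Zq_divide: "x \<in> Zq \<Longrightarrow> y \<in> Zq \<Longrightarrow> x / y \<in> Zq"
  by (simp add: Zq_mult Zq_inverse divide_inverse)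

lemma Zq_nz: "x \<in> Zq \<Longrightarrow> x \<noteq> 0"
  by (auto simp: Zq_def)

text \<open>The zeros of \<open>P\<close> are the powers \<open>1 / q ^ n\<close>. Nonvanishing
  conditions are stated throughout as lying outside the group \<open>Zq\<close>, because this form
  is stable under shifts by \<open>q\<close> and under inversion.\<close>

lemma P_nz: "x \<notin> Zq \<Longrightarrow> P x \<noteq> 0"
proof
  assume x: "x \<notin> Zq" and "P x = 0"
  then obtain n where "x * q ^ n = 1"
    unfolding P_eq_0_iff by blast
  then have "x = 1 / q ^ n"
    by (simp add: field_simps)
  then have "x \<in> Zq"
    by (simp add: Zq_divide)
  with x show False ..
qed

lemma Zq_cancel [simp]:
  "x * q \<in> Zq \<longleftrightarrow> x \<in> Zq" "q * x \<in> Zq \<longleftrightarrow> x \<in> Zq" "x / q \<in> Zq \<longleftrightarrow> x \<in> Zq"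
  "x * q ^ n \<in> Zq \<longleftrightarrow> x \<in> Zq" "q ^ n * x \<in> Zq \<longleftrightarrow> x \<in> Zq" "x / q ^ n \<in> Zq \<longleftrightarrow> x \<in> Zq"
proof -
  have *: "x * y \<in> Zq \<longleftrightarrow> x \<in> Zq" if "y \<in> Zq" for x y
    using that Zq_mult[of x y] Zq_divide[of "x * y" y] Zq_nz[OF that] by auto
  have **: "x / y \<in> Zq \<longleftrightarrow> x \<in> Zq" if "y \<in> Zq" for x y
    using *[of "inverse y" x] Zq_inverse[OF that] by (simp add: divide_inverse)
  show "x * q \<in> Zq \<longleftrightarrow> x \<in> Zq" "x / q \<in> Zq \<longleftrightarrow> x \<in> Zq"
    "x * q ^ n \<in> Zq \<longleftrightarrow> x \<in> Zq" "x / q ^ n \<in> Zq \<longleftrightarrow> x \<in> Zq"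
    by (rule *, simp, rule **, simp, rule *, simp, rule **, simp)
  then show "q * x \<in> Zq \<longleftrightarrow> x \<in> Zq" "q ^ n * x \<in> Zq \<longleftrightarrow> x \<in> Zq"
    by (simp_all add: mult.commute)
qed

lemma Zq_cancel_frac [simp]: "q * x / y \<in> Zq \<longleftrightarrow> x / y \<in> Zq"
  using Zq_cancel(2)[of "x / y"] by simp

lemma Zq_inverse_iff: "inverse x \<in> Zq \<longleftrightarrow> x \<in> Zq"
  using Zq_inverse[of x] Zq_inverse[of "inverse x"] by auto

lemma Zq_q_div: "q / x \<in> Zq \<longleftrightarrow> x \<in> Zq"
  unfolding divide_inverse by (simp add: Zq_inverse_iff)

text \<open>The modified theta function. Its zero set is exactly \<open>Zq\<close>, and a shift of
  the argument by \<open>q\<close> costs only a monomial.\<close>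

definition th :: "complex \<Rightarrow> complex" where "th x = P x * P (q / x)"

lemma th_nz: "x \<notin> Zq \<Longrightarrow> th x \<noteq> 0"
  by (simp add: th_def P_nz Zq_q_div)

lemma th_q_div: "x \<noteq> 0 \<Longrightarrow> th (q / x) = th x"
  by (simp add: th_def)

lemma th_mult_q: "x \<noteq> 0 \<Longrightarrow> th (x * q) = - th x / x"
proof -
  assume x: "x \<noteq> 0"
  have "P (1 / x) = (1 - 1 / x) * P (q / x)"
    using P_rec[of "1 / x"] by (simp add: mult.commute)
  then have "x * P (1 / x) = (x - 1) * P (q / x)"
    using x by (simp add: field_simps)
  moreover have "x * th (x * q) = x * P (1 / x) * P (x * q)"
    by (simp add: th_def)
  ultimately have "x * th (x * q) = (x - 1) * P (x * q) * P (q / x)"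
    by simp
  also have "\<dots> = - th x"
    unfolding th_def by (subst P_rec[of x]) algebra
  finally show ?thesis
    using x by (simp add: field_simps)
qed

lemma th_inverse: "x \<noteq> 0 \<Longrightarrow> th (1 / x) = - th x / x"
proof -
  assume x: "x \<noteq> 0"
  have "th (1 / x) = th (x * q)"
    using th_q_div[of "x * q"] x by simp
  then show ?thesis
    using th_mult_q[OF x] by simp
qed

lemma th_div_q: "x \<noteq> 0 \<Longrightarrow> th (x / q) = - (x / q) * th x"
proof -
  assume x: "x \<noteq> 0"
  then have "th x = - th (x / q) / (x / q)"
    using th_mult_q[of "x / q"] by simp
  then show ?thesis
    using x by simp
qed

text \<open>With \<open>a = T\<^sup>2\<close> and \<open>p\<^sub>i = T t\<^sub>i\<close>, the series \<open>S (T # ts) T\<close> is a multiple of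
  ${}_{10}W_9(a;p_1,\dots,p_7)$, and \<open>Q\<close> is a $q$-integral from \<open>c\<close> to \<open>d\<close>.\<close>

definition F :: "complex list \<Rightarrow> complex \<Rightarrow> complex" where
  "F ts x = x * (1 - x\<^sup>2) * (\<Prod>t\<leftarrow>ts. P (q * x / t) / P (t * x))"

definition S :: "complex list \<Rightarrow> complex \<Rightarrow> complex" where
  "S ts c = (\<Sum>k. F ts (c * q ^ k))"

definition Q :: "complex list \<Rightarrow> complex \<Rightarrow> complex \<Rightarrow> complex" where
  "Q ts c d = S ts d - S ts c"

lemma F_mset_cong: "mset ts = mset us \<Longrightarrow> F ts = F us"
proof (rule ext)
  fix x assume "mset ts = mset us"
  then have "prod_mset (image_mset (\<lambda>t. P (q * x / t) / P (t * x)) (mset ts))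
      = prod_mset (image_mset (\<lambda>t. P (q * x / t) / P (t * x)) (mset us))"
    by simp
  then show "F ts x = F us x"
    by (simp only: F_def prod_mset_prod_list mset_map[symmetric])
qed

lemma S_mset_cong: "mset ts = mset us \<Longrightarrow> S ts = S us"
  unfolding S_def by (drule F_mset_cong) simp

lemma Q_mset_cong: "mset ts = mset us \<Longrightarrow> Q ts = Q us"
  unfolding Q_def by (drule S_mset_cong) simp

lemma summable_q_comparison:
  assumes "(\<lambda>k. f k) \<longlonglongrightarrow> (l::complex)"
  shows "summable (\<lambda>k. q ^ k * f k)"
proof -
  obtain M where M: "norm (f k) \<le> M" for k
    using convergent_imp_Bseq[OF convergentI[OF assms]] unfolding Bseq_def by blast
  show ?thesis
  proof (rule summable_comparison_test')
    show "summable (\<lambda>k. norm q ^ k * M)"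
      using norm_q by (intro summable_mult2 summable_geometric) simp
    show "norm (q ^ k * f k) \<le> norm q ^ k * M" if "k \<ge> 0" for k
      by (simp add: norm_mult norm_power mult_left_mono M)
  qed
qed

text \<open>Along the lattice every product tends to 1, and a vanishing denominator can occur for
  finitely many \<open>k\<close> only, so the limit is decided by the factor
  \<open>x (1 - x^2)\<close>.\<close>

lemma F_over_q_power_tendsto: "(\<lambda>k. F ts (c * q ^ k) / q ^ k) \<longlonglongrightarrow> c"
proof -
  have "(\<lambda>k. (\<Prod>t\<leftarrow>ts. P (q * (c * q ^ k) / t) / P (t * (c * q ^ k)))) \<longlonglongrightarrow> 1"
  proof (induction ts)
    case (Cons t ts)
    have "(\<lambda>k. P (q * c / t * q ^ k) / P (t * c * q ^ k)) \<longlonglongrightarrow> 1 / 1"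
      by (intro tendsto_divide tendsto_P_q_power) simp
    from tendsto_mult[OF this Cons] show ?case
      by (simp add: mult_ac)
  qed simp
  moreover have "(\<lambda>k. c * (1 - (c * q ^ k)\<^sup>2)) \<longlonglongrightarrow> c * (1 - (c * 0)\<^sup>2)"
    by (intro tendsto_intros tendsto_q_power)
  from tendsto_mult[OF this calculation] have "(\<lambda>k. c * (1 - (c * q ^ k)\<^sup>2) * (\<Prod>t\<leftarrow>ts. P (q * (c * q ^ k) / t) / P (t * (c * q ^ k)))) \<longlonglongrightarrow> c * 1"
    by simp
  then show ?thesis
    by (simp add: F_def mult.assoc)
qed

lemma summable_F: "summable (\<lambda>k. F ts (c * q ^ k))"
  using summable_q_comparison[OF F_over_q_power_tendsto[of ts c]] by simp

text \<open>The common shape of the contiguous relations: a certificate \<open>G\<close> that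
  vanishes at both end points and has the same limit along both lattices gives \<open>f\<close>
  equal sums over them, so the q-integral of \<open>f\<close> is 0.\<close>

lemma sums_lattice_telescope:
  assumes "(\<lambda>k. G (c * q ^ k)) \<longlonglongrightarrow> (L::complex)" and "G c = 0"
    and "\<And>k. f (c * q ^ k) = G (c * q ^ Suc k) - G (c * q ^ k)"
  shows "(\<lambda>k. f (c * q ^ k)) sums L"
  using telescope_sums[OF assms(1)] assms(2,3) by simp

lemma P_nz_shift: "P x \<noteq> 0 \<Longrightarrow> P (x * q ^ k) \<noteq> 0"
  using P_shift[of x k] by auto

lemma P_q_nz: "P q \<noteq> 0"
proof
  assume "P q = 0"
  then obtain n where "q ^ Suc n = 1"
    unfolding P_eq_0_iff by auto
  then have "norm q ^ Suc n = 1"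
    by (metis norm_one norm_power)
  moreover have "norm q ^ Suc n < 1"
    using norm_q by (intro power_Suc_less_one) simp_all
  ultimately show False by simp
qed

lemma P_rec_nz: "P x \<noteq> 0 \<Longrightarrow> P (x * q) = P x / (1 - x)"
  using P_rec[of x] by (auto simp: field_simps)

section \<open>Uniform bounds for interchanging limits and sums\<close>

definition bdd2 :: "(nat \<Rightarrow> nat \<Rightarrow> complex) \<Rightarrow> bool" where
  "bdd2 f \<longleftrightarrow> (\<exists>M. \<forall>n k. norm (f n k) \<le> M)"

lemma bdd2_const: "bdd2 (\<lambda>n k. c)"
  unfolding bdd2_def by auto

lemma bdd2_mult: "bdd2 f \<Longrightarrow> bdd2 g \<Longrightarrow> bdd2 (\<lambda>n k. f n k * g n k)"
proof -
  assume "bdd2 f" "bdd2 g"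
  then obtain M N where MN: "\<And>n k. norm (f n k) \<le> M" "\<And>n k. norm (g n k) \<le> N"
    unfolding bdd2_def by blast
  have "norm (f n k * g n k) \<le> M * N" for n k
    unfolding norm_mult using MN[of n k] by (intro mult_mono) (auto intro: order_trans[OF norm_ge_zero])
  then show ?thesis
    unfolding bdd2_def by blast
qed

lemma bdd2_divide: "bdd2 f \<Longrightarrow> bdd2 (\<lambda>n k. inverse (g n k)) \<Longrightarrow> bdd2 (\<lambda>n k. f n k / g n k)"
  unfolding divide_inverse by (rule bdd2_mult)

lemma bdd2_inverse_mult:
  "bdd2 (\<lambda>n k. inverse (f n k)) \<Longrightarrow> bdd2 (\<lambda>n k. inverse (g n k)) \<Longrightarrow> bdd2 (\<lambda>n k. inverse (f n k * g n k))"
  unfolding inverse_mult_distrib by (rule bdd2_mult)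

lemma bdd2_diff: "bdd2 f \<Longrightarrow> bdd2 g \<Longrightarrow> bdd2 (\<lambda>n k. f n k - g n k)"
proof -
  assume "bdd2 f" "bdd2 g"
  then obtain M N where MN: "\<And>n k. norm (f n k) \<le> M" "\<And>n k. norm (g n k) \<le> N"
    unfolding bdd2_def by blast
  have "norm (f n k - g n k) \<le> M + N" for n k
    by (rule norm_triangle_le_diff) (intro add_mono MN)
  then show ?thesis
    unfolding bdd2_def by blast
qed

lemma bdd2_q_power: "bdd2 (\<lambda>n k. q ^ h n k)"
  unfolding bdd2_def using norm_q by (intro exI[of _ 1]) (auto simp: norm_power power_le_one)

lemma bdd2_P: "bdd2 f \<Longrightarrow> bdd2 (\<lambda>n k. P (f n k))"
proof -
  assume "bdd2 f"
  then obtain M where M: "norm (f n k) \<le> M" for n k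
    unfolding bdd2_def by blast
  have "norm (P (f n k)) \<le> exp (M / (1 - norm q))" for n k
    using M norm_q by (intro order_trans[OF norm_P_le]) (simp add: divide_right_mono)
  then show ?thesis
    unfolding bdd2_def by blast
qed

lemma bdd2_sequence: "f \<longlonglongrightarrow> l \<Longrightarrow> bdd2 (\<lambda>n k. f (h n k))"
  using convergent_imp_Bseq[OF convergentI, of f l] unfolding Bseq_def bdd2_def by blast

text \<open>Near the limit point 0 of the lattice \<open>c q\<^sup>m\<close> the product tends to 1, so its
  reciprocal is bounded (also when some value vanishes, since then the reciprocal is 0).\<close>

lemma bdd2_inverse_P: "(\<And>n k. f n k = c * q ^ h n k) \<Longrightarrow> bdd2 (\<lambda>n k. inverse (P (f n k)))"
  using bdd2_sequence[OF tendsto_inverse[OF tendsto_P_q_power[of c]], of h] by simp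

lemmas bdd2_intros = bdd2_const bdd2_mult bdd2_divide bdd2_inverse_mult bdd2_diff bdd2_q_power bdd2_P

lemma tannery_q:
  assumes "\<And>k. (\<lambda>n. f n k) \<longlonglongrightarrow> g k" and "bdd2 f"
  shows "(\<lambda>n. \<Sum>k. q ^ k * f n k) \<longlonglongrightarrow> (\<Sum>k. q ^ k * g k)"
proof -
  obtain M where M: "norm (f n k) \<le> M" for n k
    using assms(2) unfolding bdd2_def by blast
  have "eventually (\<lambda>n. summable (\<lambda>k. norm (q ^ k * f n k))) sequentially \<and>
      summable (\<lambda>k. norm (q ^ k * g k)) \<and>
      (\<lambda>n. \<Sum>k. q ^ k * f n k) \<longlonglongrightarrow> (\<Sum>k. q ^ k * g k)"
  proof (rule tannerys_theorem)
    show "\<forall>\<^sub>F (k, n) in sequentially \<times>\<^sub>F sequentially. norm (q ^ k * f n k) \<le> norm q ^ k * M"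
      by (intro always_eventually) (auto simp: norm_mult norm_power intro!: mult_left_mono M)
    show "summable (\<lambda>k. norm q ^ k * M)"
      using norm_q by (intro summable_mult2 summable_geometric) simp
  qed (auto intro!: tendsto_intros assms)
  then show ?thesis by blast
qed

subsection \<open>The Andrews-Askey $q$-integral\<close>

text \<open>The factor \<open>y\<close> is the measure of the q-integral: up to the factor
  \<open>1 - q\<close>, \<open>aa_int\<close> is the Andrews-Askey integral from \<open>c\<close> to
  \<open>d\<close> of the remaining quotient.\<close>

definition aa_term :: "complex \<Rightarrow> complex \<Rightarrow> complex \<Rightarrow> complex \<Rightarrow> complex \<Rightarrow> complex" where
  "aa_term c d a b y = y * (P (q * y / c) * P (q * y / d) / (P (a * y) * P (b * y)))"

definition aa_int :: "complex \<Rightarrow> complex \<Rightarrow> complex \<Rightarrow> complex \<Rightarrow> complex" where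
  "aa_int c d a b = (\<Sum>k. aa_term c d a b (d * q ^ k)) - (\<Sum>k. aa_term c d a b (c * q ^ k))"

lemma aa_int_commute: "aa_int c d a b = aa_int c d b a"
  unfolding aa_int_def aa_term_def by (simp add: mult.commute)

lemma summable_aa_term: "summable (\<lambda>k. aa_term c d a b (y * q ^ k))"
proof -
  have "(\<lambda>k. y * (P (q * y / c * q ^ k) * P (q * y / d * q ^ k) / (P (a * y * q ^ k) * P (b * y * q ^ k))))
      \<longlonglongrightarrow> y * (1 * 1 / (1 * 1))"
    by (intro tendsto_intros tendsto_P_q_power) simp
  from summable_q_comparison[OF this] show ?thesis
    by (simp add: aa_term_def mult_ac)
qed

text \<open>The combination of the two integrands is an exact q-difference. Its certificate
  \<open>G\<close> vanishes at \<open>c\<close> and at \<open>d\<close> and tends to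
  \<open>- a * c * d\<close> along both lattices, so the two sums of \<open>f\<close> agree.\<close>

lemma aa_int_shift:
  assumes nz: "c \<noteq> 0" "d \<noteq> 0" and "P (a * c) \<noteq> 0" "P (b * c) \<noteq> 0" "P (a * d) \<noteq> 0" "P (b * d) \<noteq> 0"
  shows "(1 - a * c) * (1 - a * d) * aa_int c d a b = (1 - a * b * c * d) * aa_int c d (a * q) b"
proof -
  define G where "G y = - a * c * d * (P (y / c) * P (y / d) / (P (a * y) * P (b * y)))" for y
  define f where "f y = (1 - a * c) * (1 - a * d) * aa_term c d a b y
      - (1 - a * b * c * d) * aa_term c d (a * q) b y" for y
  have sums: "(\<lambda>k. f (e * q ^ k)) sums (- a * c * d)"
    if e: "e = c \<or> e = d" and "P (a * e) \<noteq> 0" "P (b * e) \<noteq> 0" for e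
  proof (rule sums_lattice_telescope[where G = G])
    have "(\<lambda>k. - a * c * d * (P (e / c * q ^ k) * P (e / d * q ^ k) / (P (a * e * q ^ k) * P (b * e * q ^ k))))
      \<longlonglongrightarrow> - a * c * d * (1 * 1 / (1 * 1))"
      by (intro tendsto_intros tendsto_P_q_power) simp
    then show "(\<lambda>k. G (e * q ^ k)) \<longlonglongrightarrow> - a * c * d"
      by (simp add: G_def mult_ac)
    show "G e = 0"
      using e nz by (auto simp: G_def)
    fix k
    define y where "y = e * q ^ k"
    have Pa: "P (a * y) \<noteq> 0" and Pb: "P (b * y) \<noteq> 0"
      using P_nz_shift[of "a * e" k] P_nz_shift[of "b * e" k] that by (simp_all add: y_def mult_ac)
    define K where "K = P (q * y / c) * P (q * y / d) / (P (a * y) * P (b * y))"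
    have 1: "P (a * y * q) = P (a * y) / (1 - a * y)" "P (b * y * q) = P (b * y) / (1 - b * y)"
      using P_rec_nz Pa Pb by blast+
    have 2: "P (y / c) = (1 - y / c) * P (q * y / c)" "P (y / d) = (1 - y / d) * P (q * y / d)"
      using P_rec[of "y / c"] P_rec[of "y / d"] by (simp_all add: mult_ac)
    have G1: "G y = - a * c * d * ((1 - y / c) * (1 - y / d) * K)"
      by (simp add: G_def K_def 2)
    have G2: "G (y * q) = - a * c * d * ((1 - a * y) * (1 - b * y) * K)"
    proof -
      have "G (y * q) = - a * c * d * (P (q * y / c) * P (q * y / d) / (P (a * y * q) * P (b * y * q)))"
        by (simp add: G_def mult_ac)
      then show ?thesis
        unfolding 1 K_def by simp
    qed
    have "aa_term c d (a * q) b y = y * (1 - a * y) * K"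
      using 1(1) by (simp add: aa_term_def K_def mult_ac)
    moreover have "aa_term c d a b y = y * K"
      by (simp add: aa_term_def K_def)
    ultimately have "f y = ((1 - a * c) * (1 - a * d) * y - (1 - a * b * c * d) * (y * (1 - a * y))) * K"
      unfolding f_def by (simp only: left_diff_distrib mult.assoc)
    also have "\<dots> = G (y * q) - G y"
      unfolding G1 G2 using nz by (simp add: field_simps)
    finally show "f (e * q ^ k) = G (e * q ^ Suc k) - G (e * q ^ k)"
      by (simp add: y_def mult_ac)
  qed
  have eq: "(\<Sum>k. f (e * q ^ k)) = (1 - a * c) * (1 - a * d) * (\<Sum>k. aa_term c d a b (e * q ^ k))
      - (1 - a * b * c * d) * (\<Sum>k. aa_term c d (a * q) b (e * q ^ k))" for e
    unfolding f_def
    by (subst suminf_diff[symmetric]) (simp_all add: suminf_mult summable_aa_term summable_mult)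
  have "(\<Sum>k. f (d * q ^ k)) = (\<Sum>k. f (c * q ^ k))"
    using sums[of c] sums[of d] assms sums_unique by metis
  then show ?thesis
    unfolding eq aa_int_def by (simp add: algebra_simps)
qed

lemma aa_int_tendsto:
  "(\<lambda>n. aa_int c d (a * q ^ n) b) \<longlonglongrightarrow> aa_int c d 0 b"
proof -
  have "(\<lambda>n. \<Sum>k. aa_term c d (a * q ^ n) b (e * q ^ k)) \<longlonglongrightarrow> (\<Sum>k. aa_term c d 0 b (e * q ^ k))" for e
  proof -
    define f where "f n k = e * (P (q * (e * q ^ k) / c) * P (q * (e * q ^ k) / d)
        / (P (a * q ^ n * (e * q ^ k)) * P (b * (e * q ^ k))))" for n k
    define g where "g k = e * (P (q * (e * q ^ k) / c) * P (q * (e * q ^ k) / d)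
        / (P (0 * (e * q ^ k)) * P (b * (e * q ^ k))))" for k
    have "(\<lambda>n. \<Sum>k. q ^ k * f n k) \<longlonglongrightarrow> (\<Sum>k. q ^ k * g k)"
    proof (rule tannery_q)
      show "(\<lambda>n. f n k) \<longlonglongrightarrow> g k" for k
      proof (cases "P (b * (e * q ^ k)) = 0")
        case False
        have "(\<lambda>n. P (a * q ^ n * (e * q ^ k))) \<longlonglongrightarrow> P (0 * (e * q ^ k))"
          using tendsto_P_q_power[of "a * (e * q ^ k)"] by (simp add: mult_ac)
        then show ?thesis
          unfolding f_def g_def using False
          by (intro tendsto_mult tendsto_divide tendsto_const) auto
      qed (simp add: f_def g_def)
      have 1: "bdd2 (\<lambda>n k. inverse (P (a * q ^ n * (e * q ^ k))))"
        by (rule bdd2_inverse_P[where c = "a * e" and h = "\<lambda>n k. n + k"]) (simp add: power_add)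
      have 2: "bdd2 (\<lambda>n k. inverse (P (b * (e * q ^ k))))"
        by (rule bdd2_inverse_P[where c = "b * e" and h = "\<lambda>n k. k"]) simp
      show "bdd2 f"
        unfolding f_def by (intro bdd2_intros 1 2; simp add: divide_inverse; intro bdd2_intros)
    qed
    then show ?thesis
      by (simp add: aa_term_def f_def g_def mult_ac)
  qed
  then show ?thesis
    unfolding aa_int_def by (intro tendsto_intros)
qed

lemma P_power_tendsto_0: "(\<lambda>n. P (x * (a * q ^ n))) \<longlonglongrightarrow> 1"
  using tendsto_P_q_power[of "x * a"] by (simp add: mult_ac)

text \<open>Iterating the shift from \<open>a\<close> to \<open>a * q\<close> collects the factors
  of \<open>P (a * b * c * d)\<close> one by one, while the parameter itself tends to 0.\<close>

lemma aa_int_reduce: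
  assumes nz: "c \<noteq> 0" "d \<noteq> 0" and Pnz: "P (a * c) \<noteq> 0" "P (b * c) \<noteq> 0" "P (a * d) \<noteq> 0" "P (b * d) \<noteq> 0"
  shows "P (a * c) * P (a * d) * aa_int c d a b = P (a * b * c * d) * aa_int c d 0 b"
proof -
  define h where "h a = P (a * c) * P (a * d) * aa_int c d a b" for a
  have h: "h a = qpoch q (a * b * c * d) n * h (a * q ^ n)" for n
  proof (induction n)
    case (Suc n)
    define a' where "a' = a * q ^ n"
    have nz': "P (a' * c) \<noteq> 0" "P (a' * d) \<noteq> 0"
      using P_nz_shift[of "a * c" n] P_nz_shift[of "a * d" n] Pnz by (simp_all add: a'_def mult_ac)
    have "h a' = P (a' * c * q) * P (a' * d * q) * ((1 - a' * c) * (1 - a' * d) * aa_int c d a' b)"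
      unfolding h_def using P_rec[of "a' * c"] P_rec[of "a' * d"] by simp
    also have "\<dots> = (1 - a' * b * c * d) * h (a' * q)"
      using aa_int_shift[of c d a' b] nz nz' Pnz by (simp add: h_def mult_ac)
    finally show ?case
      using Suc by (simp add: a'_def qpoch_Suc mult_ac)
  qed simp
  have "(\<lambda>n. h (a * q ^ n)) \<longlonglongrightarrow> 1 * 1 * aa_int c d 0 b"
    unfolding h_def using P_power_tendsto_0[of c a] P_power_tendsto_0[of d a]
    by (intro tendsto_intros aa_int_tendsto) (simp_all add: mult.commute)
  then have "(\<lambda>n. qpoch q (a * b * c * d) n * h (a * q ^ n)) \<longlonglongrightarrow> P (a * b * c * d) * (1 * 1 * aa_int c d 0 b)"
    by (intro tendsto_intros qpoch_tendsto_P)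
  then have "(\<lambda>n. h a) \<longlonglongrightarrow> P (a * b * c * d) * aa_int c d 0 b"
    by (simp flip: h)
  then show ?thesis
    unfolding h_def by (simp add: LIMSEQ_const_iff)
qed

text \<open>Reduction in \<open>a\<close> and then in \<open>b\<close> leaves the single unknown
  \<open>aa_int c d 0 0\<close>, which one explicitly computable choice of \<open>a\<close> and
  \<open>b\<close> determines.\<close>

theorem andrews_askey:
  assumes nz: "c \<noteq> 0" "d \<noteq> 0" and cd: "d / c \<notin> Zq"
    and Pnz: "P (a * c) \<noteq> 0" "P (b * c) \<noteq> 0" "P (a * d) \<noteq> 0" "P (b * d) \<noteq> 0"
  shows "aa_int c d a b = - c * P q * th (d / c) * P (a * b * c * d)
      / (P (a * c) * P (a * d) * P (b * c) * P (b * d))"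
proof -
  have gen: "P (a * c) * P (a * d) * P (b * c) * P (b * d) * aa_int c d a b = P (a * b * c * d) * aa_int c d 0 0"
    if Pnz: "P (a * c) \<noteq> 0" "P (b * c) \<noteq> 0" "P (a * d) \<noteq> 0" "P (b * d) \<noteq> 0" for a b
  proof -
    have "P (a * c) * P (a * d) * aa_int c d a b = P (a * b * c * d) * aa_int c d b 0"
      using aa_int_reduce[OF nz] Pnz aa_int_commute by metis
    moreover have "P (b * c) * P (b * d) * aa_int c d b 0 = aa_int c d 0 0"
      using aa_int_reduce[OF nz, of b 0] Pnz by simp
    ultimately show ?thesis
      by (metis (no_types, opaque_lifting) mult.assoc mult.left_commute)
  qed
  have dc: "P (q * d / c) \<noteq> 0" "P (q * c / d) \<noteq> 0" "P q \<noteq> 0"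
  proof -
    show "P (q * d / c) \<noteq> 0"
      using cd Zq_cancel(2)[of "d / c"] by (intro P_nz) (simp add: mult.commute)
    have "c / d \<notin> Zq"
      using cd Zq_inverse_iff[of "d / c"] by simp
    then show "P (q * c / d) \<noteq> 0"
      using Zq_cancel(2)[of "c / d"] by (intro P_nz) (simp add: mult.commute)
  qed (rule P_q_nz)
  \<comment> \<open>For \<open>a = q / c\<close> and \<open>b = q / d\<close> the products cancel
    and the integrand is just \<open>y\<close>, so both sums are geometric series.\<close>
  have base: "aa_int c d (q / c) (q / d) = (d - c) / (1 - q)"
  proof -
    have gs: "(\<lambda>k. e * q ^ k) sums (e * (1 / (1 - q)))" for e
      using norm_q by (intro sums_mult geometric_sums)
    have "aa_term c d (q / c) (q / d) (e * q ^ k) = e * q ^ k" if e: "e = c \<or> e = d" for e k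
    proof -
      have "P (q * c / c * q ^ k) \<noteq> 0" "P (q * d / d * q ^ k) \<noteq> 0" "P (q * c / d * q ^ k) \<noteq> 0" "P (q * d / c * q ^ k) \<noteq> 0"
        using dc nz by (auto intro!: P_nz_shift simp del: times_divide_eq_left)
      then have "P (q * (e * q ^ k) / c) \<noteq> 0" "P (q * (e * q ^ k) / d) \<noteq> 0"
        using e nz by (auto simp: mult_ac)
      then show ?thesis
        by (simp add: aa_term_def)
    qed
    then have "(\<Sum>k. aa_term c d (q / c) (q / d) (e * q ^ k)) = e * (1 / (1 - q))" if "e = c \<or> e = d" for e
      using gs[of e] that by (simp add: sums_iff)
    then show ?thesis
      unfolding aa_int_def by (simp add: diff_divide_distrib)
  qed
  have q1: "1 - q \<noteq> 0"
    using norm_q by auto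
  have Pq: "P q = (1 - q) * P (q * q)"
    by (rule P_rec)
  have "P q * P (q * d / c) * P (q * c / d) * P q * ((d - c) / (1 - q)) = P (q * q) * aa_int c d 0 0"
    using gen[of "q / c" "q / d"] nz dc base by (simp add: mult_ac)
  moreover have "P q * P (q * d / c) * P (q * c / d) * P q * ((d - c) / (1 - q))
      = P (q * q) * (P (q * d / c) * P (q * c / d) * P q * (d - c))"
    by (subst (1) Pq) (use q1 in simp)
  moreover have "P (q * q) \<noteq> 0"
    using Pq dc by auto
  ultimately have "aa_int c d 0 0 = P (q * d / c) * P (q * c / d) * P q * (d - c)"
    by simp
  also have "\<dots> = - c * P q * th (d / c)"
  proof -
    have "- c * P (d / c) = (d - c) * P (q * d / c)"
      using P_rec[of "d / c"] nz by (simp add: field_simps)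
    moreover have "- c * P q * th (d / c) = P q * P (q * c / d) * (- c * P (d / c))"
      by (simp add: th_def)
    ultimately show ?thesis
      by simp
  qed
  finally have *: "aa_int c d 0 0 = - c * P q * th (d / c)" .
  show ?thesis
    using gen[OF Pnz] Pnz unfolding * by (simp add: field_simps)
qed

end

subsection \<open>The nonterminating ${}_8\phi_7$ sum\<close>

text \<open>Because the product of the \<open>v\<close>s is 1, the difference \<open>f\<close> of
  the two sextic products satisfies \<open>x^6 f(1/x) = - f(x)\<close>, and its coefficients of
  degree 0 and 6 vanish. So \<open>f\<close> is \<open>x (1 - x^2)\<close> times a palindromic
  quadratic. Such quadratics are spanned by \<open>(1 - x / v2) (1 - v2 x)\<close> and
  \<open>(1 - x / v0) (1 - v0 x)\<close>, and evaluation at \<open>x = v0\<close> and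
  \<open>x = v2\<close> gives the two coefficients.\<close>

lemma well_poised_polynomial:
  fixes v0 v1 v2 v3 v4 v5 x :: complex
  assumes "v0 * v1 * v2 * v3 * v4 * v5 = 1"
  shows "v0 * v2 * (v2 - v0) * ((1 - v0 * x) * (1 - v1 * x) * (1 - v2 * x) * (1 - v3 * x) * (1 - v4 * x) * (1 - v5 * x)
      - (1 - x / v0) * (1 - x / v1) * (1 - x / v2) * (1 - x / v3) * (1 - x / v4) * (1 - x / v5))
    = x * (1 - x\<^sup>2) * (
        v2\<^sup>2 * ((1 - v1 * v0) * (1 - v3 * v0) * (1 - v4 * v0) * (1 - v5 * v0)) * ((1 - x / v2) * (1 - v2 * x))
      - v0\<^sup>2 * ((1 - v1 * v2) * (1 - v3 * v2) * (1 - v4 * v2) * (1 - v5 * v2)) * ((1 - x / v0) * (1 - v0 * x)))"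
proof -
  have nz: "v0 \<noteq> 0" "v1 \<noteq> 0" "v2 \<noteq> 0" "v3 \<noteq> 0" "v4 \<noteq> 0" "v5 \<noteq> 0"
    using assms by auto
  \<comment> \<open>The four remaining \<open>v\<close>s enter only through their elementary
    symmetric functions, of which the fourth is \<open>1 / w\<close>. This leaves an identity in six
    variables.\<close>
  define e1 e2 e3 where "e1 = v1 + v3 + v4 + v5"
    and "e2 = v1 * v3 + v1 * v4 + v1 * v5 + v3 * v4 + v3 * v5 + v4 * v5"
    and "e3 = v1 * v3 * v4 + v1 * v3 * v5 + v1 * v4 * v5 + v3 * v4 * v5"
  define w where "w = v0 * v2"
  have w: "w * (v1 * v3 * v4 * v5) = 1"
    using assms by (simp add: w_def mult_ac)
  then have e4: "v1 * v3 * v4 * v5 = 1 / w"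
    by (metis nonzero_eq_divide_eq mult.commute mult_zero_left zero_neq_one)
  have A: "(1 - v1 * y) * (1 - v3 * y) * (1 - v4 * y) * (1 - v5 * y)
      = 1 - e1 * y + e2 * y\<^sup>2 - e3 * y ^ 3 + y ^ 4 / w" for y
  proof -
    have "(1 - v1 * y) * (1 - v3 * y) * (1 - v4 * y) * (1 - v5 * y)
      = 1 - e1 * y + e2 * y\<^sup>2 - e3 * y ^ 3 + (v1 * v3 * v4 * v5) * y ^ 4"
      unfolding e1_def e2_def e3_def by algebra
    then show ?thesis by (simp add: e4)
  qed
  have B: "(1 - x / v1) * (1 - x / v3) * (1 - x / v4) * (1 - x / v5)
      = 1 - w * e3 * x + w * e2 * x\<^sup>2 - w * e1 * x ^ 3 + w * x ^ 4"
  proof -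
    have "(1 - x / v1) * (1 - x / v3) * (1 - x / v4) * (1 - x / v5)
      = w * (v1 * v3 * v4 * v5) * ((1 - x / v1) * (1 - x / v3) * (1 - x / v4) * (1 - x / v5))"
      by (simp add: w)
    also have "\<dots> = w * ((v1 - x) * (v3 - x) * (v4 - x) * (v5 - x))"
      using nz by (simp add: field_simps)
    also have "\<dots> = w * (v1 * v3 * v4 * v5) - w * e3 * x + w * e2 * x\<^sup>2 - w * e1 * x ^ 3 + w * x ^ 4"
      unfolding e1_def e2_def e3_def by algebra
    finally show ?thesis
      unfolding w .
  qed
  have "v0 * v2 * (v2 - v0) * ((1 - v0 * x) * (1 - v2 * x) * (1 - e1 * x + e2 * x\<^sup>2 - e3 * x ^ 3 + x ^ 4 / w)
      - (1 - x / v0) * (1 - x / v2) * (1 - w * e3 * x + w * e2 * x\<^sup>2 - w * e1 * x ^ 3 + w * x ^ 4))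
    = x * (1 - x\<^sup>2) * (
        v2\<^sup>2 * (1 - e1 * v0 + e2 * v0\<^sup>2 - e3 * v0 ^ 3 + v0 ^ 4 / w) * ((1 - x / v2) * (1 - v2 * x))
      - v0\<^sup>2 * (1 - e1 * v2 + e2 * v2\<^sup>2 - e3 * v2 ^ 3 + v2 ^ 4 / w) * ((1 - x / v0) * (1 - v0 * x)))"
    unfolding w_def using nz by (simp add: divide_simps) algebra
  then show ?thesis
    unfolding A[symmetric] B[symmetric] by (simp only: mult_ac)
qed

context q_disc begin

text \<open>In the certificate \<open>G\<close>, passing from \<open>x\<close> to
  \<open>x * q\<close> trades the factors \<open>1 - x / v\<close> for \<open>1 - v x\<close>, so
  the q-difference of \<open>G\<close> is the left side of the polynomial identity. As the
  \<open>v\<close>s have product 1, both parameter lists have product \<open>q\<close>, the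
  balancing of the 8phi7 sum.\<close>

lemma contiguous_Q:
  assumes prod: "v0 * v1 * v2 * v3 * v4 * v5 = 1"
    and P0: "\<And>v. v \<in> {v0, v1, v2, v3, v4, v5} \<Longrightarrow> P (v * v0) \<noteq> 0"
    and P1: "\<And>v. v \<in> {v0, v1, v2, v3, v4, v5} \<Longrightarrow> P (v * v1) \<noteq> 0"
  shows "v2\<^sup>2 * ((1 - v1 * v0) * (1 - v3 * v0) * (1 - v4 * v0) * (1 - v5 * v0)) * Q [v0, v1, q * v2, v3, v4, v5] v0 v1
    = v0\<^sup>2 * ((1 - v1 * v2) * (1 - v3 * v2) * (1 - v4 * v2) * (1 - v5 * v2)) * Q [q * v0, v1, v2, v3, v4, v5] (q * v0) v1"
proof -
  have nz: "v0 \<noteq> 0" "v1 \<noteq> 0" "v2 \<noteq> 0" "v3 \<noteq> 0" "v4 \<noteq> 0" "v5 \<noteq> 0"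
    using prod by auto
  define A0 A2 where "A0 = (1 - v1 * v0) * (1 - v3 * v0) * (1 - v4 * v0) * (1 - v5 * v0)"
    and "A2 = (1 - v1 * v2) * (1 - v3 * v2) * (1 - v4 * v2) * (1 - v5 * v2)"
  define \<kappa> where "\<kappa> = v0 * v2 * (v2 - v0)"
  define G where "G x = \<kappa> * (P (x / v0) / P (v0 * x) * (P (x / v1) / P (v1 * x)) * (P (x / v2) / P (v2 * x))
    * (P (x / v3) / P (v3 * x)) * (P (x / v4) / P (v4 * x)) * (P (x / v5) / P (v5 * x)))" for x
  define f where "f x = v2\<^sup>2 * A0 * F [v0, v1, q * v2, v3, v4, v5] x - v0\<^sup>2 * A2 * F [q * v0, v1, v2, v3, v4, v5] x" for x
  have sums: "(\<lambda>k. f (c * q ^ k)) sums \<kappa>" if c: "c = v0 \<or> c = v1" for c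
  proof (rule sums_lattice_telescope[where G = G])
    have "(\<lambda>k. \<kappa> * (P (c / v0 * q ^ k) / P (v0 * c * q ^ k) * (P (c / v1 * q ^ k) / P (v1 * c * q ^ k)) * (P (c / v2 * q ^ k) / P (v2 * c * q ^ k))
    * (P (c / v3 * q ^ k) / P (v3 * c * q ^ k)) * (P (c / v4 * q ^ k) / P (v4 * c * q ^ k)) * (P (c / v5 * q ^ k) / P (v5 * c * q ^ k))))
      \<longlonglongrightarrow> \<kappa> * (1 / 1 * (1 / 1) * (1 / 1) * (1 / 1) * (1 / 1) * (1 / 1))"
      by (intro tendsto_intros tendsto_P_q_power) simp_all
    then show "(\<lambda>k. G (c * q ^ k)) \<longlonglongrightarrow> \<kappa>"
      by (simp add: G_def mult_ac)
    show "G c = 0"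
      using c nz by (auto simp: G_def)
    fix k
    define x where "x = c * q ^ k"
    have Pv: "P (v * x) \<noteq> 0" if "v \<in> {v0, v1, v2, v3, v4, v5}" for v
      using P_nz_shift[of "v * v0" k] P_nz_shift[of "v * v1" k] P0[OF that] P1[OF that] c
      by (auto simp: x_def mult_ac)
    define g where "g v = P (q * x / v) / P (v * x)" for v
    define C where "C = g v0 * g v1 * g v2 * g v3 * g v4 * g v5"
    have g1: "P (x / v) / P (v * x) = (1 - x / v) * g v" for v
      using P_rec[of "x / v"] by (simp add: g_def mult_ac)
    have g2: "P (x * q / v) / P (v * (x * q)) = (1 - v * x) * g v" if "v \<in> {v0, v1, v2, v3, v4, v5}" for v
      using P_rec_nz[OF Pv[OF that]] by (simp add: g_def mult_ac)
    have g3: "P (q * x / (q * v)) / P (q * v * x) = (1 - x / v) * (1 - v * x) * g v"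
      if "v \<in> {v0, v1, v2, v3, v4, v5}" for v
      using P_rec_nz[OF Pv[OF that]] P_rec[of "x / v"] by (simp add: g_def mult_ac)
    have G1: "G x = \<kappa> * ((1 - x / v0) * (1 - x / v1) * (1 - x / v2) * (1 - x / v3) * (1 - x / v4) * (1 - x / v5)) * C"
      unfolding G_def g1 C_def by simp
    have G2: "G (x * q) = \<kappa> * ((1 - v0 * x) * (1 - v1 * x) * (1 - v2 * x) * (1 - v3 * x) * (1 - v4 * x) * (1 - v5 * x)) * C"
      unfolding G_def C_def by (simp add: g2)
    have F1: "F [v0, v1, q * v2, v3, v4, v5] x = x * (1 - x\<^sup>2) * ((1 - x / v2) * (1 - v2 * x)) * C"
    proof -
      have "F [v0, v1, q * v2, v3, v4, v5] x
          = x * (1 - x\<^sup>2) * (g v0 * g v1 * (P (q * x / (q * v2)) / P (q * v2 * x)) * g v3 * g v4 * g v5)"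
        by (simp only: F_def g_def list.map prod_list.Cons prod_list.Nil mult_1_right mult.assoc)
      then show ?thesis
        by (subst (asm) g3, simp, simp only: C_def mult_ac)
    qed
    have F2: "F [q * v0, v1, v2, v3, v4, v5] x = x * (1 - x\<^sup>2) * ((1 - x / v0) * (1 - v0 * x)) * C"
    proof -
      have "F [q * v0, v1, v2, v3, v4, v5] x
          = x * (1 - x\<^sup>2) * ((P (q * x / (q * v0)) / P (q * v0 * x)) * g v1 * g v2 * g v3 * g v4 * g v5)"
        by (simp only: F_def g_def list.map prod_list.Cons prod_list.Nil mult_1_right mult.assoc)
      then show ?thesis
        by (subst (asm) g3, simp, simp only: C_def mult_ac)
    qed
    have "f x = (x * (1 - x\<^sup>2) * (v2\<^sup>2 * A0 * ((1 - x / v2) * (1 - v2 * x)) - v0\<^sup>2 * A2 * ((1 - x / v0) * (1 - v0 * x)))) * C"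
    proof -
      have "a * (y * r * C) - b * (y * s * C) = (y * (a * r - b * s)) * C" for a b r s y
        by (simp add: algebra_simps)
      then show ?thesis
        unfolding f_def F1 F2 .
    qed
    also have "\<dots> = G (x * q) - G x"
      unfolding G1 G2 A0_def A2_def well_poised_polynomial[OF prod, of x, symmetric] \<kappa>_def
      by (simp only: left_diff_distrib right_diff_distrib mult.assoc)
    finally show "f (c * q ^ k) = G (c * q ^ Suc k) - G (c * q ^ k)"
      by (simp add: x_def mult_ac)
  qed
  have eq: "(\<Sum>k. f (c * q ^ k)) = v2\<^sup>2 * A0 * S [v0, v1, q * v2, v3, v4, v5] c - v0\<^sup>2 * A2 * S [q * v0, v1, v2, v3, v4, v5] c" for c
    unfolding f_def S_def
    by (subst suminf_diff[symmetric]) (simp_all add: suminf_mult summable_F summable_mult)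
  \<comment> \<open>The lattice from \<open>v0\<close> has one point more than the lattice from
    \<open>q * v0\<close>; at that point the parameter \<open>q * v0\<close> contributes the factor
    \<open>P 1 = 0\<close>.\<close>
  have S0: "S [q * v0, v1, v2, v3, v4, v5] v0 = S [q * v0, v1, v2, v3, v4, v5] (q * v0)"
  proof -
    have "F [q * v0, v1, v2, v3, v4, v5] (v0 * q ^ 0) = 0"
      using nz by (simp add: F_def)
    then show ?thesis
      using suminf_split_head[OF summable_F[of "[q * v0, v1, v2, v3, v4, v5]" v0]]
      unfolding S_def by (simp add: mult_ac)
  qed
  have "(\<Sum>k. f (v1 * q ^ k)) - (\<Sum>k. f (v0 * q ^ k)) = \<kappa> - \<kappa>"
    using sums[of v0] sums[of v1] by (simp add: sums_iff)
  then show ?thesis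
    unfolding eq S0 Q_def A0_def[symmetric] A2_def[symmetric] by (simp add: algebra_simps)
qed

text \<open>The product side of Bailey's nonterminating extension of Jackson's 8phi7 sum, in
  symmetric parameters.\<close>

definition R8 :: "complex \<Rightarrow> complex \<Rightarrow> complex \<Rightarrow> complex \<Rightarrow> complex \<Rightarrow> complex \<Rightarrow> complex" where
  "R8 u0 u1 u2 u3 u4 u5 = - u0 * P q * th (u1 / u0)
    * (P (q / (u2 * u3)) * P (q / (u2 * u4)) * P (q / (u2 * u5)) * P (q / (u3 * u4)) * P (q / (u3 * u5)) * P (q / (u4 * u5)))
    / (P (u0 * u1) * (P (u0 * u2) * P (u0 * u3) * P (u0 * u4) * P (u0 * u5))
        * (P (u1 * u2) * P (u1 * u3) * P (u1 * u4) * P (u1 * u5)))"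

lemma R8_swap: "u0 \<noteq> 0 \<Longrightarrow> u1 \<noteq> 0 \<Longrightarrow> R8 u1 u0 u3 u2 u4 u5 = - R8 u0 u1 u2 u3 u4 u5"
proof -
  assume nz: "u0 \<noteq> 0" "u1 \<noteq> 0"
  have "u1 * th (u0 / u1) = - (u0 * th (u1 / u0))"
    using th_inverse[of "u1 / u0"] nz by simp
  then have "u1 * th (u0 / u1) * Y = - (u0 * th (u1 / u0) * Y)" for Y
    by simp
  from this[of "- P q
    * (P (q / (u2 * u3)) * P (q / (u2 * u4)) * P (q / (u2 * u5)) * P (q / (u3 * u4)) * P (q / (u3 * u5)) * P (q / (u4 * u5)))
    / (P (u0 * u1) * (P (u0 * u2) * P (u0 * u3) * P (u0 * u4) * P (u0 * u5))
        * (P (u1 * u2) * P (u1 * u3) * P (u1 * u4) * P (u1 * u5)))"]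
  show ?thesis
    unfolding R8_def by (simp add: mult_ac)
qed

text \<open>The closed form obeys the recurrence of \<open>contiguous_Q\<close>. Each factor
  \<open>P (q / (q * v2 * v))\<close> releases a monomial \<open>1 / (v2 * v)\<close>, and the
  product condition turns the three monomials together into \<open>v0 * v1 / v2^2\<close>.\<close>

lemma contiguous_R8:
  assumes prod: "v0 * v1 * v2 * v3 * v4 * v5 = 1"
    and nz1: "1 - v0 * v1 \<noteq> 0" "1 - v0 * v3 \<noteq> 0" "1 - v0 * v4 \<noteq> 0" "1 - v0 * v5 \<noteq> 0"
    and nz2: "P (v1 * v2) \<noteq> 0"
  shows "v2\<^sup>2 * ((1 - v1 * v0) * (1 - v3 * v0) * (1 - v4 * v0) * (1 - v5 * v0)) * R8 v0 v1 (q * v2) v3 v4 v5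
    = v0\<^sup>2 * ((1 - v1 * v2) * (1 - v3 * v2) * (1 - v4 * v2) * (1 - v5 * v2)) * R8 (q * v0) v1 v2 v3 v4 v5"
proof -
  have nz: "v0 \<noteq> 0" "v1 \<noteq> 0" "v2 \<noteq> 0" "v3 \<noteq> 0" "v4 \<noteq> 0" "v5 \<noteq> 0"
    using prod by auto
  define Z where "Z = P q * (P (q / (v2 * v3)) * P (q / (v2 * v4)) * P (q / (v2 * v5)) * P (q / (v3 * v4)) * P (q / (v3 * v5)) * P (q / (v4 * v5)))
    / (P (q * (v0 * v1)) * (P (q * (v0 * v2)) * P (q * (v0 * v3)) * P (q * (v0 * v4)) * P (q * (v0 * v5)))
        * (P (v1 * v2) * P (v1 * v3) * P (v1 * v4) * P (v1 * v5)))"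
  have r: "P (q / (q * v2 * v)) = - ((1 - v2 * v) / (v2 * v)) * P (q / (v2 * v))" if "v \<noteq> 0" for v
    using P_rec[of "1 / (v2 * v)"] that nz by (simp add: field_simps)
  have s: "P (v0 * v) = (1 - v0 * v) * P (q * (v0 * v))" for v
    using P_rec[of "v0 * v"] by (simp add: mult_ac)
  have t: "P (v1 * (q * v2)) = P (v1 * v2) / (1 - v1 * v2)"
    using P_rec_nz[OF nz2] by (simp add: mult_ac)
  have "R8 v0 v1 (q * v2) v3 v4 v5 = Z * (- v0 * th (v1 / v0)) * (1 - v1 * v2)
      * (- ((1 - v2 * v3) / (v2 * v3)) * - ((1 - v2 * v4) / (v2 * v4)) * - ((1 - v2 * v5) / (v2 * v5)))
      / ((1 - v0 * v1) * ((1 - v0 * v3) * (1 - v0 * v4) * (1 - v0 * v5)))"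
    unfolding R8_def r[OF nz(4)] r[OF nz(5)] r[OF nz(6)] s[of v1] s[of v3] s[of v4] s[of v5] t Z_def
    by (simp add: mult_ac)
  moreover have "v0 * v1 * v2 * (v3 * v4 * v5) = 1"
    using prod by (simp add: mult_ac)
  then have "1 / (v2 * v3 * (v2 * v4) * (v2 * v5)) = v0 * v1 / v2\<^sup>2"
    using nz by (simp add: divide_simps power2_eq_square mult_ac)
  ultimately have L: "v2\<^sup>2 * ((1 - v1 * v0) * (1 - v3 * v0) * (1 - v4 * v0) * (1 - v5 * v0)) * R8 v0 v1 (q * v2) v3 v4 v5
    = Z * v0\<^sup>2 * v1 * th (v1 / v0) * ((1 - v1 * v2) * (1 - v3 * v2) * (1 - v4 * v2) * (1 - v5 * v2))"
  proof -
    assume R: "R8 v0 v1 (q * v2) v3 v4 v5 = Z * (- v0 * th (v1 / v0)) * (1 - v1 * v2)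
      * (- ((1 - v2 * v3) / (v2 * v3)) * - ((1 - v2 * v4) / (v2 * v4)) * - ((1 - v2 * v5) / (v2 * v5)))
      / ((1 - v0 * v1) * ((1 - v0 * v3) * (1 - v0 * v4) * (1 - v0 * v5)))"
    assume m: "1 / (v2 * v3 * (v2 * v4) * (v2 * v5)) = v0 * v1 / v2\<^sup>2"
    have "v2\<^sup>2 * ((1 - v1 * v0) * (1 - v3 * v0) * (1 - v4 * v0) * (1 - v5 * v0)) * R8 v0 v1 (q * v2) v3 v4 v5
      = v2\<^sup>2 * (Z * v0 * th (v1 / v0)) * ((1 - v1 * v2) * (1 - v3 * v2) * (1 - v4 * v2) * (1 - v5 * v2)) * (1 / (v2 * v3 * (v2 * v4) * (v2 * v5)))"
      unfolding R using nz1 by (simp add: mult_ac)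
    then show ?thesis
      unfolding m using nz by (simp add: power2_eq_square mult_ac)
  qed
  have "th (v1 / (q * v0)) = - (v1 / (q * v0)) * th (v1 / v0)"
    using th_div_q[of "v1 / v0"] nz by (simp add: mult_ac)
  then have "R8 (q * v0) v1 v2 v3 v4 v5 = Z * (v1 * th (v1 / v0))"
    unfolding R8_def Z_def using nz by (simp add: mult_ac)
  then show ?thesis
    unfolding L by (simp add: mult_ac)
qed

text \<open>After the substitution of \<open>q ^ n * x\<close> for the variable, the numerators
  belonging to \<open>u0\<close>, \<open>u1\<close> and the denominators belonging to
  \<open>u2\<close>, \<open>u3\<close> no longer depend on \<open>n\<close>. Every other product has
  an argument containing \<open>q ^ n\<close> or \<open>q ^ (n + n)\<close> and tends to 1. What
  survives is the Andrews-Askey integrand.\<close>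

lemma Q_scaling_tendsto:
  assumes nz: "u0 \<noteq> 0" "u1 \<noteq> 0" "u2 \<noteq> 0" "u3 \<noteq> 0"
  shows "(\<lambda>n. S [q ^ n * u0, q ^ n * u1, u2 / q ^ n, u3 / q ^ n, u4, u5] (q ^ n * c) / q ^ n)
    \<longlonglongrightarrow> (\<Sum>k. aa_term u0 u1 u2 u3 (c * q ^ k))"
proof -
  define f where "f n k = c * (1 - (q ^ n * c * q ^ k) * (q ^ n * c * q ^ k))
    * (P (q * (c * q ^ k) / u0) * P (q * (c * q ^ k) / u1) * inverse (P (u2 * c * q ^ k)) * inverse (P (u3 * c * q ^ k)))
    * (P (q * c * q ^ k * q ^ (n + n) / u2) * P (q * c * q ^ k * q ^ (n + n) / u3)
       * P (q * c * q ^ k * q ^ n / u4) * P (q * c * q ^ k * q ^ n / u5))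
    * (inverse (P (u0 * c * q ^ k * q ^ (n + n))) * inverse (P (u1 * c * q ^ k * q ^ (n + n)))
       * inverse (P (u4 * c * q ^ k * q ^ n)) * inverse (P (u5 * c * q ^ k * q ^ n)))" for n k
  define g where "g k = c * (P (q * (c * q ^ k) / u0) * P (q * (c * q ^ k) / u1) * inverse (P (u2 * c * q ^ k)) * inverse (P (u3 * c * q ^ k)))" for k
  have S: "S [q ^ n * u0, q ^ n * u1, u2 / q ^ n, u3 / q ^ n, u4, u5] (q ^ n * c) / q ^ n = (\<Sum>k. q ^ k * f n k)" for n
  proof -
    have "F [q ^ n * u0, q ^ n * u1, u2 / q ^ n, u3 / q ^ n, u4, u5] (q ^ n * c * q ^ k) / q ^ n = q ^ k * f n k" for k
    proof -
      have a: "q * (q ^ n * c * q ^ k) / (q ^ n * u) = q * (c * q ^ k) / u"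
        "q ^ n * u * (q ^ n * c * q ^ k) = u * c * q ^ k * q ^ (n + n)"
        "q * (q ^ n * c * q ^ k) / (u / q ^ n) = q * c * q ^ k * q ^ (n + n) / u"
        "u / q ^ n * (q ^ n * c * q ^ k) = u * c * q ^ k"
        "q * (q ^ n * c * q ^ k) / u = q * c * q ^ k * q ^ n / u"
        "u * (q ^ n * c * q ^ k) = u * c * q ^ k * q ^ n" for u
        by (simp_all add: power_add)
      have "F [q ^ n * u0, q ^ n * u1, u2 / q ^ n, u3 / q ^ n, u4, u5] (q ^ n * c * q ^ k)
        = q ^ n * c * q ^ k * (1 - (q ^ n * c * q ^ k)\<^sup>2) *
          (P (q * (c * q ^ k) / u0) / P (u0 * c * q ^ k * q ^ (n + n)) *
          (P (q * (c * q ^ k) / u1) / P (u1 * c * q ^ k * q ^ (n + n)) *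
          (P (q * c * q ^ k * q ^ (n + n) / u2) / P (u2 * c * q ^ k) *
          (P (q * c * q ^ k * q ^ (n + n) / u3) / P (u3 * c * q ^ k) *
          (P (q * c * q ^ k * q ^ n / u4) / P (u4 * c * q ^ k * q ^ n) *
          (P (q * c * q ^ k * q ^ n / u5) / P (u5 * c * q ^ k * q ^ n)))))))"
        unfolding F_def list.map prod_list.Cons prod_list.Nil mult_1_right
        by (simp only: a(1,2)[of u0] a(1,2)[of u1] a(3,4)[of u2] a(3,4)[of u3] a(5,6)[of u4] a(5,6)[of u5])
      also have "\<dots> = q ^ n * (q ^ k * f n k)"
        unfolding f_def divide_inverse power2_eq_square by (simp only: mult_ac)
      finally show ?thesis by simp
    qed
    then show ?thesis
      unfolding S_def suminf_divide[OF summable_F, symmetric] by simp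
  qed
  have "(\<lambda>n. \<Sum>k. q ^ k * f n k) \<longlonglongrightarrow> (\<Sum>k. q ^ k * g k)"
  proof (rule tannery_q)
    fix k
    have q2: "(\<lambda>n. q ^ (n + n)) \<longlonglongrightarrow> 0"
      using tendsto_mult[OF tendsto_q_power tendsto_q_power] by (simp add: power_add)
    have p1: "(\<lambda>n. P (z * q ^ (n + n))) \<longlonglongrightarrow> 1" for z
      using tendsto_P[OF tendsto_mult[OF tendsto_const[of z] q2]] by simp
    have p2: "(\<lambda>n. P (z * q ^ (n + n) / w)) \<longlonglongrightarrow> 1" "(\<lambda>n. P (z * q ^ n / w)) \<longlonglongrightarrow> 1" for z w
      using p1[of "z / w"] tendsto_P_q_power[of "z / w"] by simp_all
    have s: "(\<lambda>n. q ^ n * c * q ^ k) \<longlonglongrightarrow> 0"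
      using tendsto_mult[OF tendsto_mult[OF tendsto_q_power tendsto_const[of c]] tendsto_const[of "q ^ k"]] by simp
    let ?K = "P (q * (c * q ^ k) / u0) * P (q * (c * q ^ k) / u1) * inverse (P (u2 * c * q ^ k)) * inverse (P (u3 * c * q ^ k))"
    have "(\<lambda>n. f n k) \<longlonglongrightarrow> c * (1 - 0 * 0) * ?K * (1 * 1 * 1 * 1) * (inverse 1 * inverse 1 * inverse 1 * inverse 1)"
      unfolding f_def by (intro tendsto_mult tendsto_diff tendsto_const p1 p2 tendsto_inverse tendsto_P_q_power s) simp_all
    then show "(\<lambda>n. f n k) \<longlonglongrightarrow> g k"
      by (simp add: g_def)
  next
    have i1: "bdd2 (\<lambda>n k. inverse (P (z * c * q ^ k)))" for z
      by (rule bdd2_inverse_P[where c = "z * c" and h = "\<lambda>n k. k"]) simp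
    have i2: "bdd2 (\<lambda>n k. inverse (P (z * c * q ^ k * q ^ (n + n))))" for z
      by (rule bdd2_inverse_P[where c = "z * c" and h = "\<lambda>n k. k + (n + n)"]) (simp add: power_add)
    have i3: "bdd2 (\<lambda>n k. inverse (P (z * c * q ^ k * q ^ n)))" for z
      by (rule bdd2_inverse_P[where c = "z * c" and h = "\<lambda>n k. k + n"]) (simp add: power_add)
    have d: "bdd2 (\<lambda>n k. x n k / w)" if "bdd2 x" for x w
      using bdd2_mult[OF that bdd2_const[of "inverse w"]] by (simp add: divide_inverse)
    show "bdd2 f"
      unfolding f_def by (intro bdd2_const bdd2_mult bdd2_diff bdd2_q_power bdd2_P d i1 i2 i3)
  qed
  moreover have "(\<Sum>k. q ^ k * g k) = (\<Sum>k. aa_term u0 u1 u2 u3 (c * q ^ k))"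
    unfolding g_def aa_term_def by (simp add: divide_inverse mult_ac)
  ultimately show ?thesis
    unfolding S by simp
qed

text \<open>The quotient of the two sides does not change when a factor \<open>q\<close> is moved
  from \<open>u2\<close> to \<open>u0\<close> or from \<open>u3\<close> to \<open>u1\<close>. After
  \<open>n\<close> such moves and division by \<open>q ^ n\<close>, both sides tend to the same
  nonzero Andrews-Askey value, so the quotient is 1.\<close>

theorem nonterminating_8phi7:
  assumes prod: "u0 * u1 * u2 * u3 * u4 * u5 = q"
    and gen: "u1 / u0 \<notin> Zq" "u0 * u0 \<notin> Zq" "u1 * u1 \<notin> Zq" "u0 * u1 \<notin> Zq"
      "u0 * u2 \<notin> Zq" "u0 * u3 \<notin> Zq" "u0 * u4 \<notin> Zq" "u0 * u5 \<notin> Zq"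
      "u1 * u2 \<notin> Zq" "u1 * u3 \<notin> Zq" "u1 * u4 \<notin> Zq" "u1 * u5 \<notin> Zq"
      "u2 * u3 \<notin> Zq" "u2 * u4 \<notin> Zq" "u2 * u5 \<notin> Zq" "u3 * u4 \<notin> Zq" "u3 * u5 \<notin> Zq" "u4 * u5 \<notin> Zq"
  shows "Q [u0, u1, u2, u3, u4, u5] u0 u1 = R8 u0 u1 u2 u3 u4 u5"
proof -
  have nz: "u0 \<noteq> 0" "u1 \<noteq> 0" "u2 \<noteq> 0" "u3 \<noteq> 0" "u4 \<noteq> 0" "u5 \<noteq> 0"
    using prod by auto
  \<comment> \<open>The hypotheses in a form that both the shift and the swap preserve;
    \<open>u4\<close> and \<open>u5\<close> stay fixed throughout.\<close>
  define good where "good a b c d \<longleftrightarrow> a * b * c * d * u4 * u5 = q \<and> b / a \<notin> Zq \<and> a * a \<notin> Zq \<and> b * b \<notin> Zq \<and> a * b \<notin> Zq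
    \<and> a * c \<notin> Zq \<and> a * d \<notin> Zq \<and> a * u4 \<notin> Zq \<and> a * u5 \<notin> Zq \<and> b * c \<notin> Zq \<and> b * d \<notin> Zq \<and> b * u4 \<notin> Zq \<and> b * u5 \<notin> Zq
    \<and> c * d \<notin> Zq \<and> c * u4 \<notin> Zq \<and> c * u5 \<notin> Zq \<and> d * u4 \<notin> Zq \<and> d * u5 \<notin> Zq \<and> u4 * u5 \<notin> Zq" for a b c d
  define X where "X a b c d = Q [a, b, c, d, u4, u5] a b / R8 a b c d u4 u5" for a b c d
  have goodD: "a \<noteq> 0 \<and> b \<noteq> 0 \<and> c \<noteq> 0 \<and> d \<noteq> 0" if "good a b c d" for a b c d
    using that by (auto simp: good_def)
  have good_swap: "good b a d c" if "good a b c d" for a b c d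
    using that Zq_inverse_iff[of "b / a"] by (auto simp: good_def mult_ac)
  have good_shift: "good (q * a) b (c / q) d" if "good a b c d" for a b c d
  proof -
    have "b / (q * a) \<notin> Zq" if "b / a \<notin> Zq"
      using that Zq_cancel(3)[of "b / a"] by (simp add: mult.commute)
    moreover have "a * (q * a) \<in> Zq \<longleftrightarrow> a * a \<in> Zq"
      unfolding mult.left_commute[of a q a] by simp
    ultimately show ?thesis
      using that by (auto simp: good_def mult.assoc)
  qed
  have R_nz: "R8 a b c d u4 u5 \<noteq> 0" if "good a b c d" for a b c d
    using that goodD[OF that] unfolding R8_def good_def
    by (simp add: P_nz th_nz Zq_q_div P_q_nz)
  have X_swap: "X b a d c = X a b c d" if "good a b c d" for a b c d
  proof -
    have "mset [b, a, d, c, u4, u5] = mset [a, b, c, d, u4, u5]"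
      by simp
    then have "Q [b, a, d, c, u4, u5] b a = - Q [a, b, c, d, u4, u5] a b"
      using Q_mset_cong[of "[b, a, d, c, u4, u5]" "[a, b, c, d, u4, u5]"] by (simp add: Q_def)
    then show ?thesis
      unfolding X_def using R8_swap[of a b d c] goodD[OF that] by simp
  qed
  have X_shift: "X a b c d = X (q * a) b (c / q) d" if g: "good a b c d" for a b c d
  proof -
    define v where "v = c / q"
    have c: "c = q * v" by (simp add: v_def)
    note g' = g[unfolded good_def c]
    have nz': "a \<noteq> 0" "v \<noteq> 0"
      using goodD[OF g] by (auto simp: c)
    have Zv: "a * v \<notin> Zq" "b * v \<notin> Zq" "v * d \<notin> Zq" "v * u4 \<notin> Zq" "v * u5 \<notin> Zq"
    proof -
      have "x * (q * v) \<in> Zq \<longleftrightarrow> x * v \<in> Zq" for x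
        unfolding mult.left_commute[of x q v] by simp
      then show "a * v \<notin> Zq" "b * v \<notin> Zq" "v * d \<notin> Zq" "v * u4 \<notin> Zq" "v * u5 \<notin> Zq"
        using g' by (auto simp: mult.assoc)
    qed
    have prod': "a * b * v * d * u4 * u5 = 1"
      using g' by (simp add: mult.assoc)
    have ne: "1 - x \<noteq> 0" if "x \<notin> Zq" for x
      using that Zq_simps(1) by auto
    have "v\<^sup>2 * ((1 - b * a) * (1 - d * a) * (1 - u4 * a) * (1 - u5 * a)) * Q [a, b, q * v, d, u4, u5] a b
      = a\<^sup>2 * ((1 - b * v) * (1 - d * v) * (1 - u4 * v) * (1 - u5 * v)) * Q [q * a, b, v, d, u4, u5] (q * a) b"
      by (rule contiguous_Q[OF prod']) (use g' Zv in \<open>auto intro!: P_nz simp: mult.commute\<close>)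
    moreover have "v\<^sup>2 * ((1 - b * a) * (1 - d * a) * (1 - u4 * a) * (1 - u5 * a)) * R8 a b (q * v) d u4 u5
      = a\<^sup>2 * ((1 - b * v) * (1 - d * v) * (1 - u4 * v) * (1 - u5 * v)) * R8 (q * a) b v d u4 u5"
      by (rule contiguous_R8[OF prod']) (use g' Zv in \<open>auto intro!: P_nz ne simp: mult.commute simp del: right_minus_eq\<close>)
    moreover have "v\<^sup>2 * ((1 - b * a) * (1 - d * a) * (1 - u4 * a) * (1 - u5 * a)) \<noteq> 0"
      "a\<^sup>2 * ((1 - b * v) * (1 - d * v) * (1 - u4 * v) * (1 - u5 * v)) \<noteq> 0"
      using nz' g' Zv ne by (simp_all add: mult.commute)
    moreover have "Q1 / R1 = Q2 / R2"
      if "\<alpha> * Q1 = \<beta> * Q2" "\<alpha> * R1 = \<beta> * R2" "\<alpha> \<noteq> 0" "\<beta> \<noteq> 0" for \<alpha> \<beta> Q1 Q2 R1 R2 :: complex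
      using that by (metis nonzero_mult_divide_mult_cancel_left)
    ultimately have "Q [a, b, q * v, d, u4, u5] a b / R8 a b (q * v) d u4 u5
        = Q [q * a, b, v, d, u4, u5] (q * a) b / R8 (q * a) b v d u4 u5"
      by blast
    then show ?thesis
      unfolding X_def c by simp
  qed
  have iter: "good (q ^ n * u0) (q ^ n * u1) (u2 / q ^ n) (u3 / q ^ n)
      \<and> X u0 u1 u2 u3 = X (q ^ n * u0) (q ^ n * u1) (u2 / q ^ n) (u3 / q ^ n)" for n
  proof (induction n)
    case 0
    then show ?case
      using prod gen by (simp add: good_def)
  next
    case (Suc n)
    define a b c d where "a = q ^ n * u0" and "b = q ^ n * u1" and "c = u2 / q ^ n" and "d = u3 / q ^ n"
    have g: "good a b c d" and e: "X u0 u1 u2 u3 = X a b c d"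
      using Suc by (simp_all add: a_def b_def c_def d_def)
    \<comment> \<open>The contiguous relation moves a factor \<open>q\<close> from \<open>c\<close>
      to \<open>a\<close>. Conjugated with the simultaneous swap of \<open>a\<close>,
      \<open>b\<close> and of \<open>c\<close>, \<open>d\<close>, it moves one from \<open>d\<close>
      to \<open>b\<close>.\<close>
    note g1 = good_swap[OF good_shift[OF g]]
    have "X a b c d = X (q * a) b (c / q) d"
      by (rule X_shift[OF g])
    also have "\<dots> = X b (q * a) d (c / q)"
      by (rule X_swap[OF good_shift[OF g], symmetric])
    also have "\<dots> = X (q * b) (q * a) (d / q) (c / q)"
      by (rule X_shift[OF g1])
    also have "\<dots> = X (q * a) (q * b) (c / q) (d / q)"
      by (rule X_swap[OF good_swap[OF good_shift[OF g1]]])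
    finally have "X u0 u1 u2 u3 = X (q * a) (q * b) (c / q) (d / q)"
      unfolding e .
    moreover have "good (q * a) (q * b) (c / q) (d / q)"
      by (rule good_swap[OF good_shift[OF g1]])
    moreover have "q * a = q ^ Suc n * u0" "q * b = q ^ Suc n * u1" "c / q = u2 / q ^ Suc n" "d / q = u3 / q ^ Suc n"
      by (simp_all add: a_def b_def c_def d_def mult_ac)
    ultimately show ?case
      by simp
  qed
  define L where "L = aa_int u0 u1 u2 u3"
  have L: "L = - u0 * P q * th (u1 / u0) * P (q / (u4 * u5))
      / (P (u0 * u2) * P (u1 * u2) * P (u0 * u3) * P (u1 * u3))"
  proof -
    have "u2 * u3 * u0 * u1 = q / (u4 * u5)"
      using prod nz by (simp add: field_simps)
    moreover have "L = - u0 * P q * th (u1 / u0) * P (u2 * u3 * u0 * u1)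
      / (P (u2 * u0) * P (u2 * u1) * P (u3 * u0) * P (u3 * u1))"
      unfolding L_def using gen nz by (intro andrews_askey P_nz) (auto simp: mult.commute)
    ultimately show ?thesis
      by (simp add: mult.commute)
  qed
  have L_nz: "L \<noteq> 0"
    unfolding L using gen nz by (simp add: P_nz th_nz Zq_q_div P_q_nz)
  have Qlim: "(\<lambda>n. Q [q ^ n * u0, q ^ n * u1, u2 / q ^ n, u3 / q ^ n, u4, u5] (q ^ n * u0) (q ^ n * u1) / q ^ n) \<longlonglongrightarrow> L"
    unfolding Q_def L_def aa_int_def diff_divide_distrib by (intro tendsto_diff Q_scaling_tendsto nz)
  have Rlim: "(\<lambda>n. R8 (q ^ n * u0) (q ^ n * u1) (u2 / q ^ n) (u3 / q ^ n) u4 u5 / q ^ n) \<longlonglongrightarrow> L"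
  proof -
    have q2: "(\<lambda>n. P (z * q ^ (n + n))) \<longlonglongrightarrow> 1" for z
      using tendsto_P[OF tendsto_mult[OF tendsto_const[of z] tendsto_mult[OF tendsto_q_power tendsto_q_power]]] by (simp add: power_add)
    have "R8 (q ^ n * u0) (q ^ n * u1) (u2 / q ^ n) (u3 / q ^ n) u4 u5 / q ^ n
      = - u0 * P q * th (u1 / u0)
    * (P (q / (u2 * u3) * q ^ (n + n)) * P (q / (u2 * u4) * q ^ n) * P (q / (u2 * u5) * q ^ n) * P (q / (u3 * u4) * q ^ n) * P (q / (u3 * u5) * q ^ n) * P (q / (u4 * u5)))
    / (P (u0 * u1 * q ^ (n + n)) * (P (u0 * u2) * P (u0 * u3) * P (u0 * u4 * q ^ n) * P (u0 * u5 * q ^ n))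
        * (P (u1 * u2) * P (u1 * u3) * P (u1 * u4 * q ^ n) * P (u1 * u5 * q ^ n)))" for n
      unfolding R8_def by (simp add: power_add mult_ac)
    moreover have "(\<lambda>n. - u0 * P q * th (u1 / u0)
    * (P (q / (u2 * u3) * q ^ (n + n)) * P (q / (u2 * u4) * q ^ n) * P (q / (u2 * u5) * q ^ n) * P (q / (u3 * u4) * q ^ n) * P (q / (u3 * u5) * q ^ n) * P (q / (u4 * u5)))
    / (P (u0 * u1 * q ^ (n + n)) * (P (u0 * u2) * P (u0 * u3) * P (u0 * u4 * q ^ n) * P (u0 * u5 * q ^ n))
        * (P (u1 * u2) * P (u1 * u3) * P (u1 * u4 * q ^ n) * P (u1 * u5 * q ^ n))))
     \<longlonglongrightarrow> - u0 * P q * th (u1 / u0) * (1 * 1 * 1 * 1 * 1 * P (q / (u4 * u5)))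
        / (1 * (P (u0 * u2) * P (u0 * u3) * 1 * 1) * (P (u1 * u2) * P (u1 * u3) * 1 * 1))"
      using gen by (intro tendsto_mult tendsto_divide tendsto_const tendsto_P_q_power q2) (simp_all add: P_nz)
    ultimately show ?thesis
      unfolding L by (simp add: mult_ac)
  qed
  have "(\<lambda>n. X u0 u1 u2 u3) \<longlonglongrightarrow> L / L"
  proof (rule Lim_transform_eventually[OF tendsto_divide[OF Qlim Rlim L_nz]])
    show "\<forall>\<^sub>F n in sequentially. Q [q ^ n * u0, q ^ n * u1, u2 / q ^ n, u3 / q ^ n, u4, u5] (q ^ n * u0) (q ^ n * u1) / q ^ n
      / (R8 (q ^ n * u0) (q ^ n * u1) (u2 / q ^ n) (u3 / q ^ n) u4 u5 / q ^ n) = X u0 u1 u2 u3"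
      using iter by (simp add: X_def)
  qed
  then have "X u0 u1 u2 u3 = 1"
    using L_nz by (simp add: LIMSEQ_const_iff)
  moreover have "good u0 u1 u2 u3"
    using iter[of 0] by simp
  ultimately show ?thesis
    unfolding X_def using R_nz by simp
qed

end

subsection \<open>Bailey's transformation from a double series\<close>

text \<open>The product majorant makes the family absolutely summable over pairs, so the interchange
  holds for unordered sums; all series involved converge absolutely and agree with them.\<close>

lemma fubini_geometric:
  fixes f :: "nat \<Rightarrow> nat \<Rightarrow> complex"
  assumes bound: "\<And>j k. norm (f j k) \<le> C * \<rho> ^ j * \<rho> ^ k" and \<rho>: "0 \<le> \<rho>" "\<rho> < 1"
  shows "(\<Sum>j. \<Sum>k. f j k) = (\<Sum>k. \<Sum>j. f j k)" and "summable (\<lambda>j. \<Sum>k. f j k)"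
    and "summable (\<lambda>k. f j k)"
proof -
  have geo: "summable (\<lambda>k. c * \<rho> ^ k)" for c :: real
    using \<rho> by (intro summable_mult summable_geometric) simp
  have row: "summable (\<lambda>k. norm (f j k))" for j
    by (rule summable_comparison_test'[OF geo[of "C * \<rho> ^ j"]]) (use bound in simp)
  have col: "summable (\<lambda>j. norm (f j k))" for k
    by (rule summable_comparison_test'[OF geo[of "C * \<rho> ^ k"]]) (use bound in \<open>simp add: mult.assoc mult.commute[of "\<rho> ^ k"]\<close>)
  show "summable (\<lambda>k. f j k)" for j
    by (rule summable_norm_cancel[OF row])
  have C: "C \<ge> 0"
    using order_trans[OF norm_ge_zero bound[of 0 0]] by simp
  have rowsum: "norm (\<Sum>k. f j k) \<le> C / (1 - \<rho>) * \<rho> ^ j" for j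
  proof -
    have "norm (\<Sum>k. f j k) \<le> (\<Sum>k. norm (f j k))"
      by (rule summable_norm[OF row])
    also have "\<dots> \<le> (\<Sum>k. C * \<rho> ^ j * \<rho> ^ k)"
      by (intro suminf_le row geo) (use bound in simp)
    also have "\<dots> = C / (1 - \<rho>) * \<rho> ^ j"
      using \<rho> by (subst suminf_mult) (simp_all add: suminf_geometric summable_geometric)
    finally show ?thesis .
  qed
  have colsum: "norm (\<Sum>j. f j k) \<le> C / (1 - \<rho>) * \<rho> ^ k" for k
  proof -
    have "norm (\<Sum>j. f j k) \<le> (\<Sum>j. norm (f j k))"
      by (rule summable_norm[OF col])
    also have "\<dots> \<le> (\<Sum>j. C * \<rho> ^ k * \<rho> ^ j)"
      by (intro suminf_le col geo) (use bound in \<open>simp add: mult.assoc mult.commute[of "\<rho> ^ k"]\<close>)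
    also have "\<dots> = C / (1 - \<rho>) * \<rho> ^ k"
      using \<rho> by (subst suminf_mult) (simp_all add: suminf_geometric summable_geometric)
    finally show ?thesis .
  qed
  have sumrow: "summable (\<lambda>j. norm (\<Sum>k. f j k))"
    by (rule summable_comparison_test'[OF geo[of "C / (1 - \<rho>)"]]) (use rowsum in simp)
  have sumcol: "summable (\<lambda>k. norm (\<Sum>j. f j k))"
    by (rule summable_comparison_test'[OF geo[of "C / (1 - \<rho>)"]]) (use colsum in simp)
  show "summable (\<lambda>j. \<Sum>k. f j k)"
    by (rule summable_norm_cancel[OF sumrow])
  have infsum_eq: "infsum g UNIV = suminf g" if "summable (\<lambda>n. norm (g n))" for g :: "nat \<Rightarrow> complex"
    using norm_summable_imp_has_sum[OF that summable_sums[OF summable_norm_cancel[OF that]]] by (rule infsumI)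
  have real_has_sum: "((\<lambda>k. c * \<rho> ^ k) has_sum (c / (1 - \<rho>))) UNIV" if "c \<ge> 0" for c
  proof (rule norm_summable_imp_has_sum)
    show "summable (\<lambda>k. norm (c * \<rho> ^ k))"
      using geo[of c] that \<rho> by (simp add: abs_mult)
    show "(\<lambda>k. c * \<rho> ^ k) sums (c / (1 - \<rho>))"
      using sums_mult[OF geometric_sums[of \<rho>], of c] \<rho> by simp
  qed
  have "(\<lambda>(j, k). C * \<rho> ^ j * \<rho> ^ k) summable_on (UNIV \<times> UNIV)"
  proof (rule summable_on_SigmaI)
    show "((\<lambda>k. (\<lambda>(j, k). C * \<rho> ^ j * \<rho> ^ k) (j, k)) has_sum (C * \<rho> ^ j / (1 - \<rho>))) UNIV" for j
      using real_has_sum[of "C * \<rho> ^ j"] C \<rho> by simp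
    show "(\<lambda>j. C * \<rho> ^ j / (1 - \<rho>)) summable_on UNIV"
      using has_sum_imp_summable[OF real_has_sum[of "C / (1 - \<rho>)"]] C \<rho> by simp
  next
    fix j k :: nat
    show "0 \<le> (\<lambda>(j, k). C * \<rho> ^ j * \<rho> ^ k) (j, k)"
      using C \<rho> by simp
  qed
  then have "(\<lambda>x. norm ((\<lambda>(j, k). f j k) x)) summable_on (UNIV \<times> UNIV)"
    by (rule summable_on_comparison_test) (simp_all add: split_beta bound)
  then have "(\<lambda>(j, k). f j k) summable_on (UNIV \<times> UNIV)"
    by (rule abs_summable_summable)
  from infsum_swap_banach[OF this]
  have "(\<Sum>\<^sub>\<infinity>j. \<Sum>\<^sub>\<infinity>k. f j k) = (\<Sum>\<^sub>\<infinity>k. \<Sum>\<^sub>\<infinity>j. f j k)" .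
  then show "(\<Sum>j. \<Sum>k. f j k) = (\<Sum>k. \<Sum>j. f j k)"
    unfolding infsum_eq[OF row] infsum_eq[OF col] infsum_eq[OF sumrow] infsum_eq[OF sumcol] .
qed

context q_disc begin

definition wt :: "complex list \<Rightarrow> complex \<Rightarrow> complex" where
  "wt ts x = (1 - x\<^sup>2) * (\<Prod>t\<leftarrow>ts. P (q * x / t) / P (t * x))"

text \<open>The contribution of the two parameters \<open>y / s\<close> and
  \<open>1 / (y * s)\<close> to the integrand \<open>F\<close>. Together with four parameters of
  product \<open>q * s^2\<close> they form a balanced six-tuple for the 8phi7 sum in
  \<open>x\<close>.\<close>

definition ker :: "complex \<Rightarrow> complex \<Rightarrow> complex \<Rightarrow> complex" where
  "ker s x y = P (q * s * x / y) * P (q * s * x * y) / (P (x * y / s) * P (x / (y * s)))"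

lemma F_wt_append: "F (ts @ us) x = x * wt ts x * (\<Prod>t\<leftarrow>us. P (q * x / t) / P (t * x))"
  by (simp add: F_def wt_def mult_ac)

lemma F_kernel:
  "F [b0, y / s, b1, b2, b3, 1 / (y * s)] x = x * wt [b0, b1, b2, b3] x * ker s x y"
  by (simp add: F_def wt_def ker_def mult_ac)

lemma P_q_negpower: "P (1 / q ^ n) = 0"
  unfolding P_eq_0_iff by (intro exI[of _ n]) simp

text \<open>For \<open>k < j\<close> the quotient \<open>q * s * x / y\<close> is a nonpositive
  power of \<open>q\<close>, a zero of \<open>P\<close>.\<close>

lemma ker_lattice_0:
  assumes "k < j" "a \<noteq> 0" "s \<noteq> 0"
  shows "ker s (a / s * q ^ k) (a * q ^ j) = 0"
proof -
  obtain i where j: "j = k + 1 + i"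
    using assms(1) less_iff_Suc_add by auto
  have "q * s * (a / s * q ^ k) / (a * q ^ j) = 1 / q ^ i"
    using assms by (simp add: j power_add field_simps)
  then show ?thesis
    unfolding ker_def by (simp only: P_q_negpower) simp
qed

text \<open>A step from \<open>z\<close> to \<open>z * q\<close> multiplies the numerator by
  \<open>- 1 / z\<close> and the denominator by \<open>- 1 / (s^2 * z * q)\<close>. The dependence
  on \<open>z\<close> cancels and leaves \<open>q * s^2\<close>.\<close>

lemma th_ratio_shift:
  assumes "w \<noteq> 0" "s \<noteq> 0"
  shows "th (w * q ^ j) / th (1 / (s\<^sup>2 * (w * q ^ j))) = (q * s\<^sup>2) ^ j * (th w / th (1 / (s\<^sup>2 * w)))"
proof (induction j)
  case (Suc j)
  define z where "z = w * q ^ j"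
  have z: "z \<noteq> 0" using assms by (simp add: z_def)
  have "th (z * q) / th (1 / (s\<^sup>2 * (z * q))) = q * s\<^sup>2 * (th z / th (1 / (s\<^sup>2 * z)))"
    using th_mult_q[OF z] th_div_q[of "1 / (s\<^sup>2 * z)"] z assms by (simp add: mult_ac power2_eq_square)
  also have "th z / th (1 / (s\<^sup>2 * z)) = (q * s\<^sup>2) ^ j * (th w / th (1 / (s\<^sup>2 * w)))"
    using Suc by (simp only: z_def)
  finally have "th (z * q) / th (1 / (s\<^sup>2 * (z * q))) = q * s\<^sup>2 * ((q * s\<^sup>2) ^ j * (th w / th (1 / (s\<^sup>2 * w))))" .
  moreover have "w * q ^ Suc j = z * q"
    by (simp add: z_def)
  ultimately show ?case
    by (simp only: power_Suc mult.assoc)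
qed simp

text \<open>Here \<open>y = a0 q\<^sup>j\<close> runs over one lattice and \<open>x = c q\<^sup>k\<close> over another one, with
  \<open>c = a0 / s\<close> or \<open>c = b0\<close>. For \<open>c = a0 / s\<close> the kernel vanishes unless \<open>j \<le> k\<close>.\<close>

definition dterm :: "complex \<Rightarrow> complex \<times> complex \<times> complex \<times> complex \<Rightarrow> complex \<times> complex \<times> complex \<times> complex
    \<Rightarrow> complex \<Rightarrow> nat \<Rightarrow> nat \<Rightarrow> complex" where
  "dterm s = (\<lambda>(a0, a1, a2, a3) (b0, b1, b2, b3) c j k.
     (1 / s\<^sup>2) ^ j * wt [a0, a1, a2, a3] (a0 * q ^ j)
     * (c * q ^ k * wt [b0, b1, b2, b3] (c * q ^ k) * ker s (c * q ^ k) (a0 * q ^ j)))"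

text \<open>The quotient of \<open>ker s x y\<close> by \<open>ker s y x\<close> is a ratio of theta
  functions, which on the two lattices is a constant times a power of \<open>q * s^2\<close>. This
  power converts the weight \<open>(1 / s^2) ^ j * x\<close> into a multiple of
  \<open>(1 / s^2) ^ k * y\<close>, so the terms on the lattices from \<open>a0\<close> and
  \<open>b0\<close> serve both assignments of the two groups.\<close>

lemma dterm_swap:
  assumes nz: "s \<noteq> 0" "a0 \<noteq> 0" "b0 \<noteq> 0" and gen: "a0 / (b0 * s) \<notin> Zq" "b0 / (a0 * s) \<notin> Zq"
  shows "dterm s (a0, a1, a2, a3) (b0, b1, b2, b3) b0 j k
    = b0 / a0 * (th (a0 / (b0 * s)) / th (b0 / (a0 * s))) * dterm s (b0, b1, b2, b3) (a0, a1, a2, a3) a0 k j"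
proof -
  define x y where "x = b0 * q ^ k" and "y = a0 * q ^ j"
  define w where "w = a0 / (b0 * s) / q ^ k"
  have w: "w \<noteq> 0" using nz by (simp add: w_def)
  define \<rho> where "\<rho> v = th v / th (1 / (s\<^sup>2 * v))" for v
  have r1: "\<rho> (w * q ^ j) = (q * s\<^sup>2) ^ j * \<rho> w" and r2: "\<rho> (w * q ^ k) = (q * s\<^sup>2) ^ k * \<rho> w"
    unfolding \<rho>_def by (rule th_ratio_shift[OF w nz(1)])+
  have e1: "w * q ^ j = y / (x * s)" "1 / (s\<^sup>2 * (w * q ^ j)) = x / (y * s)"
    "w * q ^ k = a0 / (b0 * s)" "1 / (s\<^sup>2 * (w * q ^ k)) = b0 / (a0 * s)"
    using nz by (simp_all add: w_def x_def y_def field_simps power2_eq_square)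
  have \<rho>0: "\<rho> (w * q ^ k) = th (a0 / (b0 * s)) / th (b0 / (a0 * s))"
    unfolding \<rho>_def e1(4) unfolding e1(3) ..
  have r: "th (y / (x * s)) / th (x / (y * s)) * (q * s\<^sup>2) ^ k = (q * s\<^sup>2) ^ j * \<rho> (w * q ^ k)"
  proof -
    have "\<rho> (w * q ^ j) * (q * s\<^sup>2) ^ k = (q * s\<^sup>2) ^ j * \<rho> (w * q ^ k)"
      unfolding r1 r2 by (simp only: mult_ac)
    moreover have "\<rho> (w * q ^ j) = th (y / (x * s)) / th (x / (y * s))"
      unfolding \<rho>_def e1(2) unfolding e1(1) ..
    ultimately show ?thesis
      by simp
  qed
  have n1: "x / (y * s) \<notin> Zq" "y / (x * s) \<notin> Zq"
  proof -
    have "x / (y * s) = b0 / (a0 * s) * q ^ k / q ^ j" "y / (x * s) = a0 / (b0 * s) * q ^ j / q ^ k"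
      by (simp_all add: x_def y_def)
    then show "x / (y * s) \<notin> Zq" "y / (x * s) \<notin> Zq"
      using gen by (simp_all only: Zq_cancel not_False_eq_True)
  qed
  have n2: "P (x / (y * s)) \<noteq> 0" "P (y / (x * s)) \<noteq> 0" "P (q * s * y / x) \<noteq> 0" "P (q * s * x / y) \<noteq> 0"
    using n1 Zq_q_div[of "x / (y * s)"] Zq_q_div[of "y / (x * s)"] by (auto intro!: P_nz simp: mult_ac)
  have K: "ker s x y = th (y / (x * s)) / th (x / (y * s)) * ker s y x"
    unfolding ker_def th_def using n2 by (simp add: divide_simps) (simp add: mult_ac)
  have sq: "(q * s\<^sup>2) ^ k \<noteq> 0" using nz by simp
  have "(1 / s\<^sup>2) ^ j * x * (th (y / (x * s)) / th (x / (y * s))) = b0 / a0 * \<rho> (w * q ^ k) * ((1 / s\<^sup>2) ^ k * y)"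
  proof -
    have "(1 / s\<^sup>2) ^ j * x * (th (y / (x * s)) / th (x / (y * s))) * (q * s\<^sup>2) ^ k
       = (1 / s\<^sup>2) ^ j * x * ((q * s\<^sup>2) ^ j * \<rho> (w * q ^ k))"
      unfolding r[symmetric] by (simp only: mult.assoc)
    also have "\<dots> = q ^ j * x * \<rho> (w * q ^ k)"
      using nz by (simp add: power_mult_distrib power_divide)
    also have "\<dots> = b0 / a0 * \<rho> (w * q ^ k) * ((1 / s\<^sup>2) ^ k * y) * (q * s\<^sup>2) ^ k"
      using nz by (simp add: power_mult_distrib power_divide x_def y_def)
    finally show ?thesis
      using sq mult_right_cancel by blast
  qed
  then have "(1 / s\<^sup>2) ^ j * x * (th (y / (x * s)) / th (x / (y * s))) * (wt [a0, a1, a2, a3] y * wt [b0, b1, b2, b3] x * ker s y x)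
    = b0 / a0 * \<rho> (w * q ^ k) * ((1 / s\<^sup>2) ^ k * y) * (wt [a0, a1, a2, a3] y * wt [b0, b1, b2, b3] x * ker s y x)"
    by simp
  then show ?thesis
    unfolding dterm_def prod.case x_def[symmetric] y_def[symmetric] K \<rho>0[symmetric] by (simp only: mult_ac)
qed

lemma bdd2_wt: "bdd2 (\<lambda>j k. wt ts (c * q ^ h j k))"
proof (rule bdd2_sequence)
  have "(\<lambda>n. (\<Prod>t\<leftarrow>ts. P (q * (c * q ^ n) / t) / P (t * (c * q ^ n)))) \<longlonglongrightarrow> 1"
  proof (induction ts)
    case (Cons t ts)
    have "(\<lambda>k. P (q * c / t * q ^ k) / P (t * c * q ^ k)) \<longlonglongrightarrow> 1 / 1"
      by (intro tendsto_divide tendsto_P_q_power) simp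
    from tendsto_mult[OF this Cons] show ?case
      by (simp add: mult_ac)
  qed simp
  moreover have "(\<lambda>n. 1 - (c * q ^ n)\<^sup>2) \<longlonglongrightarrow> 1 - (c * 0)\<^sup>2"
    by (intro tendsto_intros tendsto_q_power)
  ultimately show "(\<lambda>n. wt ts (c * q ^ n)) \<longlonglongrightarrow> (1 - (c * 0)\<^sup>2) * 1"
    unfolding wt_def by (intro tendsto_mult)
qed

text \<open>For \<open>j <= k\<close> the quotient \<open>x / y\<close> brings only nonnegative
  powers \<open>q ^ (k - j)\<close>, so every product runs along a lattice tending to 0 and is
  bounded together with its reciprocal. This control is lost for \<open>j > k\<close>.\<close>

lemma dterm_bound:
  assumes nz: "s \<noteq> 0" "a0 \<noteq> 0"
  obtains M where "\<And>j k. j \<le> k \<Longrightarrow>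
    norm (dterm s (a0, a1, a2, a3) (b0, b1, b2, b3) c j k) \<le> M * norm q ^ k * norm (1 / s\<^sup>2) ^ j"
proof -
  define B where "B j k = c * wt [a0, a1, a2, a3] (a0 * q ^ j) * wt [b0, b1, b2, b3] (c * q ^ k)
    * (P (q * s * (c / a0) * q ^ (k - j)) * P (q * s * (c * a0) * q ^ (k + j))
        * (inverse (P (c * a0 / s * q ^ (k + j))) * inverse (P (c / (a0 * s) * q ^ (k - j)))))" for j k
  have i: "bdd2 (\<lambda>j k. inverse (P (z * q ^ h j k)))" for z h
    by (rule bdd2_inverse_P) simp
  have "bdd2 B"
    unfolding B_def by (intro bdd2_const bdd2_mult bdd2_q_power bdd2_P bdd2_wt i)
  then obtain M where M: "norm (B j k) \<le> M" for j k
    unfolding bdd2_def by blast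
  have "norm (dterm s (a0, a1, a2, a3) (b0, b1, b2, b3) c j k) \<le> M * norm q ^ k * norm (1 / s\<^sup>2) ^ j"
    if "j \<le> k" for j k
  proof -
    have qk: "q ^ k = q ^ (k - j) * q ^ j"
      using that by (simp flip: power_add)
    have e: "q * s * (c * q ^ k) / (a0 * q ^ j) = q * s * (c / a0) * q ^ (k - j)"
      "c * q ^ k / (a0 * q ^ j * s) = c / (a0 * s) * q ^ (k - j)"
      unfolding qk using nz by (simp_all add: field_simps)
    have e': "q * s * (c * q ^ k) * (a0 * q ^ j) = q * s * (c * a0) * q ^ (k + j)"
      "c * q ^ k * (a0 * q ^ j) / s = c * a0 / s * q ^ (k + j)"
      by (simp_all add: power_add)
    have "dterm s (a0, a1, a2, a3) (b0, b1, b2, b3) c j k = B j k * q ^ k * (1 / s\<^sup>2) ^ j"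
    proof -
      have "ker s (c * q ^ k) (a0 * q ^ j) = P (q * s * (c / a0) * q ^ (k - j)) * P (q * s * (c * a0) * q ^ (k + j))
        * (inverse (P (c * a0 / s * q ^ (k + j))) * inverse (P (c / (a0 * s) * q ^ (k - j))))"
        unfolding ker_def e e' divide_inverse[of "P _ * P _"] inverse_mult_distrib ..
      then show ?thesis
        unfolding dterm_def prod.case B_def by (simp only: mult_ac)
    qed
    then show ?thesis
      by (simp add: norm_mult norm_power norm_divide mult_right_mono M divide_right_mono)
  qed
  then show ?thesis
    using that by blast
qed

text \<open>Writing the left side as \<open>a ^ (k - j) * (a * b) ^ j\<close> bounds it by
  \<open>m ^ k\<close>, and the square root of \<open>m\<close> divides the decay between both
  indices. For \<open>a = norm q\<close> and \<open>b = norm (1 / s^2)\<close>, the bound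
  \<open>a * b < 1\<close> is the convergence condition \<open>norm q < (norm s)^2\<close>.\<close>

lemma geometric_bound:
  fixes a b m \<rho> :: real
  assumes "0 \<le> a" "0 \<le> b" "a \<le> m" "a * b \<le> m" "m = \<rho>\<^sup>2" "0 \<le> \<rho>" "\<rho> < 1" "j \<le> k"
  shows "a ^ k * b ^ j \<le> \<rho> ^ j * \<rho> ^ k"
proof -
  have "a ^ k * b ^ j = a ^ (k - j) * (a * b) ^ j"
    using assms(8) by (simp add: power_mult_distrib flip: power_add)
  also have "\<dots> \<le> m ^ (k - j) * m ^ j"
    using assms by (intro mult_mono power_mono) auto
  also have "\<dots> = \<rho> ^ k * \<rho> ^ k"
    using assms(5,8) by (simp add: power2_eq_square power_mult_distrib flip: power_add)
  also have "\<dots> \<le> \<rho> ^ j * \<rho> ^ k"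
    using assms by (intro mult_right_mono power_decreasing) auto
  finally show ?thesis .
qed

section \<open>Jackson's terminating 8phi7 sum\<close>

definition jconst :: "complex \<Rightarrow> complex \<Rightarrow> complex \<Rightarrow> complex \<Rightarrow> complex \<Rightarrow> complex" where
  "jconst s a0 a1 a2 a3 = P (q / (a1 * a2)) * P (q / (a1 * a3)) * P (q / (a2 * a3))
    / (P (a0 * a1) * P (a0 * a2) * P (a0 * a3) * P (1 / s\<^sup>2))"

lemma P_ratio_step: "P (a * y) \<noteq> 0 \<Longrightarrow>
  (1 - q * y / a) * (P (q * (y * q) / a) / P (a * (y * q))) = (1 - a * y) * (P (q * y / a) / P (a * y))"
  using P_rec[of "q * y / a"] P_rec_nz[of "a * y"] by (simp add: mult_ac)

text \<open>The polynomial identity is used once more, now for \<open>r * X\<close>,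
  \<open>1 / (q * X)\<close> and the four \<open>a\<close>s, whose product is 1. The telescoping
  runs over the summation index, and replacing \<open>X\<close> by \<open>X * q\<close> raises the
  upper limit of the sum from \<open>k\<close> to \<open>k + 1\<close>.\<close>

lemma jackson_step:
  fixes a0 a1 a2 a3 r X :: complex and k :: nat
  assumes prod: "a0 * a1 * a2 * a3 = q / r" and nz: "r \<noteq> 0" and X: "X = a0 * q ^ k"
    and gen: "r \<notin> Zq" "r * (a0 * a0) \<notin> Zq" "a0 * a0 \<notin> Zq" "a0 * a1 \<notin> Zq" "a0 * a2 \<notin> Zq" "a0 * a3 \<notin> Zq"
  defines "D \<equiv> \<lambda>X j. r ^ j * wt [a0, a1, a2, a3] (a0 * q ^ j)
      * (P (q * X / (a0 * q ^ j)) * P (q * X * (a0 * q ^ j)) / (P (r * X * (a0 * q ^ j)) * P (r * X / (a0 * q ^ j))))"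
  shows "(1 - a0 * (r * X)) * (1 - a1 * (r * X)) * (1 - a2 * (r * X)) * (1 - a3 * (r * X)) * (\<Sum>j\<le>k. D X j)
    = (1 - q * X / a0) * (1 - q * X / a1) * (1 - q * X / a2) * (1 - q * X / a3) * (\<Sum>j\<le>Suc k. D (X * q) j)"
proof -
  have a: "a0 \<noteq> 0" "a1 \<noteq> 0" "a2 \<noteq> 0" "a3 \<noteq> 0"
    using prod nz by auto
  have X0: "X \<noteq> 0" using a by (simp add: X)
  define v0 v2 where "v0 = r * X" and "v2 = 1 / (q * X)"
  define A0 where "A0 = (1 - a0 * v0) * (1 - a1 * v0) * (1 - a2 * v0) * (1 - a3 * v0)"
  define A2 where "A2 = (1 - q * X / a0) * (1 - q * X / a1) * (1 - q * X / a2) * (1 - q * X / a3)"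
  have A2': "(1 - a0 * v2) * (1 - a1 * v2) * (1 - a2 * v2) * (1 - a3 * v2) = q / r / (q * X) ^ 4 * A2"
  proof -
    have "1 - a * v2 = - (a / (q * X)) * (1 - q * X / a)" if "a \<noteq> 0" for a
      using that X0 by (simp add: v2_def field_simps)
    then have "(1 - a0 * v2) * (1 - a1 * v2) * (1 - a2 * v2) * (1 - a3 * v2) = (a0 * a1 * a2 * a3) / (q * X) ^ 4 * A2"
      using a X0 by (simp add: A2_def power4_eq_xxxx)
    then show ?thesis
      unfolding prod .
  qed
  have pv: "v0 * a0 * v2 * a1 * a2 * a3 = 1"
  proof -
    have "v0 * a0 * v2 * a1 * a2 * a3 = v0 * v2 * (a0 * a1 * a2 * a3)"
      by (simp only: mult_ac)
    then show ?thesis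
      unfolding prod using nz X0 by (simp add: v0_def v2_def)
  qed
  \<comment> \<open>Normalised so that in the telescoping identity \<open>D X j\<close> has
    coefficient exactly \<open>A0\<close>.\<close>
  define \<kappa> where "\<kappa> = - ((q * X) ^ 3) * (v0 * v2 * (v2 - v0))"
  define c where "c a y = P (q * y / a) / P (a * y)" for a y
  define K where "K y = P (q * q * X / y) * P (q * q * X * y) / (P (r * X * y) * P (r * X / y))" for y
  \<comment> \<open>The common part of \<open>D X j\<close> and \<open>D (X * q) j\<close>: each is
    \<open>1 - y^2\<close> times \<open>E\<close> times two linear factors, and these linear factors
    are the palindromic quadratics of the polynomial identity up to monomials.\<close>
  define E where "E j y = r ^ j * (c a0 y * c a1 y * c a2 y * c a3 y) * K y" for j y
  define up vp where "up y = (1 - v0 * y) * (1 - a0 * y) * (1 - v2 * y) * (1 - a1 * y) * (1 - a2 * y) * (1 - a3 * y)"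
    and "vp y = (1 - y / v0) * (1 - y / a0) * (1 - y / v2) * (1 - y / a1) * (1 - y / a2) * (1 - y / a3)" for y
  define y where "y j = a0 * q ^ j" for j
  have y0: "y j \<noteq> 0" for j using a by (simp add: y_def)
  have yS: "y (Suc j) = y j * q" for j by (simp add: y_def mult_ac)
  define g where "g j = \<kappa> * E j (y j) / (y j)\<^sup>2 * vp (y j)" for j
  have Pa: "P (a0 * y j) \<noteq> 0" "P (a1 * y j) \<noteq> 0" "P (a2 * y j) \<noteq> 0" "P (a3 * y j) \<noteq> 0" for j
  proof -
    have e: "a * y j = a0 * a * q ^ j" for a
      by (simp add: y_def mult_ac)
    show "P (a0 * y j) \<noteq> 0" "P (a1 * y j) \<noteq> 0" "P (a2 * y j) \<noteq> 0" "P (a3 * y j) \<noteq> 0"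
      unfolding e by (rule P_nz_shift, rule P_nz, rule gen)+
  qed
  have PX: "P (r * X * y j) \<noteq> 0" "P (r * X / y j) \<noteq> 0" "1 - r * X / (y j * q) \<noteq> 0" for j
  proof -
    have "r * X * y j = r * (a0 * a0) * q ^ (k + j)"
      by (simp add: X y_def power_add mult_ac)
    then show "P (r * X * y j) \<noteq> 0"
      using gen by (intro P_nz) (simp only: Zq_cancel not_False_eq_True)
    have e: "r * X / y j = r * q ^ k / q ^ j" "r * X / (y j * q) = r * q ^ k / q ^ Suc j"
      using a by (simp_all add: X y_def mult_ac)
    show "P (r * X / y j) \<noteq> 0"
      unfolding e using gen by (intro P_nz) (simp only: Zq_cancel not_False_eq_True)
    have "r * X / (y j * q) \<notin> Zq"
      unfolding e using gen by (simp only: Zq_cancel not_False_eq_True)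
    then show "1 - r * X / (y j * q) \<noteq> 0"
      by (metis Zq_simps(1) eq_iff_diff_eq_0)
  qed
  have D1: "D X j = (1 - (y j)\<^sup>2) * E j (y j) * ((1 - q * X / y j) * (1 - q * X * y j))" for j
    using P_rec[of "q * X / y j"] P_rec[of "q * X * y j"]
    by (simp add: D_def E_def wt_def c_def K_def y_def[symmetric] mult_ac)
  have D2: "D (X * q) j = (1 - (y j)\<^sup>2) * E j (y j) * ((1 - r * X * y j) * (1 - r * X / y j))" for j
    using P_rec_nz[OF PX(1)[of j]] P_rec_nz[OF PX(2)[of j]]
    by (simp add: D_def E_def wt_def c_def K_def y_def[symmetric] mult_ac)
  have step: "A0 * D X j - A2 * D (X * q) j = g (Suc j) - g j" for j
  proof -
    define z where "z = y j"
    have z: "z \<noteq> 0" using y0 by (simp add: z_def)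
    have "\<kappa> / z\<^sup>2 * (up z - vp z) = - ((q * X) ^ 3) / z\<^sup>2 * (v0 * v2 * (v2 - v0) * (up z - vp z))"
      by (simp add: \<kappa>_def)
    also have "v0 * v2 * (v2 - v0) * (up z - vp z) = z * (1 - z\<^sup>2) * (v2\<^sup>2 * A0 * ((1 - z / v2) * (1 - v2 * z))
      - v0\<^sup>2 * (q / r / (q * X) ^ 4 * A2) * ((1 - z / v0) * (1 - v0 * z)))"
      unfolding up_def vp_def A2'[symmetric] A0_def by (rule well_poised_polynomial[OF pv])
    also have "- ((q * X) ^ 3) / z\<^sup>2 * \<dots> = (1 - z\<^sup>2) * (A0 * (- ((q * X) ^ 3 / z * v2\<^sup>2 * ((1 - z / v2) * (1 - v2 * z))))
      + A2 * ((q * X) ^ 3 / z * v0\<^sup>2 * (q / r / (q * X) ^ 4) * ((1 - z / v0) * (1 - v0 * z))))"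
      using z by (simp add: divide_simps power2_eq_square) (simp add: algebra_simps)
    also have "- ((q * X) ^ 3 / z * v2\<^sup>2 * ((1 - z / v2) * (1 - v2 * z))) = (1 - q * X / z) * (1 - q * X * z)"
      unfolding v2_def using z X0 by (simp add: divide_simps power2_eq_square power3_eq_cube) (simp add: algebra_simps)
    also have "(q * X) ^ 3 / z * v0\<^sup>2 * (q / r / (q * X) ^ 4) * ((1 - z / v0) * (1 - v0 * z)) = - ((1 - r * X * z) * (1 - r * X / z))"
      unfolding v0_def using z X0 nz
      by (simp add: divide_simps power2_eq_square power3_eq_cube power4_eq_xxxx) (simp add: algebra_simps)
    finally have main: "\<kappa> / z\<^sup>2 * (up z - vp z) = (1 - z\<^sup>2) * (A0 * ((1 - q * X / z) * (1 - q * X * z)) - A2 * ((1 - r * X * z) * (1 - r * X / z)))"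
      by simp
    have L: "A0 * D X j - A2 * D (X * q) j = E j z * (\<kappa> / z\<^sup>2 * (up z - vp z))"
    proof -
      have "A0 * (w * e * m) - A2 * (w * e * n) = e * (w * (A0 * m - A2 * n))" for w e m n
        by (simp add: algebra_simps)
      then show ?thesis
        unfolding D1 D2 z_def[symmetric] main .
    qed
    have cs: "(1 - q * z / a) * c a (z * q) = (1 - a * z) * c a z" if "P (a * z) \<noteq> 0" for a
      unfolding c_def by (rule P_ratio_step[OF that])
    have Ks: "(1 - q * q * X * z) * (1 - r * X / (z * q)) * K (z * q) = (1 - q * X / z) * (1 - r * X * z) * K z"
    proof -
      have e1: "P (q * q * X / (z * q)) = (1 - q * X / z) * P (q * q * X / z)"
        using P_rec[of "q * X / z"] by (simp add: mult_ac)
      have e2: "(1 - q * q * X * z) * P (q * q * X * (z * q)) = P (q * q * X * z)"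
        using P_rec[of "q * q * X * z"] by (simp add: mult_ac)
      have e3: "P (r * X * (z * q)) = P (r * X * z) / (1 - r * X * z)"
        using P_rec_nz[OF PX(1)[of j]] by (simp add: z_def mult_ac)
      have e4: "P (r * X / (z * q)) = (1 - r * X / (z * q)) * P (r * X / z)"
        using P_rec[of "r * X / (z * q)"] by simp
      have gen: "c * n * (m * p1 * p2 / (p3 / l * (n * p4))) = m * l * (p1 * (c * p2) / (p3 * p4))"
        if "n \<noteq> 0" for c n m p1 p2 p3 l p4 :: complex
        using that by simp
      show ?thesis
        unfolding K_def e1 e3 e4 gen[OF PX(3)[of j, folded z_def]] e2 ..
    qed
    have "g (Suc j) = \<kappa> / (z * q)\<^sup>2 * (r ^ Suc j * (((1 - q * z / a0) * c a0 (z * q)) * ((1 - q * z / a1) * c a1 (z * q)) * ((1 - q * z / a2) * c a2 (z * q)) * ((1 - q * z / a3) * c a3 (z * q)))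
        * ((1 - z * q / v0) * (1 - z * q / v2) * K (z * q)))"
      unfolding g_def yS z_def[symmetric] E_def vp_def by (simp add: mult_ac)
    also have "(1 - z * q / v0) * (1 - z * q / v2) * K (z * q) = - (z * q / v0) * ((1 - q * q * X * z) * (1 - r * X / (z * q)) * K (z * q))"
      unfolding v0_def v2_def using z nz X0 by (simp add: field_simps)
    also have "\<dots> = - (z * q / v0) * ((1 - q * X / z) * (1 - r * X * z) * K z)"
      unfolding Ks ..
    also have "\<kappa> / (z * q)\<^sup>2 * (r ^ Suc j * (((1 - q * z / a0) * c a0 (z * q)) * ((1 - q * z / a1) * c a1 (z * q)) * ((1 - q * z / a2) * c a2 (z * q)) * ((1 - q * z / a3) * c a3 (z * q))) * \<dots>)
      = \<kappa> / z\<^sup>2 * r ^ j * (((1 - a0 * z) * c a0 z) * ((1 - a1 * z) * c a1 z) * ((1 - a2 * z) * c a2 z) * ((1 - a3 * z) * c a3 z))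
        * ((1 - r * X * z) * K z) * (- (r / q\<^sup>2 * (z * q / v0) * (1 - q * X / z)))"
      unfolding cs[OF Pa(1)[of j, folded z_def]] cs[OF Pa(2)[of j, folded z_def]] cs[OF Pa(3)[of j, folded z_def]] cs[OF Pa(4)[of j, folded z_def]]
      by (simp add: power_mult_distrib mult_ac)
    also have "- (r / q\<^sup>2 * (z * q / v0) * (1 - q * X / z)) = 1 - v2 * z"
      unfolding v0_def v2_def using z nz X0 by (simp add: field_simps power2_eq_square)
    finally have "g (Suc j) = E j z * (\<kappa> / z\<^sup>2 * up z)"
      unfolding E_def up_def v0_def[symmetric] by (simp add: mult_ac)
    moreover have "g j = E j z * (\<kappa> / z\<^sup>2 * vp z)"
      unfolding g_def z_def by simp
    ultimately show ?thesis
      unfolding L by (simp add: right_diff_distrib)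
  qed
  \<comment> \<open>Both boundary terms vanish: at \<open>j = 0\<close> through the factor
    \<open>1 - y / a0\<close>, and at \<open>j = k + 2\<close> through
    \<open>P (q * q * X / y) = P 1\<close>. The sum over \<open>D X\<close> already ends at
    \<open>k\<close>, since its term at \<open>k + 1\<close> is 0.\<close>
  have "g 0 = 0"
    using a by (simp add: g_def vp_def y_def)
  moreover have "g (Suc (Suc k)) = 0"
  proof -
    have "q * q * X / y (Suc (Suc k)) = 1"
      using a by (simp add: X y_def)
    then show ?thesis
      by (simp add: g_def E_def K_def)
  qed
  ultimately have "(\<Sum>j<Suc (Suc k). A0 * D X j - A2 * D (X * q) j) = 0"
    unfolding step sum_lessThan_telescope by simp
  then have "A0 * (\<Sum>j\<le>Suc k. D X j) = A2 * (\<Sum>j\<le>Suc k. D (X * q) j)"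
    unfolding sum_distrib_left lessThan_Suc_atMost sum_subtractf by simp
  moreover have "D X (Suc k) = 0"
    unfolding D1 using a by (simp add: X y_def)
  ultimately show ?thesis
    unfolding A0_def A2_def v0_def by simp
qed

text \<open>Induction on \<open>k\<close>: both sides satisfy the first-order recurrence of
  \<open>jackson_step\<close>, whose coefficients do not vanish, and for \<open>k = 0\<close> the
  sum is a single term.\<close>

lemma jackson:
  assumes prod: "a0 * a1 * a2 * a3 = q * s\<^sup>2" and nz: "s \<noteq> 0"
    and gen: "1 / s\<^sup>2 \<notin> Zq" "a0 * a0 / s\<^sup>2 \<notin> Zq" "a0 * a0 \<notin> Zq" "a0 * a1 \<notin> Zq" "a0 * a2 \<notin> Zq" "a0 * a3 \<notin> Zq"
      "a1 * a2 \<notin> Zq" "a1 * a3 \<notin> Zq" "a2 * a3 \<notin> Zq" "a0 / a1 \<notin> Zq" "a0 / a2 \<notin> Zq" "a0 / a3 \<notin> Zq"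
  shows "(\<Sum>j\<le>k. (1 / s\<^sup>2) ^ j * wt [a0, a1, a2, a3] (a0 * q ^ j) * ker s (a0 / s * q ^ k) (a0 * q ^ j))
    = P q * jconst s a0 a1 a2 a3 * (\<Prod>a\<leftarrow>[a0, a1, a2, a3]. P (q * (a0 / s * q ^ k) / (a / s)) / P (a / s * (a0 / s * q ^ k)))"
proof -
  have a: "a0 \<noteq> 0" "a1 \<noteq> 0" "a2 \<noteq> 0" "a3 \<noteq> 0"
    using prod nz by auto
  define r where "r = 1 / s\<^sup>2"
  have r: "r \<noteq> 0" using nz by (simp add: r_def)
  have prod': "a0 * a1 * a2 * a3 = q / r" using prod nz by (simp add: r_def)
  define D where "D X j = r ^ j * wt [a0, a1, a2, a3] (a0 * q ^ j)
      * (P (q * X / (a0 * q ^ j)) * P (q * X * (a0 * q ^ j)) / (P (r * X * (a0 * q ^ j)) * P (r * X / (a0 * q ^ j))))" for X j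
  define M where "M X = P (q * X / a0) / P (a0 * (r * X)) * (P (q * X / a1) / P (a1 * (r * X)))
      * (P (q * X / a2) / P (a2 * (r * X))) * (P (q * X / a3) / P (a3 * (r * X)))" for X
  \<comment> \<open>By the balancing, these are the arguments of the numerators of
    \<open>jconst\<close>, which therefore cancel denominators of \<open>M\<close> at the starting
    point \<open>X = a0\<close>.\<close>
  have pair: "a0 * (r * a1) = q / (a2 * a3)" "a0 * (r * a2) = q / (a1 * a3)" "a0 * (r * a3) = q / (a1 * a2)"
    using prod' a r by (simp_all add: field_simps)
  have main: "(\<Sum>j\<le>k. D (a0 * q ^ k) j) = P q * jconst s a0 a1 a2 a3 * M (a0 * q ^ k)" for k
  proof (induction k)
    case 0
    have n: "P (a0 * a0) \<noteq> 0" "P (a0 * a1) \<noteq> 0" "P (a0 * a2) \<noteq> 0" "P (a0 * a3) \<noteq> 0"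
      "P (q / (a1 * a2)) \<noteq> 0" "P (q / (a1 * a3)) \<noteq> 0" "P (q / (a2 * a3)) \<noteq> 0"
      using gen by (auto intro!: P_nz simp: Zq_q_div)
    have "P (a0 * a0) = (1 - a0\<^sup>2) * P (q * (a0 * a0))"
      using P_rec[of "a0 * a0"] by (simp add: power2_eq_square mult_ac)
    then have "(1 - a0\<^sup>2) * P (q * (a0 * a0)) / P (a0 * a0) = 1"
      using n by simp
    then have l: "D a0 0 = P q * P q * (P (q * a0 / a1) / P (a0 * a1) * (P (q * a0 / a2) / P (a0 * a2)) * (P (q * a0 / a3) / P (a0 * a3)))
      / (P (r * (a0 * a0)) * P r)"
    proof -
      assume one: "(1 - a0\<^sup>2) * P (q * (a0 * a0)) / P (a0 * a0) = 1"
      have "D a0 0 = (1 - a0\<^sup>2) * P (q * (a0 * a0)) / P (a0 * a0) * (P q * P q * (P (q * a0 / a1) / P (a0 * a1) * (P (q * a0 / a2) / P (a0 * a2)) * (P (q * a0 / a3) / P (a0 * a3)))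
      / (P (r * (a0 * a0)) * P r))"
        using a by (simp add: D_def wt_def mult_ac)
      then show ?thesis
        unfolding one by simp
    qed
    have "M a0 = P q / P (r * (a0 * a0)) * (P (q * a0 / a1) / P (q / (a2 * a3)) * (P (q * a0 / a2) / P (q / (a1 * a3))) * (P (q * a0 / a3) / P (q / (a1 * a2))))"
      unfolding M_def pair[symmetric] using a by (simp add: mult_ac)
    then have "P q * jconst s a0 a1 a2 a3 * M a0 = D a0 0"
      unfolding l jconst_def r_def[symmetric] using n by (simp add: mult_ac)
    then show ?case by simp
  next
    case (Suc k)
    define X where "X = a0 * q ^ k"
    have XS: "a0 * q ^ Suc k = X * q" by (simp add: X_def)
    define A0 where "A0 = (1 - a0 * (r * X)) * (1 - a1 * (r * X)) * (1 - a2 * (r * X)) * (1 - a3 * (r * X))"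
    define A2 where "A2 = (1 - q * X / a0) * (1 - q * X / a1) * (1 - q * X / a2) * (1 - q * X / a3)"
    have st: "A0 * (\<Sum>j\<le>k. D X j) = A2 * (\<Sum>j\<le>Suc k. D (X * q) j)"
      unfolding A0_def A2_def D_def
      by (rule jackson_step[OF prod' r X_def]) (use gen in \<open>simp_all add: r_def\<close>)
    have ne: "1 - x \<noteq> 0" if "x \<notin> Zq" for x
      using that by (metis Zq_simps(1) eq_iff_diff_eq_0)
    have "A2 \<noteq> 0"
    proof -
      have "q * X / a0 = q ^ Suc k" using a by (simp add: X_def)
      moreover have "q ^ Suc k \<noteq> 1"
      proof
        assume "q ^ Suc k = 1"
        then have "norm q ^ Suc k = 1" by (metis norm_one norm_power)
        moreover have "norm q ^ Suc k < 1"
          using norm_q by (intro power_Suc_less_one) simp_all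
        ultimately show False by simp
      qed
      moreover have "q * X / a \<notin> Zq" if "a0 / a \<notin> Zq" for a
      proof -
        have "q * X / a = q * (a0 / a * q ^ k)" by (simp add: X_def)
        then show ?thesis using that by (simp only: Zq_cancel not_False_eq_True)
      qed
      ultimately show ?thesis
        unfolding A2_def using gen ne by (metis mult_eq_0_iff eq_iff_diff_eq_0)
    qed
    moreover have "A0 * M X = A2 * M (X * q)"
    proof -
      have e: "a0 * (r * X) = a0 * a0 / s\<^sup>2 * q ^ k" "a1 * (r * X) = q / (a2 * a3) * q ^ k"
        "a2 * (r * X) = q / (a1 * a3) * q ^ k" "a3 * (r * X) = q / (a1 * a2) * q ^ k"
        unfolding pair[symmetric] X_def by (simp_all add: r_def mult_ac)
      have PM: "P (a0 * (r * X)) \<noteq> 0" "P (a1 * (r * X)) \<noteq> 0" "P (a2 * (r * X)) \<noteq> 0" "P (a3 * (r * X)) \<noteq> 0"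
        unfolding e using gen by (auto intro!: P_nz simp only: Zq_cancel Zq_q_div)
      have st: "(1 - a * (r * X)) * (P (q * X / a) / P (a * (r * X))) = (1 - q * X / a) * (P (q * (X * q) / a) / P (a * (r * (X * q))))"
        if "P (a * (r * X)) \<noteq> 0" for a
        using P_rec[of "q * X / a"] P_rec_nz[OF that] by (simp add: mult_ac)
      have "A0 * M X = ((1 - a0 * (r * X)) * (P (q * X / a0) / P (a0 * (r * X)))) * ((1 - a1 * (r * X)) * (P (q * X / a1) / P (a1 * (r * X))))
        * ((1 - a2 * (r * X)) * (P (q * X / a2) / P (a2 * (r * X)))) * ((1 - a3 * (r * X)) * (P (q * X / a3) / P (a3 * (r * X))))"
        unfolding A0_def M_def by (simp only: mult_ac)
      also have "\<dots> = A2 * M (X * q)"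
        unfolding st[OF PM(1)] st[OF PM(2)] st[OF PM(3)] st[OF PM(4)] A2_def M_def by (simp only: mult_ac)
      finally show ?thesis .
    qed
    ultimately show ?case
      unfolding XS using st Suc[folded X_def]
      by (metis (no_types, lifting) mult.left_commute mult_left_cancel)
  qed
  have "(1 / s\<^sup>2) ^ j * wt [a0, a1, a2, a3] (a0 * q ^ j) * ker s (a0 / s * q ^ k) (a0 * q ^ j) = D (a0 * q ^ k) j" for j
    unfolding D_def ker_def r_def using nz by (simp add: power2_eq_square mult_ac)
  moreover have "(\<Prod>a\<leftarrow>[a0, a1, a2, a3]. P (q * (a0 / s * q ^ k) / (a / s)) / P (a / s * (a0 / s * q ^ k))) = M (a0 * q ^ k)"
    unfolding M_def r_def using nz by (simp add: power2_eq_square mult_ac)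
  ultimately show ?thesis
    using main by simp
qed

text \<open>In Bailey's transformation of \<open>t\<close>, the \<open>a\<^sub>i\<close> are \<open>s\<close> times the four parameters that get
  multiplied by \<open>s\<close>, and the \<open>b\<^sub>i\<close> are the four that get divided by \<open>s\<close>.\<close>

definition generic_pair :: "complex \<Rightarrow> complex \<times> complex \<times> complex \<times> complex \<Rightarrow> complex \<times> complex \<times> complex \<times> complex \<Rightarrow> bool" where
  "generic_pair s = (\<lambda>(a0, a1, a2, a3) (b0, b1, b2, b3).
     s \<noteq> 0 \<and> a0 * a1 * a2 * a3 = q * s\<^sup>2 \<and> b0 * b1 * b2 * b3 = q * s\<^sup>2 \<and> 1 / s\<^sup>2 \<notin> Zq
     \<and> a0 / (b0 * s) \<notin> Zq \<and> b0 / (a0 * s) \<notin> Zq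
     \<and> a0 * a0 \<notin> Zq \<and> a0 * a0 / s\<^sup>2 \<notin> Zq \<and> b0 * b0 \<notin> Zq \<and> b0 * b0 / s\<^sup>2 \<notin> Zq
     \<and> a0 * a1 \<notin> Zq \<and> a0 * a2 \<notin> Zq \<and> a0 * a3 \<notin> Zq \<and> a1 * a2 \<notin> Zq \<and> a1 * a3 \<notin> Zq \<and> a2 * a3 \<notin> Zq
     \<and> b0 * b1 \<notin> Zq \<and> b0 * b2 \<notin> Zq \<and> b0 * b3 \<notin> Zq \<and> b1 * b2 \<notin> Zq \<and> b1 * b3 \<notin> Zq \<and> b2 * b3 \<notin> Zq
     \<and> a0 / a1 \<notin> Zq \<and> a0 / a2 \<notin> Zq \<and> a0 / a3 \<notin> Zq \<and> b0 / b1 \<notin> Zq \<and> b0 / b2 \<notin> Zq \<and> b0 / b3 \<notin> Zq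
     \<and> a0 * b0 / s \<notin> Zq \<and> a0 * b1 / s \<notin> Zq \<and> a0 * b2 / s \<notin> Zq \<and> a0 * b3 / s \<notin> Zq
     \<and> b0 * a1 / s \<notin> Zq \<and> b0 * a2 / s \<notin> Zq \<and> b0 * a3 / s \<notin> Zq
     \<and> b1 / (a0 * s) \<notin> Zq \<and> b2 / (a0 * s) \<notin> Zq \<and> b3 / (a0 * s) \<notin> Zq
     \<and> a1 / (b0 * s) \<notin> Zq \<and> a2 / (b0 * s) \<notin> Zq \<and> a3 / (b0 * s) \<notin> Zq)"

lemma generic_pair_swap:
  "generic_pair s (a0, a1, a2, a3) (b0, b1, b2, b3) \<Longrightarrow> generic_pair s (b0, b1, b2, b3) (a0, a1, a2, a3)"
  unfolding generic_pair_def prod.case by (simp add: mult.commute)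

text \<open>Quasi-periodicity trades the theta function of \<open>R8\<close> for the one at
  \<open>b0 / (y * s)\<close>. One of its factors cancels a denominator of \<open>R8\<close>; the
  other is the numerator that \<open>F\<close> needs for the parameter \<open>b0 / s\<close>. The
  power \<open>(q * s^2) ^ j\<close> released on the way cancels the weight down to
  \<open>q ^ j = y / a0\<close>, which supplies the measure factor of \<open>F\<close>.\<close>

lemma inner_product_formula:
  assumes gen: "generic_pair s (a0, a1, a2, a3) (b0, b1, b2, b3)"
  shows "(1 / s\<^sup>2) ^ j * wt [a0, a1, a2, a3] (a0 * q ^ j)
      * R8 b0 (a0 * q ^ j / s) b1 b2 b3 (1 / (a0 * q ^ j * s))
    = - (b0 / a0 * (th (a0 / (b0 * s)) / th (b0 / (a0 * s)))) * P q * jconst s b0 b1 b2 b3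
      * F [a0, a1, a2, a3, b0 / s, b1 / s, b2 / s, b3 / s] (a0 * q ^ j)"
proof -
  note g = gen[unfolded generic_pair_def prod.case]
  have nz: "s \<noteq> 0" "a0 \<noteq> 0" "b0 \<noteq> 0" "b1 \<noteq> 0" "b2 \<noteq> 0" "b3 \<noteq> 0"
    using g by auto
  define y where "y = a0 * q ^ j"
  have y: "y \<noteq> 0" using nz by (simp add: y_def)
  have bn: "b0 / (y * s) \<notin> Zq"
  proof -
    have "b0 / (y * s) = b0 / (a0 * s) / q ^ j" by (simp add: y_def mult_ac)
    then show ?thesis using g by (simp only: Zq_cancel not_False_eq_True)
  qed
  define w where "w = a0 / (b0 * s)"
  have w: "w \<noteq> 0" using nz by (simp add: w_def)
  have e: "w * q ^ j = y / (s * b0)" "1 / (s\<^sup>2 * (w * q ^ j)) = b0 / (y * s)" "1 / (s\<^sup>2 * w) = b0 / (a0 * s)"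
    using nz by (simp_all add: w_def y_def field_simps power2_eq_square)
  have ratio: "th (y / (s * b0)) / th (b0 / (y * s)) = (q * s\<^sup>2) ^ j * (th (a0 / (b0 * s)) / th (b0 / (a0 * s)))"
    using th_ratio_shift[OF w nz(1), of j] unfolding e(2,3) unfolding e(1) unfolding w_def .
  have thb: "th (b0 / (y * s)) = P (b0 / (y * s)) * P (q * y / (b0 / s))"
    unfolding th_def by (simp add: mult_ac)
  have pn: "P (b0 / (y * s)) \<noteq> 0" "P (q * y / (b0 / s)) \<noteq> 0"
    using th_nz[OF bn] unfolding thb by auto
  have "R8 b0 (y / s) b1 b2 b3 (1 / (y * s)) = - b0 * P q * (th (y / (s * b0)) / P (b0 / (y * s))) * jconst s b0 b1 b2 b3
      * (P (q * y / (b1 / s)) / P (b1 / s * y) * (P (q * y / (b2 / s)) / P (b2 / s * y)) * (P (q * y / (b3 / s)) / P (b3 / s * y)) / P (b0 / s * y))"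
  proof -
    have e1: "q / (b * (1 / (y * s))) = q * y / (b / s)" for b using y nz by (simp add: mult_ac)
    have e2: "y / s * b = b / s * y" "b * (y / s) = b / s * y" for b by (simp_all add: mult_ac)
    have e4: "y / s * (1 / (y * s)) = 1 / s\<^sup>2" "b0 * (1 / (y * s)) = b0 / (y * s)" "y / s / b0 = y / (s * b0)"
      using y by (simp_all add: power2_eq_square)
    show ?thesis
      unfolding R8_def e1 e4 e2 jconst_def using y by (simp add: power2_eq_square mult_ac)
  qed
  also have "th (y / (s * b0)) / P (b0 / (y * s)) = th (y / (s * b0)) / th (b0 / (y * s)) * P (q * y / (b0 / s))"
    unfolding thb using pn by simp
  finally have R: "R8 b0 (y / s) b1 b2 b3 (1 / (y * s)) = - b0 * P q * (q * s\<^sup>2) ^ j * (th (a0 / (b0 * s)) / th (b0 / (a0 * s))) * jconst s b0 b1 b2 b3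
      * (\<Prod>t\<leftarrow>[b0 / s, b1 / s, b2 / s, b3 / s]. P (q * y / t) / P (t * y))"
    unfolding ratio by (simp add: mult_ac)
  have ap: "[a0, a1, a2, a3, b0 / s, b1 / s, b2 / s, b3 / s] = [a0, a1, a2, a3] @ [b0 / s, b1 / s, b2 / s, b3 / s]"
    by simp
  have c: "(1 / s\<^sup>2) ^ j * (b0 * (q * s\<^sup>2) ^ j) = b0 / a0 * y"
    using nz by (simp add: y_def power_mult_distrib power_divide)
  have "(1 / s\<^sup>2) ^ j * wt [a0, a1, a2, a3] y * R8 b0 (y / s) b1 b2 b3 (1 / (y * s))
    = - (((1 / s\<^sup>2) ^ j * (b0 * (q * s\<^sup>2) ^ j)) * (th (a0 / (b0 * s)) / th (b0 / (a0 * s)))) * P q * jconst s b0 b1 b2 b3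
      * (wt [a0, a1, a2, a3] y * (\<Prod>t\<leftarrow>[b0 / s, b1 / s, b2 / s, b3 / s]. P (q * y / t) / P (t * y)))"
    unfolding R by (simp only: mult_ac mult_minus_left mult_minus_right)
  then show ?thesis
    unfolding y_def[symmetric] c ap F_wt_append by (simp only: mult_ac mult_minus_left mult_minus_right)
qed

text \<open>The kernel kills the first \<open>j\<close> points of the lattice from
  \<open>a0 / s\<close>, so this lattice effectively starts at \<open>y / s\<close>. This is a
  parameter of the integrand in \<open>x\<close>, and the difference becomes a nonterminating 8phi7
  sum.\<close>

lemma sum_over_x:
  assumes gen: "generic_pair s (a0, a1, a2, a3) (b0, b1, b2, b3)"
  shows "(\<Sum>k. dterm s (a0, a1, a2, a3) (b0, b1, b2, b3) (a0 / s) j k)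
      - (\<Sum>k. dterm s (a0, a1, a2, a3) (b0, b1, b2, b3) b0 j k)
    = - (b0 / a0 * (th (a0 / (b0 * s)) / th (b0 / (a0 * s)))) * P q * jconst s b0 b1 b2 b3
      * F [a0, a1, a2, a3, b0 / s, b1 / s, b2 / s, b3 / s] (a0 * q ^ j)"
proof -
  note g = gen[unfolded generic_pair_def prod.case]
  have nz: "s \<noteq> 0" "a0 \<noteq> 0" "b0 \<noteq> 0"
    using g by auto
  define y where "y = a0 * q ^ j"
  have y: "y \<noteq> 0" using nz by (simp add: y_def)
  define us where "us = [b0, y / s, b1, b2, b3, 1 / (y * s)]"
  have d: "dterm s (a0, a1, a2, a3) (b0, b1, b2, b3) c j k = (1 / s\<^sup>2) ^ j * wt [a0, a1, a2, a3] y * F us (c * q ^ k)" for c k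
    unfolding us_def F_kernel dterm_def prod.case y_def[symmetric] ..
  have sum: "(\<Sum>k. dterm s (a0, a1, a2, a3) (b0, b1, b2, b3) c j k) = (1 / s\<^sup>2) ^ j * wt [a0, a1, a2, a3] y * S us c" for c
    unfolding d S_def by (rule suminf_mult[OF summable_F])
  have "S us (a0 / s) = S us (y / s)"
  proof -
    have "F us (a0 / s * q ^ k) = 0" if "k < j" for k
      unfolding us_def F_kernel using ker_lattice_0[OF that nz(2,1)] by (simp add: y_def)
    then have "(\<Sum>k<j. F us (a0 / s * q ^ k)) = 0"
      by simp
    then show ?thesis
      using suminf_split_initial_segment[OF summable_F[of us "a0 / s"], of j]
      by (simp add: S_def y_def power_add mult_ac)
  qed
  then have "(\<Sum>k. dterm s (a0, a1, a2, a3) (b0, b1, b2, b3) (a0 / s) j k) - (\<Sum>k. dterm s (a0, a1, a2, a3) (b0, b1, b2, b3) b0 j k)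
    = (1 / s\<^sup>2) ^ j * wt [a0, a1, a2, a3] y * Q us b0 (y / s)"
    unfolding sum Q_def by (simp only: right_diff_distrib)
  also have "Q us b0 (y / s) = R8 b0 (y / s) b1 b2 b3 (1 / (y * s))"
    unfolding us_def
  proof (rule nonterminating_8phi7)
    have "b0 * (y / s) * b1 * b2 * b3 * (1 / (y * s)) = b0 * b1 * b2 * b3 / s\<^sup>2"
      using y by (simp add: power2_eq_square)
    then show "b0 * (y / s) * b1 * b2 * b3 * (1 / (y * s)) = q"
      using g by simp
    have e: "y / s / b0 = a0 / (b0 * s) * q ^ j" "y / s * (y / s) = a0 * a0 / s\<^sup>2 * q ^ (j + j)"
      "b * (y / s) = a0 * b / s * q ^ j" "y / s * b = a0 * b / s * q ^ j"
      "b * (1 / (y * s)) = b / (a0 * s) / q ^ j" "y / s * (1 / (y * s)) = 1 / s\<^sup>2" for b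
      using y by (simp_all add: y_def power2_eq_square power_add mult_ac)
    show "y / s / b0 \<notin> Zq" "y / s * (y / s) \<notin> Zq" "b0 * (y / s) \<notin> Zq" "b0 * (1 / (y * s)) \<notin> Zq"
      "y / s * b1 \<notin> Zq" "y / s * b2 \<notin> Zq" "y / s * b3 \<notin> Zq" "y / s * (1 / (y * s)) \<notin> Zq"
      "b1 * (1 / (y * s)) \<notin> Zq" "b2 * (1 / (y * s)) \<notin> Zq" "b3 * (1 / (y * s)) \<notin> Zq"
      unfolding e(1,2,6) e(3)[of b0] e(4)[of b1] e(4)[of b2] e(4)[of b3] e(5)[of b0] e(5)[of b1] e(5)[of b2] e(5)[of b3]
      using g by (simp_all only: Zq_cancel not_False_eq_True)
  qed (use g in simp_all)
  finally show ?thesis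
    unfolding y_def inner_product_formula[OF gen] .
qed

text \<open>Since the kernel vanishes for \<open>j > k\<close>, the series is Jackson's finite sum,
  and its value attaches the parameters \<open>a0 / s\<close>, \<open>a1 / s\<close>,
  \<open>a2 / s\<close>, \<open>a3 / s\<close> to the integrand in \<open>x\<close>.\<close>

lemma sum_over_y:
  assumes gen: "generic_pair s (a0, a1, a2, a3) (b0, b1, b2, b3)"
  shows "(\<Sum>j. dterm s (a0, a1, a2, a3) (b0, b1, b2, b3) (a0 / s) j k)
    = P q * jconst s a0 a1 a2 a3 * F [b0, b1, b2, b3, a0 / s, a1 / s, a2 / s, a3 / s] (a0 / s * q ^ k)"
proof -
  note g = gen[unfolded generic_pair_def prod.case]
  have nz: "s \<noteq> 0" "a0 \<noteq> 0"
    using g by auto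
  define x where "x = a0 / s * q ^ k"
  have "(\<Sum>j. dterm s (a0, a1, a2, a3) (b0, b1, b2, b3) (a0 / s) j k)
    = (\<Sum>j\<le>k. dterm s (a0, a1, a2, a3) (b0, b1, b2, b3) (a0 / s) j k)"
  proof (rule suminf_finite)
    fix j assume "j \<notin> {..k}"
    then show "dterm s (a0, a1, a2, a3) (b0, b1, b2, b3) (a0 / s) j k = 0"
      using ker_lattice_0[of k j a0 s] nz by (simp add: dterm_def)
  qed simp
  also have "\<dots> = x * wt [b0, b1, b2, b3] x
      * (\<Sum>j\<le>k. (1 / s\<^sup>2) ^ j * wt [a0, a1, a2, a3] (a0 * q ^ j) * ker s (a0 / s * q ^ k) (a0 * q ^ j))"
    unfolding sum_distrib_left by (intro sum.cong refl) (simp only: dterm_def prod.case x_def mult_ac)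
  also have "(\<Sum>j\<le>k. (1 / s\<^sup>2) ^ j * wt [a0, a1, a2, a3] (a0 * q ^ j) * ker s (a0 / s * q ^ k) (a0 * q ^ j))
    = P q * jconst s a0 a1 a2 a3 * (\<Prod>a\<leftarrow>[a0, a1, a2, a3]. P (q * (a0 / s * q ^ k) / (a / s)) / P (a / s * (a0 / s * q ^ k)))"
    by (rule jackson) (use g in simp_all)
  also have "(\<Prod>a\<leftarrow>[a0, a1, a2, a3]. P (q * (a0 / s * q ^ k) / (a / s)) / P (a / s * (a0 / s * q ^ k)))
    = (\<Prod>t\<leftarrow>[a0 / s, a1 / s, a2 / s, a3 / s]. P (q * x / t) / P (t * x))"
    by (simp add: x_def)
  finally show ?thesis
    using F_wt_append[of "[b0, b1, b2, b3]" "[a0 / s, a1 / s, a2 / s, a3 / s]" x]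
    by (simp add: x_def mult_ac)
qed

text \<open>Each assignment of the two groups gives one identity between double sums. Both contain
  the double sum over the lattices from \<open>a0\<close> and \<open>b0\<close>, up to the constant
  \<open>c\<close>, and eliminating it leaves four single sums that combine into two
  q-integrals.\<close>

lemma Q_transformation_norm:
  assumes gen: "generic_pair s (a0, a1, a2, a3) (b0, b1, b2, b3)" and s: "norm q < (norm s)\<^sup>2"
  shows "jconst s a0 a1 a2 a3 * Q [a0 / s, a1 / s, a2 / s, a3 / s, b0, b1, b2, b3] (a0 / s) b0
    = - (b0 / a0 * (th (a0 / (b0 * s)) / th (b0 / (a0 * s)))) * jconst s b0 b1 b2 b3
      * Q [a0, a1, a2, a3, b0 / s, b1 / s, b2 / s, b3 / s] a0 (b0 / s)"
proof -
  note g = gen[unfolded generic_pair_def prod.case]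
  have nz: "s \<noteq> 0" "a0 \<noteq> 0" "b0 \<noteq> 0"
    using g by auto
  note gen' = generic_pair_swap[OF gen]
  let ?a = "(a0, a1, a2, a3)" and ?b = "(b0, b1, b2, b3)"
  let ?t = "[b0, b1, b2, b3, a0 / s, a1 / s, a2 / s, a3 / s]" and ?t' = "[a0, a1, a2, a3, b0 / s, b1 / s, b2 / s, b3 / s]"
  define c where "c = b0 / a0 * (th (a0 / (b0 * s)) / th (b0 / (a0 * s)))"
  define c' where "c' = a0 / b0 * (th (b0 / (a0 * s)) / th (a0 / (b0 * s)))"
  have cc': "c * c' = 1"
    using g nz th_nz by (simp add: c_def c'_def)
  \<comment> \<open>The bound on \<open>s\<close> makes \<open>m < 1\<close>, so its square root
    \<open>\<rho>\<close> is a common ratio for all the double series.\<close>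
  define m where "m = max (norm q) (norm q * norm (1 / s\<^sup>2))"
  define \<rho> where "\<rho> = sqrt m"
  have m0: "0 \<le> m" by (simp add: m_def max_def)
  have "norm q * norm (1 / s\<^sup>2) < 1"
    using s nz by (simp add: norm_divide norm_power divide_simps)
  then have m1: "m < 1"
    using norm_q by (simp add: m_def)
  have \<rho>: "0 \<le> \<rho>" "\<rho> < 1" "m = \<rho>\<^sup>2"
    using m0 m1 by (simp_all add: \<rho>_def)
  have gb: "norm q ^ k * norm (1 / s\<^sup>2) ^ j \<le> \<rho> ^ j * \<rho> ^ k" if "j \<le> k" for j k
    by (rule geometric_bound[where m = m]) (use \<rho> that in \<open>auto simp: m_def\<close>)
  have bd: "\<exists>M. \<forall>j k. j \<le> k \<longrightarrow> norm (dterm s (a0, a1, a2, a3) (b0, b1, b2, b3) e j k) \<le> M * \<rho> ^ j * \<rho> ^ k"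
    if a: "a0 \<noteq> 0" for a0 a1 a2 a3 b0 b1 b2 b3 e
  proof -
    obtain M where M: "\<And>j k. j \<le> k \<Longrightarrow>
      norm (dterm s (a0, a1, a2, a3) (b0, b1, b2, b3) e j k) \<le> M * norm q ^ k * norm (1 / s\<^sup>2) ^ j"
      using dterm_bound[OF nz(1) a] by metis
    have "norm (dterm s (a0, a1, a2, a3) (b0, b1, b2, b3) e j k) \<le> \<bar>M\<bar> * \<rho> ^ j * \<rho> ^ k" if "j \<le> k" for j k
    proof -
      have "norm (dterm s (a0, a1, a2, a3) (b0, b1, b2, b3) e j k) \<le> M * (norm q ^ k * norm (1 / s\<^sup>2) ^ j)"
        using M[OF that] by (simp only: mult.assoc)
      also have "\<dots> \<le> \<bar>M\<bar> * (norm q ^ k * norm (1 / s\<^sup>2) ^ j)"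
        by (intro mult_right_mono) auto
      also have "\<dots> \<le> \<bar>M\<bar> * (\<rho> ^ j * \<rho> ^ k)"
        by (intro mult_left_mono gb[OF that]) simp
      finally show ?thesis by (simp only: mult.assoc)
    qed
    then show ?thesis by metis
  qed
  have vanish: "dterm s (a0, a1, a2, a3) (b0, b1, b2, b3) (a0 / s) j k = 0" if "a0 \<noteq> 0" "k < j" for a0 a1 a2 a3 b0 b1 b2 b3 j k
    using ker_lattice_0[OF that(2,1) nz(1)] by (simp add: dterm_def)
  have bound0: "\<exists>M. \<forall>j k. norm (dterm s (a0, a1, a2, a3) (b0, b1, b2, b3) (a0 / s) j k) \<le> M * \<rho> ^ j * \<rho> ^ k"
    if a: "a0 \<noteq> 0" for a0 a1 a2 a3 b0 b1 b2 b3
  proof -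
    obtain M where M: "\<And>j k. j \<le> k \<Longrightarrow> norm (dterm s (a0, a1, a2, a3) (b0, b1, b2, b3) (a0 / s) j k) \<le> M * \<rho> ^ j * \<rho> ^ k"
      using bd[OF a] by metis
    have "norm (dterm s (a0, a1, a2, a3) (b0, b1, b2, b3) (a0 / s) j k) \<le> \<bar>M\<bar> * \<rho> ^ j * \<rho> ^ k" for j k
    proof (cases "j \<le> k")
      case True
      have "M * \<rho> ^ j * \<rho> ^ k \<le> \<bar>M\<bar> * \<rho> ^ j * \<rho> ^ k"
        using \<rho> by (intro mult_right_mono) auto
      then show ?thesis using M[OF True] by linarith
    qed (use \<rho> vanish[OF a] in simp)
    then show ?thesis by metis
  qed
  obtain M1 where M1: "\<And>j k. norm (dterm s ?a ?b (a0 / s) j k) \<le> M1 * \<rho> ^ j * \<rho> ^ k"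
    using bound0[OF nz(2)] by metis
  obtain M2 where M2: "\<And>k j. norm (dterm s ?b ?a (b0 / s) k j) \<le> M2 * \<rho> ^ k * \<rho> ^ j"
    using bound0[OF nz(3)] by metis
  have swap: "dterm s ?a ?b b0 j k = c * dterm s ?b ?a a0 k j" for j k
    unfolding c_def using dterm_swap[OF nz] g by simp
  \<comment> \<open>The direct estimate covers \<open>j <= k\<close>. For \<open>j > k\<close> the
    term is \<open>c\<close> times the one with the groups exchanged, for which the roles of the
    indices are reversed.\<close>
  obtain M3 where M3: "\<And>j k. norm (dterm s ?a ?b b0 j k) \<le> M3 * \<rho> ^ j * \<rho> ^ k"
  proof -
    obtain N1 where N1: "\<And>j k. j \<le> k \<Longrightarrow> norm (dterm s ?a ?b b0 j k) \<le> N1 * \<rho> ^ j * \<rho> ^ k"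
      using bd[OF nz(2)] by metis
    obtain N2 where N2: "\<And>k j. k \<le> j \<Longrightarrow> norm (dterm s ?b ?a a0 k j) \<le> N2 * \<rho> ^ k * \<rho> ^ j"
      using bd[OF nz(3)] by metis
    have "norm (dterm s ?a ?b b0 j k) \<le> (\<bar>N1\<bar> + norm c * \<bar>N2\<bar>) * \<rho> ^ j * \<rho> ^ k" for j k
    proof -
      define r where "r = \<rho> ^ j * \<rho> ^ k"
      have r: "0 \<le> r" using \<rho> by (simp add: r_def)
      have le: "N * r \<le> \<bar>N\<bar> * r" for N using r by (intro mult_right_mono) auto
      have "norm (dterm s ?a ?b b0 j k) \<le> \<bar>N1\<bar> * r + norm c * (\<bar>N2\<bar> * r)"
      proof (cases "j \<le> k")
        case True
        have "norm (dterm s ?a ?b b0 j k) \<le> \<bar>N1\<bar> * r"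
          using N1[OF True] le[of N1] by (simp only: r_def mult.assoc)
        moreover have "0 \<le> norm c * (\<bar>N2\<bar> * r)" using r by simp
        ultimately show ?thesis by linarith
      next
        case False
        then have "norm (dterm s ?b ?a a0 k j) \<le> \<bar>N2\<bar> * r"
          using N2[of k j] le[of N2] by (simp add: r_def mult_ac)
        then have "norm (dterm s ?a ?b b0 j k) \<le> norm c * (\<bar>N2\<bar> * r)"
          unfolding swap norm_mult by (intro mult_left_mono) auto
        moreover have "0 \<le> \<bar>N1\<bar> * r" using r by simp
        ultimately show ?thesis by linarith
      qed
      then show ?thesis by (simp add: r_def algebra_simps)
    qed
    then show ?thesis using that by metis
  qed
  note f1 = fubini_geometric[OF M1 \<rho>(1,2)]
  note f2 = fubini_geometric[OF M2 \<rho>(1,2)]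
  note f3 = fubini_geometric[OF M3 \<rho>(1,2)]
  have M4: "norm (dterm s ?b ?a a0 k j) \<le> (norm c' * M3) * \<rho> ^ k * \<rho> ^ j" for k j
  proof -
    have "dterm s ?b ?a a0 k j = c' * dterm s ?a ?b b0 j k"
      unfolding swap using cc' by (simp add: mult.assoc[symmetric] mult.commute[of c'])
    then have "norm (dterm s ?b ?a a0 k j) \<le> norm c' * (M3 * \<rho> ^ j * \<rho> ^ k)"
      using M3 by (simp add: norm_mult mult_left_mono)
    then show ?thesis by (simp add: mult_ac)
  qed
  note f4 = fubini_geometric[OF M4 \<rho>(1,2)]
  \<comment> \<open>\<open>I1\<close> and \<open>I2\<close> sum over the inner variable by the
    nonterminating formula, \<open>I4\<close> and \<open>I5\<close> in the other order by Jackson's;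
    \<open>I3\<close> identifies the remaining double sum in \<open>I1\<close> with the one in
    \<open>I2\<close>.\<close>
  have I1: "(\<Sum>j. \<Sum>k. dterm s ?a ?b (a0 / s) j k) - (\<Sum>j. \<Sum>k. dterm s ?a ?b b0 j k)
      = - c * P q * jconst s b0 b1 b2 b3 * S ?t' a0"
    unfolding suminf_diff[OF f1(2) f3(2)] sum_over_x[OF gen] c_def[symmetric] S_def
    by (rule suminf_mult[OF summable_F])
  have I2: "(\<Sum>k. \<Sum>j. dterm s ?b ?a (b0 / s) k j) - (\<Sum>k. \<Sum>j. dterm s ?b ?a a0 k j)
      = - c' * P q * jconst s a0 a1 a2 a3 * S ?t b0"
    unfolding suminf_diff[OF f2(2) f4(2)] sum_over_x[OF gen'] c'_def[symmetric] S_def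
    by (rule suminf_mult[OF summable_F])
  have I3: "(\<Sum>j. \<Sum>k. dterm s ?a ?b b0 j k) = c * (\<Sum>k. \<Sum>j. dterm s ?b ?a a0 k j)"
  proof -
    have "(\<Sum>j. \<Sum>k. dterm s ?a ?b b0 j k) = (\<Sum>k. \<Sum>j. dterm s ?a ?b b0 j k)"
      by (rule f3(1))
    also have "\<dots> = (\<Sum>k. c * (\<Sum>j. dterm s ?b ?a a0 k j))"
      unfolding swap by (intro suminf_cong suminf_mult f4(3))
    also have "\<dots> = c * (\<Sum>k. \<Sum>j. dterm s ?b ?a a0 k j)"
      by (rule suminf_mult[OF f4(2)])
    finally show ?thesis .
  qed
  have I4: "(\<Sum>j. \<Sum>k. dterm s ?a ?b (a0 / s) j k) = P q * jconst s a0 a1 a2 a3 * S ?t (a0 / s)"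
    unfolding f1(1) sum_over_y[OF gen] S_def by (rule suminf_mult[OF summable_F])
  have I5: "(\<Sum>k. \<Sum>j. dterm s ?b ?a (b0 / s) k j) = P q * jconst s b0 b1 b2 b3 * S ?t' (b0 / s)"
    unfolding f2(1) sum_over_y[OF gen'] S_def by (rule suminf_mult[OF summable_F])
  have "P q * (jconst s a0 a1 a2 a3 * S ?t (a0 / s) - c * c' * jconst s a0 a1 a2 a3 * S ?t b0)
      = P q * (c * jconst s b0 b1 b2 b3 * S ?t' (b0 / s) - c * jconst s b0 b1 b2 b3 * S ?t' a0)"
    using I1 I2 unfolding I3 I4 I5 by algebra
  then have "jconst s a0 a1 a2 a3 * S ?t (a0 / s) - 1 * jconst s a0 a1 a2 a3 * S ?t b0
      = c * jconst s b0 b1 b2 b3 * S ?t' (b0 / s) - c * jconst s b0 b1 b2 b3 * S ?t' a0"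
    using P_q_nz unfolding cc' by (simp only: mult_left_cancel not_False_eq_True)
  then have "jconst s a0 a1 a2 a3 * (S ?t b0 - S ?t (a0 / s)) = - c * jconst s b0 b1 b2 b3 * (S ?t' (b0 / s) - S ?t' a0)"
    by algebra
  moreover have "mset [a0 / s, a1 / s, a2 / s, a3 / s, b0, b1, b2, b3] = mset ?t"
    by simp
  ultimately show ?thesis
    unfolding c_def[symmetric] Q_def using S_mset_cong[of "[a0 / s, a1 / s, a2 / s, a3 / s, b0, b1, b2, b3]" ?t] by simp
qed

subsection \<open>Independent parameters\<close>

text \<open>Multiplicative independence of eight numbers modulo \<open>q\<^sup>\<int>\<close>, up to the relation
  forced by the balancing condition that their product is a power of \<open>q\<close>.\<close>

definition indep :: "complex list \<Rightarrow> bool" where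
  "indep ts \<longleftrightarrow> length ts = 8 \<and> prod_list ts = q\<^sup>2 \<and>
     (\<forall>ks. length ks = 8 \<longrightarrow> prod_list (map2 (powi) ts ks) \<in> Zq \<longrightarrow> (\<exists>c. set ks \<subseteq> {c}))"

text \<open>Permuting the exponents along with the parameters leaves the monomial unchanged, and the
  conclusion on the exponents is symmetric.\<close>

lemma indep_mset_cong:
  assumes "indep ts" and "mset ts = mset us"
  shows "indep us"
proof -
  have len: "length ts = 8" "length us = 8"
    using assms(1) mset_eq_length[OF assms(2)] unfolding indep_def by simp_all
  obtain p where p: "p permutes {..<length ts}" "permute_list p ts = us"
    by (rule mset_eq_permutation[OF assms(2)[symmetric]])
  have "\<exists>c. set ks \<subseteq> {c}" if ks: "length ks = 8" "prod_list (map2 (powi) us ks) \<in> Zq" for ks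
  proof -
    define ls where "ls = permute_list (inv p) ks"
    have pk: "p permutes {..<length ks}" "inv p permutes {..<length ks}"
      using p(1) len ks permutes_inv[OF p(1)] by simp_all
    have pl: "permute_list p ls = ks"
      unfolding ls_def using permute_list_compose[OF pk(1), of "inv p"] permutes_inv_o[OF p(1)] by simp
    have ll: "length ts = length ls"
      using len ks by (simp add: ls_def)
    have "permute_list p (zip ts ls) = zip us ks"
      using permute_list_zip[OF p(1) refl ll] unfolding p(2) pl .
    moreover have "permute_list p (map2 (powi) ts ls) = map (\<lambda>(x, k). x powi k) (permute_list p (zip ts ls))"
      by (rule permute_list_map) (use p(1) ll in simp)
    ultimately have m: "map2 (powi) us ks = permute_list p (map2 (powi) ts ls)"
      by (simp only:)
    have "mset (map2 (powi) us ks) = mset (map2 (powi) ts ls)"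
      unfolding m by (rule mset_permute_list) (use p(1) ll in simp)
    then have "prod_list (map2 (powi) ts ls) \<in> Zq"
      using ks(2) unfolding prod_mset_prod_list[symmetric] by simp
    moreover have "length ls = 8"
      using ks by (simp add: ls_def)
    ultimately have "\<exists>c. set ls \<subseteq> {c}"
      using assms(1) unfolding indep_def by simp
    then obtain c where "set ls \<subseteq> {c}" ..
    moreover have "set ls = set ks"
      unfolding ls_def using pk(2) by simp
    ultimately show ?thesis by auto
  qed
  moreover have "prod_list us = q\<^sup>2"
    using assms unfolding indep_def prod_mset_prod_list[symmetric] by simp
  ultimately show ?thesis
    using len by (simp add: indep_def)
qed

lemma indepD:
  assumes "indep [t0, t1, t2, t3, t4, t5, t6, t7]"
    and "t0 powi k0 * t1 powi k1 * t2 powi k2 * t3 powi k3 * t4 powi k4 * t5 powi k5 * t6 powi k6 * t7 powi k7 \<in> Zq"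
  shows "k1 = k0 \<and> k2 = k0 \<and> k3 = k0 \<and> k4 = k0 \<and> k5 = k0 \<and> k6 = k0 \<and> k7 = k0"
proof -
  have "prod_list (map2 (powi) [t0, t1, t2, t3, t4, t5, t6, t7] [k0, k1, k2, k3, k4, k5, k6, k7]) \<in> Zq"
    using assms(2) by (simp add: mult.assoc)
  then have "\<exists>c. set [k0, k1, k2, k3, k4, k5, k6, k7] \<subseteq> {c}"
    using assms(1) unfolding indep_def by (elim conjE allE[of _ "[k0, k1, k2, k3, k4, k5, k6, k7]"]) simp
  then show ?thesis by auto
qed

lemma indepI:
  assumes "t0 * t1 * t2 * t3 * t4 * t5 * t6 * t7 = q\<^sup>2"
    and "\<And>k0 k1 k2 k3 k4 k5 k6 k7. t0 powi k0 * t1 powi k1 * t2 powi k2 * t3 powi k3 * t4 powi k4 * t5 powi k5 * t6 powi k6 * t7 powi k7 \<in> Zq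
      \<Longrightarrow> k1 = k0 \<and> k2 = k0 \<and> k3 = k0 \<and> k4 = k0 \<and> k5 = k0 \<and> k6 = k0 \<and> k7 = k0"
  shows "indep [t0, t1, t2, t3, t4, t5, t6, t7]"
  unfolding indep_def
proof (intro conjI allI impI)
  fix ks :: "int list"
  assume "length ks = 8"
  then obtain k0 k1 k2 k3 k4 k5 k6 k7 where ks: "ks = [k0, k1, k2, k3, k4, k5, k6, k7]"
    by (auto simp: numeral_eq_Suc length_Suc_conv)
  assume "prod_list (map2 (powi) [t0, t1, t2, t3, t4, t5, t6, t7] ks) \<in> Zq"
  then have "k1 = k0 \<and> k2 = k0 \<and> k3 = k0 \<and> k4 = k0 \<and> k5 = k0 \<and> k6 = k0 \<and> k7 = k0"
    using assms(2)[of k0 k1 k2 k3 k4 k5 k6 k7] by (simp add: ks mult.assoc)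
  then show "\<exists>c. set ks \<subseteq> {c}"
    unfolding ks by auto
qed (use assms(1) in \<open>simp_all add: mult.assoc\<close>)

lemma indep_prod: "indep [t0, t1, t2, t3, t4, t5, t6, t7] \<Longrightarrow> t0 * t1 * t2 * t3 * t4 * t5 * t6 * t7 = q\<^sup>2"
  by (simp add: indep_def mult.assoc)

lemma indep_nz: "indep [t0, t1, t2, t3, t4, t5, t6, t7] \<Longrightarrow>
  t0 \<noteq> 0 \<and> t1 \<noteq> 0 \<and> t2 \<noteq> 0 \<and> t3 \<noteq> 0 \<and> t4 \<noteq> 0 \<and> t5 \<noteq> 0 \<and> t6 \<noteq> 0 \<and> t7 \<noteq> 0"
  using indep_prod[of t0 t1 t2 t3 t4 t5 t6 t7] by auto

lemma Zq_power2: "x \<in> Zq \<Longrightarrow> x\<^sup>2 \<in> Zq"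
  by (simp add: power2_eq_square Zq_mult)

text \<open>Only the square of \<open>s\<close> is a monomial in the parameters, so the given
  relation is squared first. The exponents become \<open>2 k - n\<close> in the scaled group and
  \<open>2 k\<close> in the other. If all agree, then \<open>k\<close> is constant on each group;
  comparing the groups gives \<open>n = 2 (k0 - k4)\<close>, whereas the definition of
  \<open>n\<close> gives \<open>4 (k0 - k4)\<close>, so the two constants coincide.\<close>

lemma indep_reflect:
  assumes ind: "indep [t0, t1, t2, t3, t4, t5, t6, t7]" and s: "s\<^sup>2 * (t0 * t1 * t2 * t3) = q"
  shows "indep [s * t0, s * t1, s * t2, s * t3, t4 / s, t5 / s, t6 / s, t7 / s]"
proof (rule indepI)
  note nz = indep_nz[OF ind]
  have s0: "s \<noteq> 0" using s by auto
  show "s * t0 * (s * t1) * (s * t2) * (s * t3) * (t4 / s) * (t5 / s) * (t6 / s) * (t7 / s) = q\<^sup>2"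
    using indep_prod[OF ind] s0 by (simp add: mult_ac)
  fix k0 k1 k2 k3 k4 k5 k6 k7 :: int
  define n where "n = k0 + k1 + k2 + k3 - (k4 + k5 + k6 + k7)"
  define z where "z = t0 powi k0 * t1 powi k1 * t2 powi k2 * t3 powi k3 * t4 powi k4 * t5 powi k5 * t6 powi k6 * t7 powi k7"
  assume "(s * t0) powi k0 * (s * t1) powi k1 * (s * t2) powi k2 * (s * t3) powi k3
    * (t4 / s) powi k4 * (t5 / s) powi k5 * (t6 / s) powi k6 * (t7 / s) powi k7 \<in> Zq"
  also have "(s * t0) powi k0 * (s * t1) powi k1 * (s * t2) powi k2 * (s * t3) powi k3
    * (t4 / s) powi k4 * (t5 / s) powi k5 * (t6 / s) powi k6 * (t7 / s) powi k7 = s powi n * z"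
    unfolding n_def z_def power_int_diff[OF disjI1[OF s0]] power_int_add[OF disjI1[OF s0]]
      power_int_mult_distrib power_int_divide_distrib by simp
  finally have "(s powi n * z)\<^sup>2 \<in> Zq"
    by (rule Zq_power2)
  also have "(s powi n * z)\<^sup>2 = (s\<^sup>2) powi n * z\<^sup>2"
    by (simp add: power_mult_distrib power2_eq_square power_int_mult_distrib)
  also have "s\<^sup>2 = q / (t0 * t1 * t2 * t3)"
    using s nz by (simp add: eq_divide_eq)
  also have "(q / (t0 * t1 * t2 * t3)) powi n * z\<^sup>2
    = q powi n * (t0 powi (2 * k0 - n) * t1 powi (2 * k1 - n) * t2 powi (2 * k2 - n) * t3 powi (2 * k3 - n)
        * t4 powi (2 * k4) * t5 powi (2 * k5) * t6 powi (2 * k6) * t7 powi (2 * k7))"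
  proof -
    have p: "x powi (2 * k) = (x powi k)\<^sup>2" "x powi (2 * k - n) = (x powi k)\<^sup>2 / x powi n" if "x \<noteq> 0" for x :: complex and k
      using that power_int_add[of x k k] power_int_diff[of x "2 * k" n] by (simp_all add: power2_eq_square)
    have "t0 \<noteq> 0" "t1 \<noteq> 0" "t2 \<noteq> 0" "t3 \<noteq> 0" "t4 \<noteq> 0" "t5 \<noteq> 0" "t6 \<noteq> 0" "t7 \<noteq> 0"
      using nz by simp_all
    note p = this[THEN p(1)] this[THEN p(2)]
    show ?thesis
      unfolding p z_def power_int_mult_distrib power_int_divide_distrib power_mult_distrib by simp
  qed
  finally have "q powi n * (t0 powi (2 * k0 - n) * t1 powi (2 * k1 - n) * t2 powi (2 * k2 - n) * t3 powi (2 * k3 - n)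
        * t4 powi (2 * k4) * t5 powi (2 * k5) * t6 powi (2 * k6) * t7 powi (2 * k7)) / q powi n \<in> Zq"
    by (rule Zq_divide[OF _ q_powi_in_Zq])
  then have "t0 powi (2 * k0 - n) * t1 powi (2 * k1 - n) * t2 powi (2 * k2 - n) * t3 powi (2 * k3 - n)
        * t4 powi (2 * k4) * t5 powi (2 * k5) * t6 powi (2 * k6) * t7 powi (2 * k7) \<in> Zq"
    by (simp only: nonzero_mult_div_cancel_left power_int_eq_0_iff q_nz simp_thms)
  from indepD[OF ind this] n_def
  show "k1 = k0 \<and> k2 = k0 \<and> k3 = k0 \<and> k4 = k0 \<and> k5 = k0 \<and> k6 = k0 \<and> k7 = k0"
    by (intro conjI; linarith)
qed

lemma indep_invert:
  assumes ind: "indep [t0, t1, t2, t3, t4, t5, t6, t7]" and r: "r\<^sup>2 = q"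
  shows "indep [r / t0, r / t1, r / t2, r / t3, r / t4, r / t5, r / t6, r / t7]"
proof (rule indepI)
  note nz = indep_nz[OF ind]
  have r0: "r \<noteq> 0" using r by auto
  have "r / t0 * (r / t1) * (r / t2) * (r / t3) * (r / t4) * (r / t5) * (r / t6) * (r / t7)
    = (r\<^sup>2) ^ 4 / (t0 * t1 * t2 * t3 * t4 * t5 * t6 * t7)"
    by (simp add: eval_nat_numeral)
  also have "\<dots> = q\<^sup>2"
    unfolding indep_prod[OF ind] r by (simp add: eval_nat_numeral)
  finally show "r / t0 * (r / t1) * (r / t2) * (r / t3) * (r / t4) * (r / t5) * (r / t6) * (r / t7) = q\<^sup>2" .
  fix k0 k1 k2 k3 k4 k5 k6 k7 :: int
  define n where "n = k0 + k1 + k2 + k3 + k4 + k5 + k6 + k7"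
  define z where "z = t0 powi k0 * t1 powi k1 * t2 powi k2 * t3 powi k3 * t4 powi k4 * t5 powi k5 * t6 powi k6 * t7 powi k7"
  have z: "z \<noteq> 0" using nz by (simp add: z_def)
  assume "(r / t0) powi k0 * (r / t1) powi k1 * (r / t2) powi k2 * (r / t3) powi k3
    * (r / t4) powi k4 * (r / t5) powi k5 * (r / t6) powi k6 * (r / t7) powi k7 \<in> Zq"
  also have "(r / t0) powi k0 * (r / t1) powi k1 * (r / t2) powi k2 * (r / t3) powi k3
    * (r / t4) powi k4 * (r / t5) powi k5 * (r / t6) powi k6 * (r / t7) powi k7 = r powi n / z"
    unfolding n_def z_def power_int_add[OF disjI1[OF r0]] power_int_divide_distrib by simp
  finally have "(r powi n / z)\<^sup>2 \<in> Zq"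
    by (rule Zq_power2)
  moreover have "(r powi n / z)\<^sup>2 = q powi n / z\<^sup>2"
    unfolding r[symmetric] by (simp add: power_divide power2_eq_square power_int_mult_distrib)
  ultimately have h: "q powi n / z\<^sup>2 \<in> Zq"
    by (simp only:)
  have "q powi n / (q powi n / z\<^sup>2) \<in> Zq"
    by (rule Zq_divide[OF q_powi_in_Zq h])
  moreover have "q powi n / (q powi n / z\<^sup>2) = t0 powi (2 * k0) * t1 powi (2 * k1) * t2 powi (2 * k2) * t3 powi (2 * k3)
        * t4 powi (2 * k4) * t5 powi (2 * k5) * t6 powi (2 * k6) * t7 powi (2 * k7)"
  proof -
    have p: "x powi (2 * k) = x powi k * x powi k" if "x \<noteq> 0" for x :: complex and k
      using that power_int_add[of x k k] by simp
    show ?thesis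
      using nz by (simp add: p z_def power2_eq_square)
  qed
  ultimately have "t0 powi (2 * k0) * t1 powi (2 * k1) * t2 powi (2 * k2) * t3 powi (2 * k3)
        * t4 powi (2 * k4) * t5 powi (2 * k5) * t6 powi (2 * k6) * t7 powi (2 * k7) \<in> Zq"
    by simp
  from indepD[OF ind this]
  show "k1 = k0 \<and> k2 = k0 \<and> k3 = k0 \<and> k4 = k0 \<and> k5 = k0 \<and> k6 = k0 \<and> k7 = k0"
    by (intro conjI; linarith)
qed

lemma indep_pair:
  assumes ind: "indep ts" and us: "mset ts = mset (x # y # us)"
  shows "x * y \<notin> Zq" "x / y \<notin> Zq" "x * x \<notin> Zq"
proof -
  have "length us = 6"
    using ind mset_eq_length[OF us] by (simp add: indep_def)
  then obtain t2 t3 t4 t5 t6 t7 where "us = [t2, t3, t4, t5, t6, t7]"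
    by (auto simp: numeral_eq_Suc length_Suc_conv)
  then have ind: "indep [x, y, t2, t3, t4, t5, t6, t7]"
    using indep_mset_cong[OF ind us] by simp
  show "x * y \<notin> Zq"
    using indepD[OF ind, of 1 1 0 0 0 0 0 0] by auto
  show "x / y \<notin> Zq"
    using indepD[OF ind, of 1 "-1" 0 0 0 0 0 0] by (auto simp: power_int_minus divide_inverse)
  show "x * x \<notin> Zq"
    using indepD[OF ind, of 2 0 0 0 0 0 0 0] by (auto simp: power2_eq_square)
qed

lemma indep_distinct: "indep ts \<Longrightarrow> distinct ts"
proof (rule ccontr)
  assume ind: "indep ts" and "\<not> distinct ts"
  then obtain xs ys zs y where "ts = xs @ [y] @ ys @ [y] @ zs"
    using not_distinct_decomp[of ts] by auto
  then have us: "mset ts = mset (y # y # xs @ ys @ zs)"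
    by simp
  have "prod_list ts \<noteq> 0" "y \<in> set ts"
    using ind mset_eq_setD[OF us] by (auto simp: indep_def)
  then have "y / y = 1"
    by (auto simp: prod_list_zero_iff)
  then show False
    using indep_pair(2)[OF ind us] by simp
qed

lemma indep_members:
  assumes "indep ts" and "x \<in> set ts" "y \<in> set ts" "x \<noteq> y"
  shows "x * y \<notin> Zq" "x / y \<notin> Zq" "x * x \<notin> Zq"
proof -
  obtain N where N: "mset ts = add_mset x N"
    using multi_member_split[of x "mset ts"] assms(2) by auto
  then have "y \<in># N"
    using assms(3,4) set_mset_mset[of ts] by auto
  then obtain M where "N = add_mset y M"
    using multi_member_split[of y N] by auto
  moreover obtain us where "mset us = M"
    using ex_mset by auto
  ultimately have "mset ts = mset (x # y # us)"
    using N by simp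
  from indep_pair[OF assms(1) this] show "x * y \<notin> Zq" "x / y \<notin> Zq" "x * x \<notin> Zq" .
qed

lemma indep_quad:
  assumes "indep [t0, t1, t2, t3, t4, t5, t6, t7]"
  shows "t0 * t1 * t2 * t3 \<notin> Zq" "t0 / (t1 * t2 * t3) \<notin> Zq"
  using indepD[OF assms, of 1 1 1 1 0 0 0 0] indepD[OF assms, of 1 "-1" "-1" "-1" 0 0 0 0]
  by (auto simp: power_int_minus divide_inverse mult.assoc)

text \<open>With \<open>s^2\<close> expressed by the parameters, each nonvanishing condition
  concerns, up to powers of \<open>q\<close> and inversion, a square, a product or quotient of two
  parameters, a product of four, or one parameter divided by three others.\<close>

lemma indep_generic_pair:
  assumes ind: "indep [t0, c, d, e, b, f, g, h]" and s: "s\<^sup>2 * (t0 * c * d * e) = q"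
  shows "generic_pair s (s * t0, s * c, s * d, s * e) (b, f, g, h)"
proof -
  have nz: "t0 \<noteq> 0" "c \<noteq> 0" "d \<noteq> 0" "e \<noteq> 0" "b \<noteq> 0" "f \<noteq> 0" "g \<noteq> 0" "h \<noteq> 0" "s \<noteq> 0"
    using indep_nz[OF ind] s by auto
  have s2: "q = s * s * (t0 * c * d * e)"
    using s by (simp add: power2_eq_square)
  have p1: "s * t0 * (s * c) * (s * d) * (s * e) = q * s\<^sup>2"
    by (simp add: s2 power2_eq_square)
  have "t0 * c * d * e * (b * f * g * h) = q * q"
    using indep_prod[OF ind] by (simp add: power2_eq_square mult.assoc)
  then have "q * (b * f * g * h) = s\<^sup>2 * (q * q)"
    using s by (metis mult.assoc)
  then have p2: "b * f * g * h = q * s\<^sup>2"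
    by (simp add: mult_ac)
  have bb: "b * b / s\<^sup>2 = q * b / (f * g * h)"
    using p2 nz by (simp add: divide_simps mult_ac)
  have e1: "1 / s\<^sup>2 = t0 * c * d * e / q" "s * t0 * (s * t0) / s\<^sup>2 = t0 * t0"
    "s * t0 * x / s = t0 * x" "x * (s * y) / s = x * y" "s * x / (y * s) = x / y" "s * x / (s * y) = x / y"
    "x / (s * t0 * s) = x * c * d * e / q" for x y
    using nz by (simp_all add: s2 power2_eq_square divide_simps)
  have e2: "s * t0 * (s * t0) = q * t0 / (c * d * e)"
    "s * t0 * (s * c) = q / (d * e)" "s * t0 * (s * d) = q / (c * e)" "s * t0 * (s * e) = q / (c * d)"
    "s * c * (s * d) = q / (t0 * e)" "s * c * (s * e) = q / (t0 * d)" "s * d * (s * e) = q / (t0 * c)"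
    using nz by (simp_all add: s2 divide_simps)
  have perm: "indep [b, c, d, e, t0, f, g, h]" "indep [f, c, d, e, t0, b, g, h]" "indep [g, c, d, e, t0, b, f, h]"
    "indep [h, c, d, e, t0, b, f, g]" "indep [b, f, g, h, t0, c, d, e]"
    by (rule indep_mset_cong[OF ind], simp)+
  have sq: "b * b \<notin> Zq"
    by (rule indep_pair(3)[OF perm(1) refl])
  have bs: "b * c \<notin> Zq" "b * d \<notin> Zq" "b * e \<notin> Zq"
    using indep_distinct[OF ind] indep_members(1)[OF ind, of c b] indep_members(1)[OF ind, of d b]
      indep_members(1)[OF ind, of e b] by (auto simp: mult.commute)
  note quads = indep_quad[OF ind] indep_quad[OF perm(1)] indep_quad[OF perm(2)] indep_quad[OF perm(3)]
    indep_quad[OF perm(4)] indep_quad[OF perm(5)]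
  show ?thesis
    unfolding generic_pair_def prod.case p1 p2 bb e1 unfolding e2 Zq_q_div
    using nz quads indep_distinct[OF ind] indep_pair(3)[OF ind refl] sq bs
    by (simp add: indep_members[OF ind])
qed

subsection \<open>Symmetries and three-term relations\<close>

text \<open>A multiple of $\Phi$ that Bailey's transformation leaves exactly invariant.\<close>

definition Psi :: "complex \<Rightarrow> complex \<Rightarrow> complex list \<Rightarrow> complex" where
  "Psi c d es = Q (c # d # es) c d * (\<Prod>e\<leftarrow>es. P (c * e) * P (d * e)) / (c * th (d / c))"

lemma prod_list_mset_cong: "mset xs = mset ys \<Longrightarrow> (\<Prod>x\<leftarrow>xs. f x) = (\<Prod>x\<leftarrow>ys. f x :: complex)"
  by (simp only: prod_mset_prod_list[symmetric] mset_map)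

lemma Psi_mset_cong: "mset es = mset fs \<Longrightarrow> Psi c d es = Psi c d fs"
  using Q_mset_cong[of "c # d # es" "c # d # fs"] prod_list_mset_cong[of es fs] by (simp add: Psi_def)

lemma Psi_commute:
  assumes "c \<noteq> 0" "d \<noteq> 0"
  shows "Psi c d es = Psi d c es"
proof -
  have "Q (c # d # es) c d = - Q (d # c # es) d c"
    using Q_mset_cong[of "c # d # es" "d # c # es"] by (simp add: Q_def)
  moreover have "d * th (c / d) = - (c * th (d / c))"
    using th_inverse[of "d / c"] assms by simp
  ultimately show ?thesis
    unfolding Psi_def by (simp add: mult.commute)
qed

text \<open>By the balancing, \<open>jconst\<close> consists of pair products within the groups: in
  one group the numerators belong to the old parameters and the denominators to the new ones, in the
  other group conversely. The pair products \<open>M\<close> across the groups are unchanged by the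
  scaling. So the constants are exactly absorbed by the normalisation in \<open>Psi\<close>.\<close>

lemma bailey_norm:
  assumes ind: "indep [t0, c, d, e, b, f, g, h]" and s: "s\<^sup>2 * (t0 * c * d * e) = q" and n: "norm q < (norm s)\<^sup>2"
  shows "Psi t0 b [c, d, e, f, g, h] = Psi (s * t0) (b / s) [s * c, s * d, s * e, f / s, g / s, h / s]"
proof -
  have gen: "generic_pair s (s * t0, s * c, s * d, s * e) (b, f, g, h)"
    by (rule indep_generic_pair[OF ind s])
  note gp = gen[unfolded generic_pair_def prod.case]
  have nz: "t0 \<noteq> 0" "c \<noteq> 0" "d \<noteq> 0" "e \<noteq> 0" "b \<noteq> 0" "f \<noteq> 0" "g \<noteq> 0" "h \<noteq> 0" "s \<noteq> 0"
    using indep_nz[OF ind] s by auto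
  have q2: "q * s\<^sup>2 = b * f * g * h"
    using gp by simp
  have pairs: "q / (s * c * (s * d)) = t0 * e" "q / (s * c * (s * e)) = t0 * d" "q / (s * d * (s * e)) = t0 * c"
    "q / (f * g) = b / s * (h / s)" "q / (f * h) = b / s * (g / s)" "q / (g * h) = b / s * (f / s)"
    using nz s q2 by (simp_all add: field_simps power2_eq_square)
  let ?t = "[t0, c, d, e, b, f, g, h]" and ?t' = "[s * t0, s * c, s * d, s * e, b / s, f / s, g / s, h / s]"
  define X Y Z V M p where "X = P (t0 * c) * P (t0 * d) * P (t0 * e)"
    and "Y = P (s * t0 * (s * c)) * P (s * t0 * (s * d)) * P (s * t0 * (s * e))"
    and "Z = P (b * f) * P (b * g) * P (b * h)" and "V = P (b / s * (f / s)) * P (b / s * (g / s)) * P (b / s * (h / s))"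
    and "M = P (t0 * f) * P (t0 * g) * P (t0 * h) * P (b * c) * P (b * d) * P (b * e)" and "p = P (1 / s\<^sup>2)"
  have nn: "Y \<noteq> 0" "Z \<noteq> 0" "p \<noteq> 0"
    using gp by (simp_all add: Y_def Z_def p_def P_nz)
  define K where "K = b / (s * t0) * (th (t0 / b) / th (b / (s * t0 * s)))"
  have j: "jconst s (s * t0) (s * c) (s * d) (s * e) = X / (Y * p)" "jconst s b f g h = V / (Z * p)"
    unfolding jconst_def pairs X_def Y_def Z_def V_def p_def by (simp_all add: mult_ac)
  have main: "X / (Y * p) * Q ?t t0 b = - K * (V / (Z * p)) * Q ?t' (s * t0) (b / s)"
    using Q_transformation_norm[OF gen n] nz unfolding j K_def by simp
  have "X * Z * Q ?t t0 b = (Y * Z * p) * (X / (Y * p) * Q ?t t0 b)"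
    using nn by simp
  also have "\<dots> = - K * (V * Y) * Q ?t' (s * t0) (b / s)"
    unfolding main using nn by simp
  finally have m2: "X * Z * Q ?t t0 b = - K * (V * Y) * Q ?t' (s * t0) (b / s)" .
  have th1: "th (t0 / b) = - (t0 / b) * th (b / t0)"
    using th_inverse[of "b / t0"] nz by simp
  have tz: "th (b / t0) \<noteq> 0" "th (b / (s * t0 * s)) \<noteq> 0"
    using gp nz Zq_inverse_iff[of "b / t0"] by (auto intro!: th_nz)
  have K: "- K / (t0 * th (b / t0)) = 1 / (s * t0 * th (b / s / (s * t0)))"
    unfolding K_def th1 using nz tz by (simp add: mult_ac)
  have "mset [t0, b, c, d, e, f, g, h] = mset ?t" "mset [s * t0, b / s, s * c, s * d, s * e, f / s, g / s, h / s] = mset ?t'"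
    by simp_all
  then have Q: "Q [t0, b, c, d, e, f, g, h] = Q ?t" "Q [s * t0, b / s, s * c, s * d, s * e, f / s, g / s, h / s] = Q ?t'"
    by (auto intro!: Q_mset_cong)
  have "Psi t0 b [c, d, e, f, g, h] = (X * Z * Q ?t t0 b) * M / (t0 * th (b / t0))"
    unfolding Psi_def Q X_def Z_def M_def by (simp add: mult_ac)
  also have "\<dots> = (- K / (t0 * th (b / t0))) * (V * Y * M * Q ?t' (s * t0) (b / s))"
    unfolding m2 by simp
  also have "\<dots> = Psi (s * t0) (b / s) [s * c, s * d, s * e, f / s, g / s, h / s]"
    unfolding K Psi_def Q V_def Y_def M_def using nz by (simp add: mult_ac)
  finally show ?thesis .
qed

text \<open>If the convergence bound fails, then \<open>norm s < 1\<close>, and the bound holds for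
  \<open>1 / s\<close>, which is the admissible scaling for the other group. Since
  \<open>Psi\<close> is symmetric in its end points, exchanging the groups gives the same
  identity.\<close>

theorem bailey_transformation:
  assumes ind: "indep [t0, c, d, e, b, f, g, h]" and s: "s\<^sup>2 * (t0 * c * d * e) = q"
  shows "Psi t0 b [c, d, e, f, g, h] = Psi (s * t0) (b / s) [s * c, s * d, s * e, f / s, g / s, h / s]"
proof (cases "norm q < (norm s)\<^sup>2")
  case True
  then show ?thesis
    by (rule bailey_norm[OF ind s])
next
  case False
  have nz: "t0 \<noteq> 0" "b \<noteq> 0" "s \<noteq> 0"
    using indep_nz[OF ind] s by auto
  have "(norm s)\<^sup>2 < 1"
    using False norm_q by simp
  then have "1 < (norm (1 / s))\<^sup>2"
    using nz by (simp add: norm_divide power_divide)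
  then have n: "norm q < (norm (1 / s))\<^sup>2"
    using norm_q by simp
  have ind': "indep [b, f, g, h, t0, c, d, e]"
    by (rule indep_mset_cong[OF ind]) simp
  have "q * (b * f * g * h) = s\<^sup>2 * (t0 * c * d * e * b * f * g * h)"
    unfolding s[symmetric] by (simp add: mult_ac)
  then have "b * f * g * h = s\<^sup>2 * q"
    unfolding indep_prod[OF ind] by (simp add: power2_eq_square mult_ac)
  then have s': "(1 / s)\<^sup>2 * (b * f * g * h) = q"
    using nz by (simp add: power_divide)
  have "Psi t0 b [c, d, e, f, g, h] = Psi b t0 [f, g, h, c, d, e]"
    unfolding Psi_commute[OF nz(1,2)] by (rule Psi_mset_cong) simp
  also have "\<dots> = Psi (b / s) (s * t0) [f / s, g / s, h / s, s * c, s * d, s * e]"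
    using bailey_norm[OF ind' s' n] by (simp add: mult.commute)
  also have "\<dots> = Psi (s * t0) (b / s) [f / s, g / s, h / s, s * c, s * d, s * e]"
    by (rule Psi_commute) (use nz in simp_all)
  also have "\<dots> = Psi (s * t0) (b / s) [s * c, s * d, s * e, f / s, g / s, h / s]"
    by (rule Psi_mset_cong) simp
  finally show ?thesis .
qed

lemma sqrt_exists: "x \<noteq> 0 \<Longrightarrow> \<exists>s. s\<^sup>2 * x = (y :: complex)"
  by (rule exI[of _ "csqrt (y / x)"]) simp

text \<open>Two further transformations that separate \<open>i\<close> from \<open>j\<close> compose to the inversion
  \<open>t \<mapsto> r / t\<close> up to a permutation of the parameters.\<close>

lemma reflected_Psi_eq_inverted_Psi:
  assumes ind: "indep [i, j, l, m, k, e, f, g]" and s: "s\<^sup>2 * (i * j * l * m) = q" and r: "r\<^sup>2 = q"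
  shows "Psi (s * i) (s * j) [s * l, s * m, k / s, e / s, f / s, g / s]
    = Psi (r / l) (r / m) [r / i, r / j, r / k, r / e, r / f, r / g]"
proof -
  have nz: "i \<noteq> 0" "j \<noteq> 0" "l \<noteq> 0" "m \<noteq> 0" "k \<noteq> 0" "e \<noteq> 0" "f \<noteq> 0" "g \<noteq> 0" "s \<noteq> 0" "r \<noteq> 0"
    using indep_nz[OF ind] s r by auto
  note pr = indep_prod[OF ind]
  have ind': "indep [s * i, s * j, s * l, s * m, k / s, e / s, f / s, g / s]"
    by (rule indep_reflect[OF ind s])
  obtain \<tau> where \<tau>: "\<tau>\<^sup>2 * (i * l * e * f) = q"
    using sqrt_exists[of "i * l * e * f" q] nz by auto
  have \<tau>0: "\<tau> \<noteq> 0" using \<tau> by auto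
  \<comment> \<open>Chosen so that the scalings by \<open>s\<close>, \<open>\<tau>\<close> and
    \<open>\<upsilon>\<close> together send \<open>i\<close> to \<open>r / l\<close> and
    \<open>l\<close> to \<open>r / i\<close>; the total product of the parameters then makes it
    admissible.\<close>
  define \<upsilon> where "\<upsilon> = r / (l * i * s * \<tau>)"
  have \<upsilon>0: "\<upsilon> \<noteq> 0" using nz \<tau>0 by (simp add: \<upsilon>_def)
  have \<upsilon>: "\<upsilon>\<^sup>2 * (i * l * k * g) = q"
  proof -
    have a: "s\<^sup>2 = q / (i * j * l * m)" "\<tau>\<^sup>2 = q / (i * l * e * f)"
      using s \<tau> nz by (simp_all add: eq_divide_eq)
    have "\<upsilon>\<^sup>2 * (i * l * k * g) = i * j * l * m * k * e * f * g / q"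
      unfolding \<upsilon>_def power_divide power_mult_distrib r a using nz by (simp add: power2_eq_square mult_ac)
    then show ?thesis
      unfolding pr by (simp add: power2_eq_square)
  qed
  have ind1: "indep [s * i, s * l, e / s, f / s, s * j, s * m, k / s, g / s]"
    by (rule indep_mset_cong[OF ind']) simp
  have t1: "\<tau>\<^sup>2 * (s * i * (s * l) * (e / s) * (f / s)) = q"
    using \<tau> nz by (simp add: mult_ac)
  have ind2: "indep [\<tau> * (s * i), \<tau> * (s * l), k / s / \<tau>, g / s / \<tau>, s * j / \<tau>, s * m / \<tau>, \<tau> * (e / s), \<tau> * (f / s)]"
    by (rule indep_mset_cong[OF indep_reflect[OF ind1 t1]]) simp
  have t2: "\<upsilon>\<^sup>2 * (\<tau> * (s * i) * (\<tau> * (s * l)) * (k / s / \<tau>) * (g / s / \<tau>)) = q"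
    using \<upsilon> nz \<tau>0 by (simp add: mult_ac)
  have "Psi (s * i) (s * j) [s * l, s * m, k / s, e / s, f / s, g / s] = Psi (s * i) (s * j) [s * l, e / s, f / s, s * m, k / s, g / s]"
    by (rule Psi_mset_cong) simp
  also have "\<dots> = Psi (\<tau> * (s * i)) (s * j / \<tau>) [\<tau> * (s * l), \<tau> * (e / s), \<tau> * (f / s), s * m / \<tau>, k / s / \<tau>, g / s / \<tau>]"
    by (rule bailey_transformation[OF ind1 t1])
  also have "\<dots> = Psi (\<tau> * (s * i)) (s * j / \<tau>) [\<tau> * (s * l), k / s / \<tau>, g / s / \<tau>, s * m / \<tau>, \<tau> * (e / s), \<tau> * (f / s)]"
    by (rule Psi_mset_cong) simp
  also have "\<dots> = Psi (\<upsilon> * (\<tau> * (s * i))) (s * j / \<tau> / \<upsilon>) [\<upsilon> * (\<tau> * (s * l)), \<upsilon> * (k / s / \<tau>), \<upsilon> * (g / s / \<tau>), s * m / \<tau> / \<upsilon>, \<tau> * (e / s) / \<upsilon>, \<tau> * (f / s) / \<upsilon>]"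
    by (rule bailey_transformation[OF ind2 t2])
  also have "\<upsilon> * (\<tau> * (s * i)) = r / l"
    using nz \<tau>0 by (simp add: \<upsilon>_def)
  also have "\<upsilon> * (\<tau> * (s * l)) = r / i"
    using nz \<tau>0 by (simp add: \<upsilon>_def)
  also have "s * j / \<tau> / \<upsilon> = r / m"
  proof -
    have "s * j / \<tau> / \<upsilon> = s\<^sup>2 * (i * j * l * m) / (r * m)"
      using nz \<tau>0 by (simp add: \<upsilon>_def power2_eq_square)
    then show ?thesis
      unfolding s r[symmetric] using nz by (simp add: power2_eq_square)
  qed
  also have "s * m / \<tau> / \<upsilon> = r / j"
  proof -
    have "s * m / \<tau> / \<upsilon> = s\<^sup>2 * (i * j * l * m) / (r * j)"
      using nz \<tau>0 by (simp add: \<upsilon>_def power2_eq_square)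
    then show ?thesis
      unfolding s r[symmetric] using nz by (simp add: power2_eq_square)
  qed
  also have "\<tau> * (e / s) / \<upsilon> = r / f"
  proof -
    have "\<tau> * (e / s) / \<upsilon> = \<tau>\<^sup>2 * (i * l * e * f) / (r * f)"
      using nz \<tau>0 by (simp add: \<upsilon>_def power2_eq_square)
    then show ?thesis
      unfolding \<tau> r[symmetric] using nz by (simp add: power2_eq_square)
  qed
  also have "\<tau> * (f / s) / \<upsilon> = r / e"
  proof -
    have "\<tau> * (f / s) / \<upsilon> = \<tau>\<^sup>2 * (i * l * e * f) / (r * e)"
      using nz \<tau>0 by (simp add: \<upsilon>_def power2_eq_square)
    then show ?thesis
      unfolding \<tau> r[symmetric] using nz by (simp add: power2_eq_square)
  qed
  also have "\<upsilon> * (k / s / \<tau>) = r / g"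
  proof -
    have "\<upsilon> * (k / s / \<tau>) = \<upsilon>\<^sup>2 * (i * l * k * g) / (r * g)"
      using nz \<tau>0 \<upsilon>0 by (simp add: \<upsilon>_def power2_eq_square)
    then show ?thesis
      unfolding \<upsilon> r[symmetric] using nz by (simp add: power2_eq_square)
  qed
  also have "\<upsilon> * (g / s / \<tau>) = r / k"
  proof -
    have "\<upsilon> * (g / s / \<tau>) = \<upsilon>\<^sup>2 * (i * l * k * g) / (r * k)"
      using nz \<tau>0 \<upsilon>0 by (simp add: \<upsilon>_def power2_eq_square)
    then show ?thesis
      unfolding \<upsilon> r[symmetric] using nz by (simp add: power2_eq_square)
  qed
  also have "Psi (r / l) (r / m) [r / i, r / g, r / k, r / j, r / f, r / e] = Psi (r / l) (r / m) [r / i, r / j, r / k, r / e, r / f, r / g]"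
    by (rule Psi_mset_cong) simp
  finally show ?thesis .
qed

text \<open>q-integrals around a triangle of end points add up to 0. The coefficients undo the
  denominators of \<open>Psi\<close> and complete its products to one expression \<open>C\<close>
  that is the same for all three sides.\<close>

lemma Psi_triangle:
  assumes nz: "i \<noteq> 0" "j \<noteq> 0" "m \<noteq> 0" and th: "th (j / i) \<noteq> 0" "th (m / j) \<noteq> 0" "th (i / m) \<noteq> 0"
  shows "i * th (j / i) * P (i * j) * (\<Prod>k\<leftarrow>ks. P (m * k)) * Psi i j (m # ks)
    + j * th (m / j) * P (j * m) * (\<Prod>k\<leftarrow>ks. P (i * k)) * Psi j m (i # ks)
    + m * th (i / m) * P (m * i) * (\<Prod>k\<leftarrow>ks. P (j * k)) * Psi m i (j # ks) = 0"
proof -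
  define pr where "pr x = (\<Prod>k\<leftarrow>ks. P (x * k))" for x
  have d: "(\<Prod>k\<leftarrow>ks. P (x * k) * P (y * k)) = pr x * pr y" for x y
    unfolding pr_def by (induction ks) simp_all
  let ?Q = "Q (i # j # m # ks)"
  have Q: "Q (j # m # i # ks) = ?Q" "Q (m # i # j # ks) = ?Q"
    by (rule Q_mset_cong; simp)+
  define C where "C = P (i * j) * P (j * m) * P (m * i) * (pr i * pr j * pr m)"
  have p: "i * th (j / i) * P (i * j) * pr m * Psi i j (m # ks) = ?Q i j * C"
    "j * th (m / j) * P (j * m) * pr i * Psi j m (i # ks) = ?Q j m * C"
    "m * th (i / m) * P (m * i) * pr j * Psi m i (j # ks) = ?Q m i * C"
    unfolding Psi_def Q list.map prod_list.Cons d C_def using nz th by (simp_all add: mult_ac)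
  show ?thesis
    unfolding pr_def[symmetric] p by (simp add: Q_def algebra_simps)
qed

text \<open>The triangle relation after scaling the group \<open>i\<close>, \<open>j\<close>,
  \<open>l\<close>, \<open>n\<close> by \<open>s\<close>. Its two sides that leave the group go back
  to the original parameters by Bailey's transformation; the side within the group becomes the
  inverted function with the complementary pair \<open>l\<close>, \<open>n\<close>.\<close>

lemma three_term_inverted:
  assumes ind: "indep [i, j, l, n, m, e, f, g]" and r: "r\<^sup>2 = q"
  shows "i * th (j / i) * (P (q / (l * n)) * P (m * l) * P (m * n) * P (q / (e * f)) * P (q / (e * g)) * P (q / (f * g)))
        * Psi (r / l) (r / n) [r / i, r / j, r / m, r / e, r / f, r / g]
    + j * th (i * m * l * n / q) * (P (j * m) * P (q / (j * n)) * P (q / (j * l)) * P (i * e) * P (i * f) * P (i * g))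
        * Psi j m [i, l, n, e, f, g]
    - i * th (j * m * l * n / q) * (P (i * m) * P (q / (i * n)) * P (q / (i * l)) * P (j * e) * P (j * f) * P (j * g))
        * Psi i m [j, l, n, e, f, g] = 0"
proof -
  have nz: "i \<noteq> 0" "j \<noteq> 0" "l \<noteq> 0" "n \<noteq> 0" "m \<noteq> 0" "e \<noteq> 0" "f \<noteq> 0" "g \<noteq> 0"
    using indep_nz[OF ind] by auto
  obtain s where s: "s\<^sup>2 * (i * j * l * n) = q"
    using sqrt_exists[of "i * j * l * n" q] nz by auto
  have s0: "s \<noteq> 0" using s by auto
  have ind1: "indep [j, i, l, n, m, e, f, g]"
    by (rule indep_mset_cong[OF ind]) simp
  have s1: "s\<^sup>2 * (j * i * l * n) = q"
    using s by (simp add: mult_ac)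
  have h0: "Psi (s * i) (s * j) [m / s, s * l, s * n, e / s, f / s, g / s]
    = Psi (r / l) (r / n) [r / i, r / j, r / m, r / e, r / f, r / g]"
    unfolding reflected_Psi_eq_inverted_Psi[OF ind s r, symmetric] by (rule Psi_mset_cong) simp
  have h1: "Psi (s * j) (m / s) [s * i, s * l, s * n, e / s, f / s, g / s] = Psi j m [i, l, n, e, f, g]"
    by (rule bailey_transformation[OF ind1 s1, symmetric])
  have h2: "Psi (m / s) (s * i) [s * j, s * l, s * n, e / s, f / s, g / s] = Psi i m [j, l, n, e, f, g]"
    unfolding bailey_transformation[OF ind s] by (rule Psi_commute) (use nz s0 in simp_all)
  note g1 = indep_generic_pair[OF ind s, unfolded generic_pair_def prod.case]
  note g2 = indep_generic_pair[OF ind1 s1, unfolded generic_pair_def prod.case]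
  have "q * (m * e * f * g) = s\<^sup>2 * (i * j * l * n * m * e * f * g)"
    unfolding s[symmetric] by (simp add: mult_ac)
  then have sc: "m * e * f * g = s\<^sup>2 * q"
    unfolding indep_prod[OF ind] by (simp add: power2_eq_square mult_ac)
  have p: "s * i * (s * j) = q / (l * n)" "m / s * (s * l) = m * l" "m / s * (s * n) = m * n"
    "m / s * (e / s) = q / (f * g)" "m / s * (f / s) = q / (e * g)" "m / s * (g / s) = q / (e * f)"
    "s * j * (m / s) = j * m" "s * i * (s * l) = q / (j * n)" "s * i * (s * n) = q / (j * l)"
    "s * i * (e / s) = i * e" "s * i * (f / s) = i * f" "s * i * (g / s) = i * g"
    "m / s * (s * i) = i * m" "s * j * (s * l) = q / (i * n)" "s * j * (s * n) = q / (i * l)"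
    "s * j * (e / s) = j * e" "s * j * (f / s) = j * f" "s * j * (g / s) = j * g"
    using nz s0 s sc by (simp_all add: field_simps power2_eq_square)
  have t1: "m / s / (s * j) = i * m * l * n / q"
    unfolding s[symmetric] using nz s0 by (simp add: power2_eq_square)
  have t2: "s * i / (m / s) = 1 / (j * m * l * n / q)"
    unfolding s[symmetric] using nz s0 by (simp add: power2_eq_square)
  have n1: "j / i \<notin> Zq" "i * m * l * n / q \<notin> Zq" "j * m * l * n / q \<notin> Zq"
  proof -
    show "j / i \<notin> Zq"
      using g2 s0 by simp
    have "m / (s * j * s) = i * m * l * n / q" "m / (s * i * s) = j * m * l * n / q"
      unfolding s[symmetric] using nz s0 by (simp_all add: power2_eq_square)
    then show "i * m * l * n / q \<notin> Zq" "j * m * l * n / q \<notin> Zq"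
      using g1 g2 by auto
  qed
  have n3: "1 / (j * m * l * n / q) \<notin> Zq"
    unfolding inverse_eq_divide[symmetric] Zq_inverse_iff by (rule n1)
  have tt: "th (s * j / (s * i)) = th (j / i)" using s0 by simp
  \<comment> \<open>The third side runs from \<open>m\<close> to \<open>i\<close>; inverting the
    theta argument is the source of the minus sign in the relation.\<close>
  have t3: "m / s * th (s * i / (m / s)) = - (s * (i * th (j * m * l * n / q)))"
  proof -
    have "m / s * th (s * i / (m / s)) = - (m / s * (th (j * m * l * n / q) / (j * m * l * n / q)))"
      unfolding t2 using th_inverse[of "j * m * l * n / q"] nz by simp
    also have "m / s * (th (j * m * l * n / q) / (j * m * l * n / q)) = s * (i * th (j * m * l * n / q))"
    proof -
      have "j * m * l * n / q = m / (s * s * i)"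
        unfolding s[symmetric] using nz s0 by (simp add: power2_eq_square)
      then show ?thesis using nz s0 by simp
    qed
    finally show ?thesis .
  qed
  have "s * i * th (s * j / (s * i)) * P (s * i * (s * j)) * (\<Prod>k\<leftarrow>[s * l, s * n, e / s, f / s, g / s]. P (m / s * k)) * Psi (s * i) (s * j) [m / s, s * l, s * n, e / s, f / s, g / s]
    + s * j * th (m / s / (s * j)) * P (s * j * (m / s)) * (\<Prod>k\<leftarrow>[s * l, s * n, e / s, f / s, g / s]. P (s * i * k)) * Psi (s * j) (m / s) [s * i, s * l, s * n, e / s, f / s, g / s]
    + m / s * th (s * i / (m / s)) * P (m / s * (s * i)) * (\<Prod>k\<leftarrow>[s * l, s * n, e / s, f / s, g / s]. P (s * j * k)) * Psi (m / s) (s * i) [s * j, s * l, s * n, e / s, f / s, g / s] = 0"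
  proof (rule Psi_triangle)
    show "th (s * j / (s * i)) \<noteq> 0" "th (m / s / (s * j)) \<noteq> 0" "th (s * i / (m / s)) \<noteq> 0"
      unfolding tt t1 t2 by (rule th_nz, rule n1 n3)+
  qed (use nz s0 in simp_all)
  then have "s * (i * th (j / i) * (P (q / (l * n)) * P (m * l) * P (m * n) * P (q / (e * f)) * P (q / (e * g)) * P (q / (f * g)))
        * Psi (r / l) (r / n) [r / i, r / j, r / m, r / e, r / f, r / g]
    + j * th (i * m * l * n / q) * (P (j * m) * P (q / (j * n)) * P (q / (j * l)) * P (i * e) * P (i * f) * P (i * g))
        * Psi j m [i, l, n, e, f, g]
    - i * th (j * m * l * n / q) * (P (i * m) * P (q / (i * n)) * P (q / (i * l)) * P (j * e) * P (j * f) * P (j * g))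
        * Psi i m [j, l, n, e, f, g]) = 0"
    unfolding h0 h1 h2 t3 tt t1 list.map prod_list.Cons prod_list.Nil mult_1_right p by (simp only: distrib_left right_diff_distrib mult_ac mult_minus_left mult_minus_right diff_conv_add_uminus)
  then show ?thesis
    using s0 by (simp only: mult_eq_0_iff simp_thms)
qed

text \<open>The previous relation is applied after scaling the group \<open>T\<close>,
  \<open>G\<close>, \<open>X\<close>, \<open>Y\<close>. There the inverted function with the indices
  of \<open>X\<close>, \<open>Y\<close> is the original one with \<open>T\<close>, \<open>G\<close>,
  and the other two functions have end points in different groups and return by Bailey's
  transformation. All three then share \<open>G\<close>.\<close>

lemma three_term_star:
  assumes ind: "indep [T, G, X, Y, B, C, U, V]"
  shows "B * th (C / B) * (P (T * G) * P (q / (T * X)) * P (q / (T * Y)) * P (q / (T * U)) * P (q / (T * V)) * P (B * C))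
        * Psi T G [B, C, X, Y, U, V]
    + C * th (B / T) * (P (C * G) * P (B * T) * P (q / (C * X)) * P (q / (C * Y)) * P (q / (C * U)) * P (q / (C * V)))
        * Psi C G [T, B, X, Y, U, V]
    - B * th (C / T) * (P (B * G) * P (C * T) * P (q / (B * X)) * P (q / (B * Y)) * P (q / (B * U)) * P (q / (B * V)))
        * Psi B G [T, C, X, Y, U, V] = 0"
proof -
  have nz: "T \<noteq> 0" "G \<noteq> 0" "X \<noteq> 0" "Y \<noteq> 0" "B \<noteq> 0" "C \<noteq> 0" "U \<noteq> 0" "V \<noteq> 0"
    using indep_nz[OF ind] by auto
  obtain r where r: "r\<^sup>2 = q"
    using sqrt_exists[of 1 q] by auto
  obtain s where s: "s\<^sup>2 * (T * G * X * Y) = q"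
    using sqrt_exists[of "T * G * X * Y" q] nz by auto
  have s0: "s \<noteq> 0" using s by auto
  have ind': "indep [s * T, s * G, s * X, s * Y, B / s, C / s, U / s, V / s]"
    by (rule indep_reflect[OF ind s])
  have s': "(1 / s)\<^sup>2 * (s * T * (s * G) * (s * X) * (s * Y)) = q"
  proof -
    have "(1 / s)\<^sup>2 * (s * T * (s * G) * (s * X) * (s * Y)) = s\<^sup>2 * (T * G * X * Y)"
      using s0 by (simp add: power2_eq_square)
    then show ?thesis unfolding s .
  qed
  have "q * (B * C * U * V) = s\<^sup>2 * (T * G * X * Y * B * C * U * V)"
    unfolding s[symmetric] by (simp add: mult_ac)
  then have sc: "B * C * U * V = s\<^sup>2 * q"
    unfolding indep_prod[OF ind] by (simp add: power2_eq_square mult_ac)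
  have ind1: "indep [B / s, C / s, s * X, s * Y, s * G, s * T, U / s, V / s]"
    by (rule indep_mset_cong[OF ind']) simp
  note R = three_term_inverted[OF ind1 r]
  have h0: "Psi (r / (s * X)) (r / (s * Y)) [r / (B / s), r / (C / s), r / (s * G), r / (s * T), r / (U / s), r / (V / s)]
      = Psi T G [B, C, X, Y, U, V]"
  proof -
    have "Psi T G [B, C, X, Y, U, V] = Psi T G [X, Y, B, C, U, V]"
      by (rule Psi_mset_cong) simp
    also have "\<dots> = Psi (1 / s * (s * T)) (1 / s * (s * G)) [1 / s * (s * X), 1 / s * (s * Y), B / s / (1 / s), C / s / (1 / s), U / s / (1 / s), V / s / (1 / s)]"
      using s0 by simp
    also have "\<dots> = Psi (r / (s * X)) (r / (s * Y)) [r / (s * T), r / (s * G), r / (B / s), r / (C / s), r / (U / s), r / (V / s)]"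
      by (rule reflected_Psi_eq_inverted_Psi[OF ind' s' r])
    also have "\<dots> = Psi (r / (s * X)) (r / (s * Y)) [r / (B / s), r / (C / s), r / (s * G), r / (s * T), r / (U / s), r / (V / s)]"
      by (rule Psi_mset_cong) simp
    finally show ?thesis ..
  qed
  have bail: "Psi (s * G) (x / s) [s * T, s * X, s * Y, y / s, U / s, V / s] = Psi G x [T, X, Y, y, U, V]"
    if "indep [G, T, X, Y, x, y, U, V]" for x y
    by (rule bailey_transformation[OF that, symmetric]) (use s in \<open>simp add: mult_ac\<close>)
  have h1: "Psi (C / s) (s * G) [B / s, s * X, s * Y, s * T, U / s, V / s] = Psi C G [T, B, X, Y, U, V]"
  proof -
    have "indep [G, T, X, Y, C, B, U, V]"
      by (rule indep_mset_cong[OF ind]) simp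
    note b = bail[OF this]
    have "Psi (C / s) (s * G) [B / s, s * X, s * Y, s * T, U / s, V / s] = Psi (s * G) (C / s) [B / s, s * X, s * Y, s * T, U / s, V / s]"
      by (rule Psi_commute) (use nz s0 in simp_all)
    also have "\<dots> = Psi (s * G) (C / s) [s * T, s * X, s * Y, B / s, U / s, V / s]"
      by (rule Psi_mset_cong) simp
    also have "\<dots> = Psi G C [T, B, X, Y, U, V]"
      unfolding b by (rule Psi_mset_cong) simp
    also have "\<dots> = Psi C G [T, B, X, Y, U, V]"
      by (rule Psi_commute) (use nz in simp_all)
    finally show ?thesis .
  qed
  have h2: "Psi (B / s) (s * G) [C / s, s * X, s * Y, s * T, U / s, V / s] = Psi B G [T, C, X, Y, U, V]"
  proof -
    have "indep [G, T, X, Y, B, C, U, V]"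
      by (rule indep_mset_cong[OF ind]) simp
    note b = bail[OF this]
    have "Psi (B / s) (s * G) [C / s, s * X, s * Y, s * T, U / s, V / s] = Psi (s * G) (B / s) [C / s, s * X, s * Y, s * T, U / s, V / s]"
      by (rule Psi_commute) (use nz s0 in simp_all)
    also have "\<dots> = Psi (s * G) (B / s) [s * T, s * X, s * Y, C / s, U / s, V / s]"
      by (rule Psi_mset_cong) simp
    also have "\<dots> = Psi G B [T, C, X, Y, U, V]"
      unfolding b by (rule Psi_mset_cong) simp
    also have "\<dots> = Psi B G [T, C, X, Y, U, V]"
      by (rule Psi_commute) (use nz in simp_all)
    finally show ?thesis .
  qed
  have p: "q / (s * X * (s * Y)) = T * G" "s * G * (s * X) = q / (T * Y)" "s * G * (s * Y) = q / (T * X)"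
    "q / (s * T * (U / s)) = q / (T * U)" "q / (s * T * (V / s)) = q / (T * V)" "q / (U / s * (V / s)) = B * C"
    "C / s * (s * G) = C * G" "q / (C / s * (s * Y)) = q / (C * Y)" "q / (C / s * (s * X)) = q / (C * X)"
    "B / s * (s * T) = B * T" "B / s * (U / s) = q / (C * V)" "B / s * (V / s) = q / (C * U)"
    "B / s * (s * G) = B * G" "q / (B / s * (s * Y)) = q / (B * Y)" "q / (B / s * (s * X)) = q / (B * X)"
    "C / s * (s * T) = C * T" "C / s * (U / s) = q / (B * V)" "C / s * (V / s) = q / (B * U)"
    using nz s0 s sc by (simp_all add: field_simps power2_eq_square)
  have t: "B / s * (s * G) * (s * X) * (s * Y) / q = B / T" "C / s * (s * G) * (s * X) * (s * Y) / q = C / T"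
    unfolding s[symmetric] using nz s0 by (simp_all add: power2_eq_square)
  have tt: "th (C / s / (B / s)) = th (C / B)" using s0 by simp
  have "(1 / s) * (B * th (C / B) * (P (T * G) * P (q / (T * X)) * P (q / (T * Y)) * P (q / (T * U)) * P (q / (T * V)) * P (B * C))
        * Psi T G [B, C, X, Y, U, V]
    + C * th (B / T) * (P (C * G) * P (B * T) * P (q / (C * X)) * P (q / (C * Y)) * P (q / (C * U)) * P (q / (C * V)))
        * Psi C G [T, B, X, Y, U, V]
    - B * th (C / T) * (P (B * G) * P (C * T) * P (q / (B * X)) * P (q / (B * Y)) * P (q / (B * U)) * P (q / (B * V)))
        * Psi B G [T, C, X, Y, U, V]) = 0"
    using R unfolding h0 h1 h2 t unfolding tt p by (simp add: algebra_simps)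
  then show ?thesis
    using s0 by simp
qed

subsection \<open>The relation for independent parameters\<close>

text \<open>The leading term \<open>F (T # ts) T\<close> of the lattice sum, simplified by
  \<open>P (T^2) = (1 - T^2) * P (T^2 * q)\<close>.\<close>

definition Wfactor :: "complex \<Rightarrow> complex list \<Rightarrow> complex" where
  "Wfactor T ts = T * P q / P (T\<^sup>2 * q) * (\<Prod>t\<leftarrow>ts. P (q * T / t) / P (T * t))"

lemma P_q_power: "P x \<noteq> 0 \<Longrightarrow> P (x * q ^ k) = P x / qpoch q x k"
  using P_shift[of x k] by (auto simp: field_simps)

lemma S_eq_W:
  assumes T: "T \<noteq> 0" "T * T \<notin> Zq" and ts: "\<And>t. t \<in> set ts \<Longrightarrow> t \<noteq> 0 \<and> T * t \<notin> Zq \<and> T / t \<notin> Zq"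
  shows "S (T # ts) T = Wfactor T ts * W q (T\<^sup>2) (map ((*) T) ts)"
proof -
  have T2: "P (T\<^sup>2) \<noteq> 0" "T\<^sup>2 \<noteq> 1"
    using T P_nz[of "T * T"] Zq_simps(1) by (auto simp: power2_eq_square)
  have Pt: "P (T\<^sup>2) = (1 - T\<^sup>2) * P (T\<^sup>2 * q)"
    by (rule P_rec)
  have prod: "(\<Prod>t\<leftarrow>ts. P (q * (T * q ^ k) / t) / P (t * (T * q ^ k)))
    = (\<Prod>t\<leftarrow>ts. P (q * T / t) / P (T * t)) * (qpochs q (map ((*) T) ts) k / qpochs q (map (\<lambda>p. T\<^sup>2 * q / p) (map ((*) T) ts)) k)" for k
    using ts
  proof (induction ts)
    case (Cons t ts)
    have t: "t \<noteq> 0" "P (T * t) \<noteq> 0" "P (q * T / t) \<noteq> 0"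
      using Cons.prems[of t] P_nz[of "T * t"] P_nz[of "q * (T / t)"] by auto
    have "P (q * (T * q ^ k) / t) = P (q * T / t) / qpoch q (q * T / t) k" "P (t * (T * q ^ k)) = P (T * t) / qpoch q (T * t) k"
      using P_q_power[OF t(3), of k] P_q_power[OF t(2), of k] by (simp_all add: mult_ac)
    moreover have "T\<^sup>2 * q / (T * t) = q * T / t"
      using T by (simp add: power2_eq_square)
    ultimately show ?case
      using Cons by (simp add: qpochs_def) (simp add: mult_ac)
  qed (simp add: qpochs_def)
  define w where "w k = (1 - T\<^sup>2 * q ^ (2 * k)) / (1 - T\<^sup>2)
      * (qpochs q (T\<^sup>2 # map ((*) T) ts) k / qpochs q (q # map (\<lambda>p. T\<^sup>2 * q / p) (map ((*) T) ts)) k) * q ^ k" for k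
  have "F (T # ts) (T * q ^ k) = Wfactor T ts * ((1 - T\<^sup>2 * q ^ (2 * k)) / (1 - T\<^sup>2)
      * (qpochs q (T\<^sup>2 # map ((*) T) ts) k / qpochs q (q # map (\<lambda>p. T\<^sup>2 * q / p) (map ((*) T) ts)) k) * q ^ k)" for k
  proof -
    have h: "P (q * (T * q ^ k) / T) = P q / qpoch q q k" "P (T * (T * q ^ k)) = P (T\<^sup>2) / qpoch q (T\<^sup>2) k"
      using P_q_power[OF P_q_nz, of k] P_q_power[OF T2(1), of k] T by (simp_all add: power2_eq_square mult_ac)
    have "F (T # ts) (T * q ^ k) = T * q ^ k * (1 - (T * q ^ k)\<^sup>2) * (P q / qpoch q q k / (P (T\<^sup>2) / qpoch q (T\<^sup>2) k)
      * ((\<Prod>t\<leftarrow>ts. P (q * T / t) / P (T * t)) * (qpochs q (map ((*) T) ts) k / qpochs q (map (\<lambda>p. T\<^sup>2 * q / p) (map ((*) T) ts)) k)))"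
      unfolding F_def list.map prod_list.Cons h prod[of k, unfolded list.map_comp o_def] list.map_comp o_def by simp
    moreover have "(T * q ^ k)\<^sup>2 = T\<^sup>2 * q ^ (2 * k)"
      by (simp add: power_mult_distrib power_mult[symmetric] mult.commute)
    moreover have "qpochs q (x # xs) k = qpoch q x k * qpochs q xs k" for x xs
      by (simp add: qpochs_def)
    ultimately show ?thesis
      unfolding Wfactor_def Pt using T2 by (simp add: mult_ac)
  qed
  note F_term = this
  have wnz: "Wfactor T ts \<noteq> 0"
  proof -
    have "(\<Prod>t\<leftarrow>ts. P (q * T / t) / P (T * t)) \<noteq> 0"
      using ts
    proof (induction ts)
      case (Cons t ts)
      have "P (T * t) \<noteq> 0" "P (q * T / t) \<noteq> 0"
        using Cons.prems[of t] P_nz[of "T * t"] P_nz[of "q * (T / t)"] by auto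
      then show ?case using Cons by simp
    qed simp
    moreover have "P (T\<^sup>2 * q) \<noteq> 0"
      using T2 Pt by auto
    ultimately show ?thesis
      using T P_q_nz by (simp add: Wfactor_def)
  qed
  have F_w: "F (T # ts) (T * q ^ k) = Wfactor T ts * w k" for k
    unfolding w_def by (rule F_term)
  have "summable w"
    using summable_F[of "T # ts" T] wnz unfolding F_w by (rule summable_mult_D)
  then have "(\<Sum>k. Wfactor T ts * w k) = Wfactor T ts * (\<Sum>k. w k)"
    by (rule suminf_mult)
  then show ?thesis
    unfolding S_def F_w unfolding W_def w_def .
qed

text \<open>The prefactor of the second series in \<open>Phi\<close> is precisely what makes the two
  lattice sums enter with opposite coefficients, so that \<open>Phi\<close> is minus a q-integral
  divided by \<open>Wfactor T ts\<close>.\<close>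

lemma Phi_eq_Psi:
  assumes i: "i < length ts" "ti = ts ! i" "os = others i ts"
    and T: "T \<noteq> 0" "ti \<noteq> 0" "T * T \<notin> Zq" "ti * ti \<notin> Zq" "T * ti \<notin> Zq" "ti / T \<notin> Zq"
    and os: "\<And>t. t \<in> set os \<Longrightarrow> t \<noteq> 0 \<and> T * t \<notin> Zq \<and> T / t \<notin> Zq \<and> ti * t \<notin> Zq \<and> ti / t \<notin> Zq"
  shows "Phi q i (T\<^sup>2) (map ((*) T) ts) = - (P (q * T\<^sup>2) * P (T * ti) * P (ti / T) / (P q * (\<Prod>t\<leftarrow>os. P (q * T / t) * P (ti * t)))) * Psi T ti os"
proof -
  have Tti: "T / ti \<notin> Zq"
    using T(6) Zq_inverse_iff[of "ti / T"] by simp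
  have ms: "mset ts = mset (ti # os)"
  proof -
    have "ts = take i ts @ ti # drop (Suc i) ts"
      using i id_take_nth_drop by simp
    then have "mset ts = mset (take i ts @ ti # drop (Suc i) ts)"
      by simp
    then show ?thesis
      unfolding i(3) others_def by simp
  qed
  have oth: "others i (map ((*) T) ts) = map ((*) T) os"
    unfolding i(3) others_def by (simp add: take_map drop_map)
  have nth: "map ((*) T) ts ! i = T * ti"
    using i by simp
  have sts: "t \<in> set ts \<Longrightarrow> t = ti \<or> t \<in> set os" for t
    using ms by (metis list.set_intros(1) set_ConsD set_mset_mset)
  have par: "Phi_params i (T\<^sup>2) (map ((*) T) ts) = map ((*) ti) (T # os)"
    unfolding Phi_params_def Let_def nth oth using T by (simp add: power2_eq_square mult_ac)
  have sq: "(T * ti)\<^sup>2 / T\<^sup>2 = ti\<^sup>2"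
    using T by (simp add: power_mult_distrib)
  define M where "M f = (\<Prod>t\<leftarrow>os. f t :: complex)" for f
  have Mm: "M (\<lambda>t. f t * g t) = M f * M g" for f g
    unfolding M_def by (induction os) simp_all
  have Md: "M (\<lambda>t. f t / g t) = M f / M g" for f g
    unfolding M_def by (induction os) simp_all
  have Mnz: "M f \<noteq> 0" if "\<And>t. t \<in> set os \<Longrightarrow> f t \<noteq> 0" for f
    using that unfolding M_def by (induction os) auto
  have nz: "M (\<lambda>t. P (q * T / t)) \<noteq> 0" "M (\<lambda>t. P (q * ti / t)) \<noteq> 0" "M (\<lambda>t. P (T * t)) \<noteq> 0" "M (\<lambda>t. P (ti * t)) \<noteq> 0"
  proof -
    have "P (q * T / t) \<noteq> 0 \<and> P (q * ti / t) \<noteq> 0 \<and> P (T * t) \<noteq> 0 \<and> P (ti * t) \<noteq> 0" if "t \<in> set os" for t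
      using os[OF that] P_nz[of "T * t"] P_nz[of "ti * t"] P_nz[of "q * (T / t)"] P_nz[of "q * (ti / t)"] by simp
    then show "M (\<lambda>t. P (q * T / t)) \<noteq> 0" "M (\<lambda>t. P (q * ti / t)) \<noteq> 0" "M (\<lambda>t. P (T * t)) \<noteq> 0" "M (\<lambda>t. P (ti * t)) \<noteq> 0"
      by (auto intro!: Mnz)
  qed
  have pz: "P (T * ti) \<noteq> 0" "P (T\<^sup>2 * q) \<noteq> 0" "P (ti\<^sup>2 * q) \<noteq> 0" "P (ti / T) \<noteq> 0" "P (T / ti) \<noteq> 0"
    "P (q * T / ti) \<noteq> 0" "P (q * ti / T) \<noteq> 0" "ti \<noteq> T"
  proof -
    have "T\<^sup>2 \<notin> Zq" "ti\<^sup>2 \<notin> Zq"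
      using T by (simp_all add: power2_eq_square)
    then show "P (T * ti) \<noteq> 0" "P (T\<^sup>2 * q) \<noteq> 0" "P (ti\<^sup>2 * q) \<noteq> 0" "P (ti / T) \<noteq> 0" "P (T / ti) \<noteq> 0"
      "P (q * T / ti) \<noteq> 0" "P (q * ti / T) \<noteq> 0" "ti \<noteq> T"
      using T Tti by (auto intro!: P_nz)
  qed
  have w1: "Wfactor T ts = T * P q / P (T\<^sup>2 * q) * (P (q * T / ti) / P (T * ti) * (M (\<lambda>t. P (q * T / t)) / M (\<lambda>t. P (T * t))))"
    unfolding Wfactor_def prod_list_mset_cong[OF ms] Md[symmetric] by (simp add: M_def)
  have w2: "Wfactor ti (T # os) = ti * P q / P (ti\<^sup>2 * q) * (P (q * ti / T) / P (T * ti) * (M (\<lambda>t. P (q * ti / t)) / M (\<lambda>t. P (ti * t))))"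
    unfolding Wfactor_def Md[symmetric] by (simp add: M_def mult.commute)
  have wz: "Wfactor T ts \<noteq> 0" "Wfactor ti (T # os) \<noteq> 0"
    unfolding w1 w2 using nz pz T P_q_nz by simp_all
  have W1: "W q (T\<^sup>2) (map ((*) T) ts) = S (T # ti # os) T / Wfactor T ts"
  proof -
    have "S (T # ts) T = Wfactor T ts * W q (T\<^sup>2) (map ((*) T) ts)"
    proof (rule S_eq_W[OF T(1,3)])
      fix t assume "t \<in> set ts"
      then show "t \<noteq> 0 \<and> T * t \<notin> Zq \<and> T / t \<notin> Zq"
        using sts[of t] os[of t] T Tti by auto
    qed
    moreover have "S (T # ts) = S (T # ti # os)"
      by (rule S_mset_cong) (simp add: ms)
    ultimately show ?thesis
      using wz by simp
  qed
  have W2: "W q (ti\<^sup>2) (map ((*) ti) (T # os)) = S (T # ti # os) ti / Wfactor ti (T # os)"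
  proof -
    have "S (ti # T # os) ti = Wfactor ti (T # os) * W q (ti\<^sup>2) (map ((*) ti) (T # os))"
    proof (rule S_eq_W[OF T(2,4)])
      fix t assume "t \<in> set (T # os)"
      then show "t \<noteq> 0 \<and> ti * t \<notin> Zq \<and> ti / t \<notin> Zq"
        using os[of t] T by (auto simp: mult.commute)
    qed
    moreover have "S (ti # T # os) = S (T # ti # os)"
      by (rule S_mset_cong) simp
    ultimately show ?thesis
      using wz by simp
  qed
  have num: "Phi_num q i (T\<^sup>2) (map ((*) T) ts) = P (T\<^sup>2 * q) * P (ti / T) * (M (\<lambda>t. P (T * t)) * M (\<lambda>t. P (q * ti / t)))"
  proof -
    have e: "T * ti / T\<^sup>2 = ti / T" "T * ti * q / (T * t) = q * ti / t" for t
      using T by (simp_all add: power2_eq_square)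
    show ?thesis
      unfolding Phi_num_def Let_def nth oth using Mm[of "\<lambda>t. P (T * t)" "\<lambda>t. P (q * ti / t)"]
      by (simp add: M_def o_def qpochs_inf_def e)
  qed
  have den: "Phi_den q i (T\<^sup>2) (map ((*) T) ts) = P (ti\<^sup>2 * q) * P (T / ti) * (M (\<lambda>t. P (q * T / t)) * M (\<lambda>t. P (ti * t)))"
  proof -
    have e: "(T * ti)\<^sup>2 * q / T\<^sup>2 = ti\<^sup>2 * q" "T\<^sup>2 / (T * ti) = T / ti" "T\<^sup>2 * q / (T * t) = q * T / t" "T * ti * (T * t) / T\<^sup>2 = ti * t" for t
      using T by (simp_all add: power2_eq_square)
    show ?thesis
      unfolding Phi_den_def Let_def nth oth using Mm[of "\<lambda>t. P (q * T / t)" "\<lambda>t. P (ti * t)"]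
      by (simp add: M_def o_def qpochs_inf_def e)
  qed
  \<comment> \<open>The inversion formula for the theta function at \<open>ti / T\<close>, written
    out in products; the relative sign of the two lattice sums originates here.\<close>
  have "T * P (q * T / ti) * P (ti / T) = - (ti * P (q * ti / T) * P (T / ti))"
  proof -
    have "T * P (ti / T) = (T - ti) * P (q * ti / T)" "ti * P (T / ti) = (ti - T) * P (q * T / ti)"
      using P_rec[of "ti / T"] P_rec[of "T / ti"] T by (simp_all add: field_simps)
    then show ?thesis by algebra
  qed
  then have key: "P (ti / T) / (P (T / ti) * (ti * P (q * ti / T))) = - 1 / (T * P (q * T / ti))"
    using pz T by (simp add: field_simps)
  have coef: "Phi_num q i (T\<^sup>2) (map ((*) T) ts) / Phi_den q i (T\<^sup>2) (map ((*) T) ts) / Wfactor ti (T # os) = - 1 / Wfactor T ts"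
  proof -
    have "Phi_num q i (T\<^sup>2) (map ((*) T) ts) / Phi_den q i (T\<^sup>2) (map ((*) T) ts) / Wfactor ti (T # os)
      = P (ti / T) / (P (T / ti) * (ti * P (q * ti / T))) * (P (T\<^sup>2 * q) * P (T * ti) * M (\<lambda>t. P (T * t)) / (P q * M (\<lambda>t. P (q * T / t))))"
      unfolding num den w2 using nz pz T by (simp add: mult_ac)
    also have "\<dots> = - 1 / Wfactor T ts"
      unfolding key w1 using nz pz T by (simp add: mult_ac)
    finally show ?thesis .
  qed
  have "Phi q i (T\<^sup>2) (map ((*) T) ts) = S (T # ti # os) T / Wfactor T ts
      + Phi_num q i (T\<^sup>2) (map ((*) T) ts) / Phi_den q i (T\<^sup>2) (map ((*) T) ts) / Wfactor ti (T # os) * S (T # ti # os) ti"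
    unfolding Phi_def nth sq par W1 W2 by simp
  also have "\<dots> = - Q (T # ti # os) T ti / Wfactor T ts"
    unfolding coef Q_def by (simp add: diff_divide_distrib)
  also have "\<dots> = - (P (q * T\<^sup>2) * P (T * ti) * P (ti / T) / (P q * (\<Prod>t\<leftarrow>os. P (q * T / t) * P (ti * t)))) * Psi T ti os"
  proof -
    have "th (ti / T) = P (ti / T) * P (q * T / ti)"
      unfolding th_def by simp
    then show ?thesis
      unfolding Psi_def w1 M_def[symmetric] Mm using nz pz T by (simp add: mult_ac)
  qed
  finally show ?thesis .
qed

lemma P_nz_indep:
  assumes "indep ts" and "x \<in> set ts" "y \<in> set ts" "x \<noteq> y"
  shows "P (x * y) \<noteq> 0" "P (x / y) \<noteq> 0" "P (q / (x * y)) \<noteq> 0" "P (q * x / y) \<noteq> 0"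
  using indep_members[OF assms] by (auto intro!: P_nz simp: Zq_q_div)

lemma Phi_eq_Psi_indep:
  assumes ind: "indep us" and us: "mset us = mset (T # ti # os)" and i: "i < length ts" "ti = ts ! i" "os = others i ts"
  shows "Phi q i (T\<^sup>2) (map ((*) T) ts) = - (P (q * T\<^sup>2) * P (T * ti) * P (ti / T) / (P q * (\<Prod>t\<leftarrow>os. P (q * T / t) * P (ti * t)))) * Psi T ti os"
proof (rule Phi_eq_Psi[OF i])
  have set: "set us = insert T (insert ti (set os))"
    using mset_eq_setD[OF us] by simp
  have "distinct (T # ti # os)"
    using indep_distinct[OF ind] mset_eq_imp_distinct_iff[OF us] by simp
  then have ne: "T \<noteq> ti" "\<And>t. t \<in> set os \<Longrightarrow> T \<noteq> t \<and> ti \<noteq> t"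
    by auto
  note mem = indep_members[OF ind]
  show "T * T \<notin> Zq" "ti * ti \<notin> Zq" "T * ti \<notin> Zq" "ti / T \<notin> Zq"
    using mem[of T ti] mem[of ti T] ne set by auto
  have nz: "x \<noteq> 0" if "x \<in> set us" for x
  proof -
    have "prod_list us \<noteq> 0"
      using ind by (simp add: indep_def)
    then show ?thesis
      using that by (auto simp: prod_list_zero_iff)
  qed
  show "T \<noteq> 0" "ti \<noteq> 0"
    using nz set by auto
  fix t assume t: "t \<in> set os"
  show "t \<noteq> 0 \<and> T * t \<notin> Zq \<and> T / t \<notin> Zq \<and> ti * t \<notin> Zq \<and> ti / t \<notin> Zq"
    using mem[of T t] mem[of ti t] nz[of t] ne(2)[OF t] t set by auto
qed

text \<open>The star relation has index pairs \<open>T g\<close>, \<open>c g\<close>,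
  \<open>b g\<close>; the inverted relation has \<open>c g\<close>, \<open>b g\<close> and the
  inverted pair of \<open>T\<close>, \<open>h\<close>. Eliminating \<open>c g\<close> expresses the
  first function by the two on the right.\<close>

theorem three_term_generic:
  fixes A B C D E F G H T b c d e f g h :: complex
  assumes ind: "indep [T, b, c, d, e, f, g, h]"
    and A: "A = T\<^sup>2" and BH: "B = T * b" "C = T * c" "D = T * d" "E = T * e" "F = T * f" "G = T * g" "H = T * h"
  shows "Phi q 5 A [B, C, D, E, F, G, H]
    = K1 q A B C D E F G H * Phi q 6 (q/A) [q/B, q/C, q/D, q/E, q/F, q/G, q/H]
    + K2 q A B C D E F G H * Phi q 0 (G\<^sup>2/A) [G*B/A, G*C/A, G*D/A, G*E/A, G*F/A, G, G*H/A]"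
proof -
  have nz: "T \<noteq> 0" "b \<noteq> 0" "c \<noteq> 0" "d \<noteq> 0" "e \<noteq> 0" "f \<noteq> 0" "g \<noteq> 0" "h \<noteq> 0"
    using indep_nz[OF ind] by auto
  have pr: "T * b * c * d * e * f * g * h = q * q"
    using indep_prod[OF ind] by (simp add: power2_eq_square)
  obtain r where r: "r\<^sup>2 = q"
    using sqrt_exists[of 1 q] by auto
  have r0: "r \<noteq> 0" using r by auto
  define \<Phi>5 \<Phi>6 \<Phi>0 where "\<Phi>5 = Phi q 5 A [B, C, D, E, F, G, H]"
    and "\<Phi>6 = Phi q 6 (q/A) [q/B, q/C, q/D, q/E, q/F, q/G, q/H]"
    and "\<Phi>0 = Phi q 0 (G\<^sup>2/A) [G*B/A, G*C/A, G*D/A, G*E/A, G*F/A, G, G*H/A]"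
  define \<psi>5 \<psi>6 \<psi>0 \<psi> where "\<psi>5 = Psi T g [b, c, d, e, f, h]"
    and "\<psi>6 = Psi (r / T) (r / h) [r / b, r / c, r / d, r / e, r / f, r / g]"
    and "\<psi>0 = Psi g b [c, d, e, f, T, h]" and "\<psi> = Psi c g [T, b, d, e, f, h]"

  define n5 n6 n0 where "n5 = P (q * T\<^sup>2) * P (T * g) * P (g / T) / (P q * (\<Prod>t\<leftarrow>[b, c, d, e, f, h]. P (q * T / t) * P (g * t)))"
    and "n6 = P (q * q / T\<^sup>2) * P (q / (T * h)) * P (T / h) / (P q * (\<Prod>t\<leftarrow>[b, c, d, e, f, g]. P (q * t / T) * P (q / (h * t))))"
    and "n0 = P (q * g\<^sup>2) * P (g * b) * P (b / g) / (P q * (\<Prod>t\<leftarrow>[c, d, e, f, T, h]. P (q * g / t) * P (b * t)))"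
  have \<Phi>5: "\<Phi>5 = - n5 * \<psi>5"
  proof -
    have "\<Phi>5 = Phi q 5 (T\<^sup>2) (map ((*) T) [b, c, d, e, f, g, h])"
      unfolding \<Phi>5_def A BH by simp
    also have "\<dots> = - n5 * \<psi>5"
      unfolding \<psi>5_def n5_def by (rule Phi_eq_Psi_indep[OF ind]) (simp_all add: others_def)
    finally show ?thesis .
  qed
  have \<Phi>6: "\<Phi>6 = - n6 * \<psi>6"
  proof -
    have x: "r / T * (r / t) = q / (T * t)" for t
      using r by (simp add: power2_eq_square)
    have x2: "(r / T)\<^sup>2 = q / T\<^sup>2"
      using r by (simp add: power_divide)
    have "\<Phi>6 = Phi q 6 ((r / T)\<^sup>2) (map ((*) (r / T)) [r / b, r / c, r / d, r / e, r / f, r / g, r / h])"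
      unfolding \<Phi>6_def A BH list.map x x2 ..
    also have "\<dots> = - (P (q * (r / T)\<^sup>2) * P (r / T * (r / h)) * P ((r / h) / (r / T))
        / (P q * (\<Prod>t\<leftarrow>[r / b, r / c, r / d, r / e, r / f, r / g]. P (q * (r / T) / t) * P (r / h * t)))) * \<psi>6"
      unfolding \<psi>6_def by (rule Phi_eq_Psi_indep[OF indep_invert[OF ind r]]) (simp_all add: others_def)
    also have "(\<Prod>t\<leftarrow>[r / b, r / c, r / d, r / e, r / f, r / g]. P (q * (r / T) / t) * P (r / h * t))
      = (\<Prod>t\<leftarrow>[b, c, d, e, f, g]. P (q * t / T) * P (q / (h * t)))"
    proof -
      have "P (q * (r / T) / (r / t)) * P (r / h * (r / t)) = P (q * t / T) * P (q / (h * t))" for t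
      proof -
        have "r / h * (r / t) = q / (h * t)" using r by (simp add: power2_eq_square)
        moreover have "q * (r / T) / (r / t) = q * t / T" using r0 by simp
        ultimately show ?thesis by (simp only:)
      qed
      then show ?thesis by (simp only: list.map)
    qed
    also have "(r / h) / (r / T) = T / h" using r0 by simp
    also have "q * (r / T)\<^sup>2 = q * q / T\<^sup>2" unfolding x2 by simp
    finally show ?thesis unfolding x n6_def .
  qed
  have \<Phi>0: "\<Phi>0 = - n0 * \<psi>0"
  proof -
    have "\<Phi>0 = Phi q 0 (g\<^sup>2) (map ((*) g) [b, c, d, e, f, T, h])"
      unfolding \<Phi>0_def A BH using nz by (simp add: power2_eq_square mult_ac)
    also have "\<dots> = - n0 * \<psi>0"
      unfolding \<psi>0_def n0_def by (rule Phi_eq_Psi_indep[OF ind]) (simp_all add: others_def)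
    finally show ?thesis .
  qed

  \<comment> \<open>Coefficients of the star relation and of the inverted relation. Elimination
    gives the coefficients \<open>S2 * I1 / (S1 * I2)\<close> and
    \<open>S3 / S1 * (1 - S2 * I3 / (S3 * I2))\<close>, which \<open>E1\<close>, \<open>E2\<close>
    and \<open>E3\<close> match with \<open>K1\<close>, the prefactor of \<open>K2\<close> and its
    bracket.\<close>
  define S1 S2 S3 I1 I2 I3 where
    "S1 = b * th (c / b) * (P (T * g) * P (q / (T * d)) * P (q / (T * e)) * P (q / (T * f)) * P (q / (T * h)) * P (b * c))"
    and "S2 = c * th (b / T) * (P (c * g) * P (b * T) * P (q / (c * d)) * P (q / (c * e)) * P (q / (c * f)) * P (q / (c * h)))"
    and "S3 = b * th (c / T) * (P (b * g) * P (c * T) * P (q / (b * d)) * P (q / (b * e)) * P (q / (b * f)) * P (q / (b * h)))"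
    and "I1 = b * th (c / b) * (P (q / (T * h)) * P (g * T) * P (g * h) * P (q / (d * e)) * P (q / (d * f)) * P (q / (e * f)))"
    and "I2 = c * th (b * g * T * h / q) * (P (c * g) * P (q / (c * h)) * P (q / (c * T)) * P (b * d) * P (b * e) * P (b * f))"
    and "I3 = b * th (c * g * T * h / q) * (P (b * g) * P (q / (b * h)) * P (q / (b * T)) * P (c * d) * P (c * e) * P (c * f))"

  have "indep [h, g, f, e, d, c, b, T]"
    by (rule indep_mset_cong[OF ind]) simp
  note dist = indep_distinct[OF ind] indep_distinct[OF this]
  have qd: "c * d * e * f \<notin> Zq" "b * d * e * f \<notin> Zq"
  proof -
    have i: "indep [c, d, e, f, T, b, g, h]" "indep [b, d, e, f, T, c, g, h]"
      by (rule indep_mset_cong[OF ind], simp)+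
    show "c * d * e * f \<notin> Zq" "b * d * e * f \<notin> Zq"
      by (rule indep_quad(1)[OF i(1)], rule indep_quad(1)[OF i(2)])
  qed
  have star: "S1 * \<psi>5 + S2 * \<psi> - S3 * \<psi>0 = 0"
  proof -
    have "indep [T, g, d, e, b, c, f, h]"
      by (rule indep_mset_cong[OF ind]) simp
    note st = three_term_star[OF this]
    have "Psi b g [T, c, d, e, f, h] = Psi g b [T, c, d, e, f, h]"
      by (rule Psi_commute) (use nz in simp_all)
    also have "\<dots> = \<psi>0"
      unfolding \<psi>0_def by (rule Psi_mset_cong) simp
    finally have h: "Psi b g [T, c, d, e, f, h] = \<psi>0" .
    show ?thesis
      using st unfolding h \<psi>5_def[symmetric] \<psi>_def[symmetric] S1_def S2_def S3_def .
  qed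
  have inv: "I1 * \<psi>6 + I2 * \<psi> - I3 * \<psi>0 = 0"
  proof -
    have "indep [b, c, T, h, g, d, e, f]"
      by (rule indep_mset_cong[OF ind]) simp
    note st = three_term_inverted[OF this r]
    have h6: "Psi (r / T) (r / h) [r / b, r / c, r / g, r / d, r / e, r / f] = \<psi>6"
      unfolding \<psi>6_def by (rule Psi_mset_cong) simp
    have h1: "Psi c g [b, T, h, d, e, f] = \<psi>"
      unfolding \<psi>_def by (rule Psi_mset_cong) simp
    have "Psi b g [c, T, h, d, e, f] = Psi g b [c, T, h, d, e, f]"
      by (rule Psi_commute) (use nz in simp_all)
    also have "\<dots> = \<psi>0"
      unfolding \<psi>0_def by (rule Psi_mset_cong) simp
    finally have h0: "Psi b g [c, T, h, d, e, f] = \<psi>0" .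
    show ?thesis
      using st unfolding h6 h1 h0 I1_def I2_def I3_def .
  qed

  have th1: "th (b * g * T * h / q) = P (c * d * e * f) * P (q / (c * d * e * f))"
  proof -
    have "b * g * T * h / q = q / (c * d * e * f)"
      using pr nz by (simp add: divide_simps mult_ac)
    then show ?thesis
      using th_q_div[of "c * d * e * f"] nz by (simp add: th_def)
  qed
  have th2: "th (c * g * T * h / q) = P (b * d * e * f) * P (q / (b * d * e * f))"
  proof -
    have "c * g * T * h / q = q / (b * d * e * f)"
      using pr nz by (simp add: divide_simps mult_ac)
    then show ?thesis
      using th_q_div[of "b * d * e * f"] nz by (simp add: th_def)
  qed
  have th3: "th (b / T) = P (b / T) * P (q * T / b)" "th (c / T) = P (c / T) * P (q * T / c)"
    "th (c / b) = P (c / b) * P (q * b / c)"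
    by (simp_all add: th_def)

  have arg:
    "B/A = b / T" "G/A = g / T" "B*q/A = q * b / T" "C*q/A = q * c / T" "D*q/A = q * d / T" "E*q/A = q * e / T" "F*q/A = q * f / T" "G*q/A = q * g / T" "A*q/(C*D) = q / (c * d)" "A*q/(C*E) = q / (c * e)" "A*q/(C*F) = q / (c * f)" "A*q/(D*E) = q / (d * e)" "A*q/(D*F) = q / (d * f)" "A*q/(E*F) = q / (e * f)" "A*q/(B*H) = q / (b * h)" "A*q/(C*H) = q / (c * h)" "A*q/(D*H) = q / (d * h)" "A*q/(E*H) = q / (e * h)" "A*q/(F*H) = q / (f * h)" "A*q/(G*H) = q / (g * h)" "q\<^sup>2/A = q * q / (T * T)" "q/C = q / (T * c)" "q/D = q / (T * d)" "q/E = q / (T * e)" "q/F = q / (T * f)" "q/H = q / (T * h)" "A/H = T / h" "A*q/C = q * T / c" "A*q/D = q * T / d" "A*q/E = q * T / e" "A*q/F = q * T / f" "A*q/H = q * T / h" "B*C/A = b * c" "B*D/A = b * d" "B*E/A = b * e" "B*F/A = b * f" "B*G/A = b * g" "C*G/A = c * g" "D*G/A = d * g" "E*G/A = e * g" "F*G/A = f * g" "C*D*E*F/A\<^sup>2 = c * d * e * f" "A\<^sup>2*q/(C*D*E*F) = q / (c * d * e * f)" "C/A = c / T" "G*q/C = q * g / c" "G*q/D = q * g / d" "G*q/E = q * g / e" "G*q/F = q * g / f" "G*q/H = q * g / h" "A*q/(B*D) = q / (b * d)" "A*q/(B*E) = q / (b * e)" "A*q/(B*F) = q / (b * f)" "B*H/A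 = b * h" "G\<^sup>2*q/A = q * g * g" "A*q/B = q * T / b" "B/G = b / g" "C/B = c / b" "B*q/C = q * b / c" "G*B/A = b * g" "G*C/A = c * g" "G*D/A = d * g" "G*E/A = e * g" "G*F/A = f * g" "G*H/A = g * h" "q/B = q / (T * b)" "A/B = T / b" "C*D/A = c * d" "C*E/A = c * e" "C*F*q/A = q * c * f" "A/(C*F) = 1 / (c * f)" "B*D*E*F/A\<^sup>2 = b * d * e * f" "A\<^sup>2*q/(B*D*E*F) = q / (b * d * e * f)" "A/C = T / c" "B*F*q/A = q * b * f" "A/(B*F) = 1 / (b * f)"
    unfolding A BH using nz by (simp_all add: power2_eq_square)
  have arg0:
    "A*q = q * T * T" "B = T * b" "G = T * g" "C = T * c"
    unfolding A BH using nz by (simp_all add: power2_eq_square)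
  have Pq: "P (c * d * e * f) \<noteq> 0" "P (q / (c * d * e * f)) \<noteq> 0" "P (b * d * e * f) \<noteq> 0" "P (q / (b * d * e * f)) \<noteq> 0"
    using qd by (simp_all add: P_nz Zq_q_div)
  have P2: "P (q * T * T) \<noteq> 0" "P (q * q / (T * T)) \<noteq> 0" "P (q * g * g) \<noteq> 0"
    using indep_pair(3)[OF ind refl] indep_members(3)[OF ind, of g h] dist by (auto intro!: P_nz simp: mult.assoc Zq_q_div)

  define u5 v5 u6 v6 u0 v0 where "u5 = P (q * T * T) * P (T * g) * P (g / T)" and "v5 = P (q * T / b) * P (g * b) * P (q * T / c) * P (g * c) * P (q * T / d) * P (g * d) * P (q * T / e) * P (g * e) * P (q * T / f) * P (g * f) * P (q * T / h) * P (g * h)" and "u6 = P (q * q / (T * T)) * P (q / (T * h)) * P (T / h)" and "v6 = P (q * b / T) * P (q / (h * b)) * P (q * c / T) * P (q / (h * c)) * P (q * d / T) * P (q / (h * d)) * P (q * e / T) * P (q / (h * e)) * P (q * f / T) * P (q / (h * f)) * P (q * g / T) * P (q / (h * g))" and "u0 = P (q * g * g) * P (g * b) * P (b / g)" and "v0 = P (q * g / c) * P (b * c) * P (q * g / d) * P (b * d) * P (q * g / e) * P (b * e) * P (q * g / f) * P (b * f) * P (q * g / T) * P (b * T) * P (q * g / h) * P (b * h)"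
  note Ks = K1_num_def K1_den_def K2_num_def K2_den_def K2_bracket_num_def K2_bracket_den_def
    qpochs_inf_def list.map prod_list.Cons prod_list.Nil mult_1_right
  have n: "n5 = u5 / (P q * v5)" "n6 = u6 / (P q * v6)" "n0 = u0 / (P q * v0)"
    unfolding n5_def n6_def n0_def u5_def v5_def u6_def v6_def u0_def v0_def list.map prod_list.Cons prod_list.Nil power2_eq_square
    by (simp_all only: mult_1_right mult.assoc)
  have th_b: "th (b / T) = - (b / T) * (P (T / b) * P (q * b / T))"
    using th_inverse[of "T / b"] nz by (simp add: th_def)
  have th_c: "th (c / T) = - (c / T) * (P (T / c) * P (q * c / T))"
    using th_inverse[of "T / c"] nz by (simp add: th_def)
  \<comment> \<open>The bracket contains the theta function at \<open>q * b * f\<close> and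
    \<open>q * c * f\<close>, the relations contain it at \<open>b * f\<close> and
    \<open>c * f\<close>; a shift by \<open>q\<close> mediates.\<close>
  have pf: "P (x * f) * P (q / (x * f)) = - (x * f) * (P (q * x * f) * P (1 / (x * f)))" if "x \<noteq> 0" for x
  proof -
    have "th (x * f) = - (x * f) * th (x * f * q)"
      using th_mult_q[of "x * f"] nz that by simp
    then show ?thesis
      using that nz by (simp add: th_def mult_ac)
  qed
  have S_nz: "S1 \<noteq> 0" "S2 \<noteq> 0" "S3 \<noteq> 0" "I2 \<noteq> 0" "u5 \<noteq> 0" "v5 \<noteq> 0" "u6 \<noteq> 0" "v6 \<noteq> 0" "u0 \<noteq> 0" "v0 \<noteq> 0"
    unfolding S1_def S2_def S3_def I2_def u5_def v5_def u6_def v6_def u0_def v0_def th1 th3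
    using Pq P2 nz dist by (simp_all add: P_nz_indep[OF ind])
  have K1_dz: "K1_den q A B C D E F G H \<noteq> 0" and K2_dz: "K2_den q A B C D E F G H \<noteq> 0" and Kb_dz: "K2_bracket_den q A B C D E F \<noteq> 0"
  proof -
    have x: "P (1 / (b * f)) \<noteq> 0" "P (q * b * f) \<noteq> 0"
      using indep_members(1)[OF ind, of b f] Zq_inverse_iff[of "b * f"] dist by (auto intro!: P_nz simp: divide_inverse mult.assoc)
    show "K1_den q A B C D E F G H \<noteq> 0" "K2_den q A B C D E F G H \<noteq> 0" "K2_bracket_den q A B C D E F \<noteq> 0"
      unfolding Ks unfolding arg unfolding arg0 using Pq P2 x dist by (simp_all add: P_nz_indep[OF ind])
  qed
  have E1: "K1_num q A B C D E F G H * (S1 * I2 * u6 * v5) = K1_den q A B C D E F G H * (S2 * I1 * u5 * v6)"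
    unfolding Ks unfolding arg unfolding arg0 S1_def S2_def I1_def I2_def th1 th3 u6_def v5_def u5_def v6_def by (simp only: mult_ac)
  have E2: "K2_num q A B C D E F G H * (u0 * v5 * S1) = K2_den q A B C D E F G H * (u5 * v0 * S3)"
    unfolding Ks unfolding arg unfolding arg0 S1_def S3_def th3 u0_def v5_def u5_def v0_def by (simp only: mult_ac)

  define Z2 Z3 N1 N2 where "Z2 = P (c * g) * P (b * T) * P (q / (c * d)) * P (q / (c * e)) * P (q / (c * h)) * P (b * d * e * f) * P (q / (b * d * e * f)) * P (b * g) * P (q / (b * h)) * P (q / (b * T)) * P (c * d) * P (c * e)" and "Z3 = P (b * g) * P (c * T) * P (q / (b * d)) * P (q / (b * e)) * P (q / (b * h)) * P (c * d * e * f) * P (q / (c * d * e * f)) * P (c * g) * P (q / (c * h)) * P (q / (c * T)) * P (b * d) * P (b * e)" and "N1 = P (T * b) * P (q / (T * b)) * P (c * d) * P (q / (c * d)) * P (c * e) * P (q / (c * e)) * P (b * d * e * f) * P (q / (b * d * e * f))" and "N2 = P (T * c) * P (q / (T * c)) * P (b * d) * P (q / (b * d)) * P (b * e) * P (q / (b * e)) * P (c * d * e * f) * P (q / (c * d * e * f))"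
  define Xb Xc Yb Yc where "Xb = P (T / b) * P (q * b / T)" and "Xc = P (T / c) * P (q * c / T)"
    and "Yb = P (q * b * f) * P (1 / (b * f))" and "Yc = P (q * c * f) * P (1 / (c * f))"
  have SI1: "S3 * I2 = b * c * (th (c / T) * (P (b * f) * P (q / (b * f))) * Z3)"
    unfolding S3_def I2_def th1 Z3_def by (simp only: mult_ac)
  have SI2: "S2 * I3 = b * c * (th (b / T) * (P (c * f) * P (q / (c * f))) * Z2)"
    unfolding S2_def I3_def th2 Z2_def by (simp only: mult_ac)
  have B1: "K2_bracket_num q A B C D E F = Xb * Yc * N1"
    unfolding Ks unfolding arg unfolding arg0 Xb_def Yc_def N1_def by (simp only: mult_ac)
  have B2: "K2_bracket_den q A B C D E F = Xc * Yb * N2"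
    unfolding Ks unfolding arg unfolding arg0 Xc_def Yb_def N2_def by (simp only: mult_ac)
  have NZ: "N1 * Z3 = N2 * Z2"
    unfolding N1_def N2_def Z2_def Z3_def by (simp only: mult_ac)
  have SI1': "S3 * I2 = b * c * (- (c / T) * Xc * (- (b * f) * Yb) * Z3)"
    unfolding SI1 th_c pf[OF nz(2)] Xc_def Yb_def ..
  have SI2': "S2 * I3 = b * c * (- (b / T) * Xb * (- (c * f) * Yc) * Z2)"
    unfolding SI2 th_b pf[OF nz(3)] Xb_def Yc_def ..
  \<comment> \<open>The theta inversions at \<open>b / T\<close>, \<open>c / T\<close> and the
    shifts at \<open>b * f\<close>, \<open>c * f\<close> produce monomials, namely
    \<open>(c / T) * (b * f)\<close> on one side and \<open>(b / T) * (c * f)\<close> on the other;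
    these are equal, so the bracket carries no extra factor.\<close>
  have E3: "K2_bracket_num q A B C D E F * (S3 * I2) = K2_bracket_den q A B C D E F * (S2 * I3)"
  proof -
    have "K2_bracket_num q A B C D E F * (S3 * I2) = b * c * (b * c * f / T) * (Xb * Xc * Yb * Yc) * (N1 * Z3)"
      unfolding SI1' B1 by simp
    also have "\<dots> = K2_bracket_den q A B C D E F * (S2 * I3)"
      unfolding SI2' B2 NZ by simp
    finally show ?thesis .
  qed
  have K1: "K1 q A B C D E F G H * n6 = n5 * (S2 * I1 / (S1 * I2))"
    unfolding K1_def n using E1 S_nz K1_dz P_q_nz by (simp add: divide_simps) (simp add: mult_ac)
  have K2: "K2 q A B C D E F G H * n0 = n5 * (S3 / S1) * (1 - S2 * I3 / (S3 * I2))"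
  proof -
    have a: "K2_bracket_num q A B C D E F / K2_bracket_den q A B C D E F = S2 * I3 / (S3 * I2)"
      using E3 S_nz Kb_dz by (simp add: divide_simps)
    have b: "K2_num q A B C D E F G H / K2_den q A B C D E F G H * n0 = n5 * (S3 / S1)"
      unfolding n using E2 S_nz K2_dz P_q_nz by (simp add: divide_simps) (simp add: mult_ac)
    have "K2 q A B C D E F G H * n0 = K2_num q A B C D E F G H / K2_den q A B C D E F G H * n0
        * (1 - K2_bracket_num q A B C D E F / K2_bracket_den q A B C D E F)"
      unfolding K2_def by simp
    then show ?thesis
      unfolding a b .
  qed
  have \<psi>: "\<psi> = (I3 * \<psi>0 - I1 * \<psi>6) / I2"
    using inv S_nz by (simp add: field_simps)
  have "\<psi>5 = (S3 * \<psi>0 - S2 * \<psi>) / S1"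
    using star S_nz by (simp add: field_simps)
  then have \<psi>5': "\<psi>5 = S2 * I1 / (S1 * I2) * \<psi>6 + S3 / S1 * (1 - S2 * I3 / (S3 * I2)) * \<psi>0"
    unfolding \<psi> using S_nz by (simp add: divide_simps) (simp add: algebra_simps)
  have "\<Phi>5 - (K1 q A B C D E F G H * \<Phi>6 + K2 q A B C D E F G H * \<Phi>0)
      = - n5 * \<psi>5 + (K1 q A B C D E F G H * n6) * \<psi>6 + (K2 q A B C D E F G H * n0) * \<psi>0"
    unfolding \<Phi>5 \<Phi>6 \<Phi>0 by (simp add: algebra_simps)
  also have "\<dots> = 0"
    unfolding K1 K2 \<psi>5' by (simp add: algebra_simps)
  finally show ?thesis
    unfolding \<Phi>5_def \<Phi>6_def \<Phi>0_def by simp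
qed

subsection \<open>Passage to arbitrary parameters\<close>

text \<open>A perturbation \<open>t_i exp (s^(i+1))\<close> destroys independence only if \<open>s\<close> is a root of one of
  countably many non-zero polynomials.\<close>

lemma indep_dense:
  assumes pr: "t0 * t1 * t2 * t3 * t4 * t5 * t6 * t7 = q\<^sup>2" and e: "0 < (\<epsilon>::real)"
  obtains s where "norm s < \<epsilon>"
    "indep [t0 * exp s, t1 * exp (s ^ 2), t2 * exp (s ^ 3), t3 * exp (s ^ 4), t4 * exp (s ^ 5), t5 * exp (s ^ 6), t6 * exp (s ^ 7),
      t7 * exp (- (s + s ^ 2 + s ^ 3 + s ^ 4 + s ^ 5 + s ^ 6 + s ^ 7))]"
proof -
  have nz: "t0 \<noteq> 0" "t1 \<noteq> 0" "t2 \<noteq> 0" "t3 \<noteq> 0" "t4 \<noteq> 0" "t5 \<noteq> 0" "t6 \<noteq> 0" "t7 \<noteq> 0"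
    using pr by auto
  define M where "M ks = prod_list (map2 (powi) [t0, t1, t2, t3, t4, t5, t6, t7] ks)" for ks
  \<comment> \<open>The logarithm of a multiplicative relation with exponents \<open>ks\<close> and
    value \<open>q powi n\<close>, as a polynomial in the perturbation \<open>s\<close>;
    \<open>l\<close> accounts for the branch. The last parameter compensates the other seven, whence
    the coefficients \<open>ks ! i - ks ! 7\<close>.\<close>
  define pol where "pol = (\<lambda>(ks :: int list, n :: int, l :: int).
    pCons (- (Ln (q powi n / M ks) + of_int (2 * l) * pi * \<i>)) (Poly (map (\<lambda>i. of_int (ks ! i - ks ! 7)) [0..<7])))"
  define Bad where "Bad = (\<Union>x \<in> {x. pol x \<noteq> 0}. {s. poly (pol x) s = 0})"
  have "countable Bad"
    unfolding Bad_def by (intro countable_UN countableI_type) (auto intro: countable_finite poly_roots_finite)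
  moreover have "uncountable (ball (0 :: complex) \<epsilon>)"
    using e by (rule uncountable_ball)
  ultimately have "\<not> ball 0 \<epsilon> \<subseteq> Bad"
    using countable_subset by auto
  then obtain s where "s \<in> ball 0 \<epsilon>" and sB: "s \<notin> Bad"
    by (meson subsetI)
  then have s: "norm s < \<epsilon>" "s \<notin> Bad"
    by (simp_all add: mem_ball_0)
  show ?thesis
  proof (rule that[OF s(1)], rule indepI)
    define u where "u = s + s ^ 2 + s ^ 3 + s ^ 4 + s ^ 5 + s ^ 6 + s ^ 7"
    have "exp s * exp (s ^ 2) * exp (s ^ 3) * exp (s ^ 4) * exp (s ^ 5) * exp (s ^ 6) * exp (s ^ 7) * exp (- u) = 1"
      unfolding u_def by (simp add: exp_add[symmetric])
    then have "(t0 * t1 * t2 * t3 * t4 * t5 * t6 * t7) * (exp s * exp (s ^ 2) * exp (s ^ 3) * exp (s ^ 4) * exp (s ^ 5) * exp (s ^ 6) * exp (s ^ 7) * exp (- u)) = q\<^sup>2"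
      using pr by simp
    then show "t0 * exp s * (t1 * exp (s ^ 2)) * (t2 * exp (s ^ 3)) * (t3 * exp (s ^ 4)) * (t4 * exp (s ^ 5)) * (t5 * exp (s ^ 6)) * (t6 * exp (s ^ 7))
      * (t7 * exp (- (s + s ^ 2 + s ^ 3 + s ^ 4 + s ^ 5 + s ^ 6 + s ^ 7))) = q\<^sup>2"
      unfolding u_def[symmetric] by (simp only: mult_ac)
    fix k0 k1 k2 k3 k4 k5 k6 k7 :: int
    let ?ks = "[k0, k1, k2, k3, k4, k5, k6, k7]"
    define c where "c i = complex_of_int (?ks ! i - k7)" for i
    define p where "p = c 0 * s + c 1 * s ^ 2 + c 2 * s ^ 3 + c 3 * s ^ 4 + c 4 * s ^ 5 + c 5 * s ^ 6 + c 6 * s ^ 7"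
    have Mnz: "M ?ks \<noteq> 0"
      unfolding M_def using nz by simp
    assume "(t0 * exp s) powi k0 * (t1 * exp (s ^ 2)) powi k1 * (t2 * exp (s ^ 3)) powi k2 * (t3 * exp (s ^ 4)) powi k3 * (t4 * exp (s ^ 5)) powi k4
      * (t5 * exp (s ^ 6)) powi k5 * (t6 * exp (s ^ 7)) powi k6
      * (t7 * exp (- (s + s ^ 2 + s ^ 3 + s ^ 4 + s ^ 5 + s ^ 6 + s ^ 7))) powi k7 \<in> Zq"
    then obtain n where n: "(t0 * exp s) powi k0 * (t1 * exp (s ^ 2)) powi k1 * (t2 * exp (s ^ 3)) powi k2 * (t3 * exp (s ^ 4)) powi k3 * (t4 * exp (s ^ 5)) powi k4
      * (t5 * exp (s ^ 6)) powi k5 * (t6 * exp (s ^ 7)) powi k6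
      * (t7 * exp (- (s + s ^ 2 + s ^ 3 + s ^ 4 + s ^ 5 + s ^ 6 + s ^ 7))) powi k7 = q powi n"
      unfolding Zq_def by auto
    have "M ?ks * exp p = (t0 * exp s) powi k0 * (t1 * exp (s ^ 2)) powi k1 * (t2 * exp (s ^ 3)) powi k2 * (t3 * exp (s ^ 4)) powi k3 * (t4 * exp (s ^ 5)) powi k4
      * (t5 * exp (s ^ 6)) powi k5 * (t6 * exp (s ^ 7)) powi k6
      * (t7 * exp (- (s + s ^ 2 + s ^ 3 + s ^ 4 + s ^ 5 + s ^ 6 + s ^ 7))) powi k7"
    proof -
      have "p = of_int k0 * s + of_int k1 * s ^ 2 + of_int k2 * s ^ 3 + of_int k3 * s ^ 4 + of_int k4 * s ^ 5 + of_int k5 * s ^ 6 + of_int k6 * s ^ 7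
        + of_int k7 * (- (s + s ^ 2 + s ^ 3 + s ^ 4 + s ^ 5 + s ^ 6 + s ^ 7))"
        unfolding p_def c_def by (simp add: nth_Cons' algebra_simps)
      then show ?thesis
        unfolding M_def power_int_mult_distrib exp_power_int by (simp add: exp_add mult_ac)
    qed
    then have "exp p = q powi n / M ?ks"
      using n Mnz by (simp add: field_simps)
    also have "\<dots> = exp (Ln (q powi n / M ?ks))"
      using Mnz by simp
    finally obtain l :: int where l: "p = Ln (q powi n / M ?ks) + of_int (2 * l) * pi * \<i>"
      unfolding exp_eq by auto
    have "poly (pol (?ks, n, l)) s = 0"
      unfolding pol_def prod.case using l
      by (simp add: upt_rec p_def c_def algebra_simps eval_nat_numeral)
    \<comment> \<open>As \<open>s\<close> avoids the roots of all nonzero polynomials of this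
      family, the polynomial itself is 0, and its coefficients force all exponents to equal
      \<open>k7\<close>.\<close>
    then have "pol (?ks, n, l) = 0"
      using s(2) unfolding Bad_def by blast
    then show "k1 = k0 \<and> k2 = k0 \<and> k3 = k0 \<and> k4 = k0 \<and> k5 = k0 \<and> k6 = k0 \<and> k7 = k0"
      unfolding pol_def prod.case by (simp add: upt_rec eval_nat_numeral split: if_splits)
  qed
qed

lemma generic_sequence:
  assumes pr: "t0 * t1 * t2 * t3 * t4 * t5 * t6 * t7 = q\<^sup>2"
  obtains u0 u1 u2 u3 u4 u5 u6 u7 where
    "\<And>n. indep [u0 n, u1 n, u2 n, u3 n, u4 n, u5 n, u6 n, u7 n]"
    "u0 \<longlonglongrightarrow> t0" "u1 \<longlonglongrightarrow> t1" "u2 \<longlonglongrightarrow> t2" "u3 \<longlonglongrightarrow> t3" "u4 \<longlonglongrightarrow> t4" "u5 \<longlonglongrightarrow> t5" "u6 \<longlonglongrightarrow> t6" "u7 \<longlonglongrightarrow> t7"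
proof -
  have "\<exists>s. norm s < 1 / real (Suc n) \<and>
    indep [t0 * exp s, t1 * exp (s ^ 2), t2 * exp (s ^ 3), t3 * exp (s ^ 4), t4 * exp (s ^ 5), t5 * exp (s ^ 6), t6 * exp (s ^ 7),
      t7 * exp (- (s + s ^ 2 + s ^ 3 + s ^ 4 + s ^ 5 + s ^ 6 + s ^ 7))]" for n
    by (rule indep_dense[OF pr, of "1 / real (Suc n)"]) auto
  then obtain s where s: "\<And>n. norm (s n) < 1 / real (Suc n)"
    "\<And>n. indep [t0 * exp (s n), t1 * exp (s n ^ 2), t2 * exp (s n ^ 3), t3 * exp (s n ^ 4), t4 * exp (s n ^ 5), t5 * exp (s n ^ 6), t6 * exp (s n ^ 7),
      t7 * exp (- (s n + s n ^ 2 + s n ^ 3 + s n ^ 4 + s n ^ 5 + s n ^ 6 + s n ^ 7))]"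
    by metis
  have s0: "s \<longlonglongrightarrow> 0"
    by (rule LIMSEQ_norm_0) (rule s(1))
  show ?thesis
  proof (rule that[OF s(2)])
    show "(\<lambda>n. t0 * exp (s n)) \<longlonglongrightarrow> t0"
      by (rule tendsto_eq_intros s0 | simp)+
    show "(\<lambda>n. t1 * exp (s n ^ 2)) \<longlonglongrightarrow> t1"
      by (rule tendsto_eq_intros s0 | simp)+
    show "(\<lambda>n. t2 * exp (s n ^ 3)) \<longlonglongrightarrow> t2"
      by (rule tendsto_eq_intros s0 | simp)+
    show "(\<lambda>n. t3 * exp (s n ^ 4)) \<longlonglongrightarrow> t3"
      by (rule tendsto_eq_intros s0 | simp)+
    show "(\<lambda>n. t4 * exp (s n ^ 5)) \<longlonglongrightarrow> t4"
      by (rule tendsto_eq_intros s0 | simp)+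
    show "(\<lambda>n. t5 * exp (s n ^ 6)) \<longlonglongrightarrow> t5"
      by (rule tendsto_eq_intros s0 | simp)+
    show "(\<lambda>n. t6 * exp (s n ^ 7)) \<longlonglongrightarrow> t6"
      by (rule tendsto_eq_intros s0 | simp)+
    show "(\<lambda>n. t7 * exp (- (s n + s n ^ 2 + s n ^ 3 + s n ^ 4 + s n ^ 5 + s n ^ 6 + s n ^ 7))) \<longlonglongrightarrow> t7"
      by (rule tendsto_eq_intros s0 | simp)+
  qed
qed

section \<open>Continuity of the series and of \<open>Phi\<close> at regular points\<close>

lemma bdd2_qpoch: "bdd2 f \<Longrightarrow> bdd2 (\<lambda>n k. qpoch q (f n k) k)"
proof -
  assume "bdd2 f"
  then obtain M where M: "norm (f n k) \<le> M" for n k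
    unfolding bdd2_def by auto
  have "norm (qpoch q (f n k) k) \<le> exp (M / (1 - norm q))" for n k
    using M norm_q by (intro order_trans[OF norm_qpoch_le]) (simp add: divide_right_mono)
  then show ?thesis
    unfolding bdd2_def by auto
qed

lemma tendsto_qpoch: "f \<longlonglongrightarrow> l \<Longrightarrow> (\<lambda>n. qpoch q (f n) k) \<longlonglongrightarrow> qpoch q l k"
  unfolding qpoch_def by (intro tendsto_intros)

definition seq_list_tendsto :: "(nat \<Rightarrow> complex) list \<Rightarrow> complex list \<Rightarrow> bool" where
  "seq_list_tendsto fs ls \<longleftrightarrow> list_all2 (\<lambda>f l. f \<longlonglongrightarrow> l) fs ls"

lemma seq_list_simps [simp]:
  "seq_list_tendsto [] []" "seq_list_tendsto (f # fs) (l # ls) \<longleftrightarrow> f \<longlonglongrightarrow> l \<and> seq_list_tendsto fs ls"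
  by (simp_all add: seq_list_tendsto_def)

lemma seq_list_induct [consumes 1, case_names Nil Cons]:
  assumes "seq_list_tendsto fs ls" "R [] []"
    and "\<And>f fs l ls. f \<longlonglongrightarrow> l \<Longrightarrow> seq_list_tendsto fs ls \<Longrightarrow> R fs ls \<Longrightarrow> R (f # fs) (l # ls)"
  shows "R fs ls"
  using assms(1) unfolding seq_list_tendsto_def
  by (induction rule: list_all2_induct) (auto intro: assms(2,3) simp: seq_list_tendsto_def)

text \<open>Connects \<open>W_regular\<close>, which speaks of finite products, with the infinite
  products used for continuity: a zero of the infinite product comes from a single factor.\<close>

lemma qpoch_nz_imp_P_nz: "(\<And>k. qpoch q x k \<noteq> 0) \<Longrightarrow> P x \<noteq> 0"
proof
  assume nz: "\<And>k. qpoch q x k \<noteq> 0" and "P x = 0"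
  then obtain n where "x * q ^ n = 1"
    unfolding P_eq_0_iff by auto
  then have "qpoch q x (Suc n) = 0"
    by (simp add: qpoch_Suc)
  with nz show False by simp
qed

lemma inverse_qpoch: "P x \<noteq> 0 \<Longrightarrow> 1 / qpoch q x k = P (x * q ^ k) / P x"
proof -
  assume x: "P x \<noteq> 0"
  have e: "P x = qpoch q x k * P (x * q ^ k)"
    by (rule P_shift)
  with x have "qpoch q x k \<noteq> 0" "P (x * q ^ k) \<noteq> 0"
    by auto
  then show ?thesis
    unfolding e by (simp only: divide_simps) simp
qed

text \<open>Writing each reciprocal finite product as a quotient of infinite products moves all
  denominators into a prefactor independent of \<open>k\<close>. The remaining summand has no poles
  and admits bounds uniform in the parameters.\<close>

lemma W_eq_regular:
  assumes "\<And>p. p \<in> set ps \<Longrightarrow> P (a * q / p) \<noteq> 0"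
  shows "W q a ps = (\<Sum>k. q ^ k * ((1 - a * (q ^ k * q ^ k)) * qpoch q a k * P (q * q ^ k)
      * (\<Prod>p\<leftarrow>ps. qpoch q p k * P (a * q / p * q ^ k)))) / ((1 - a) * P q * (\<Prod>p\<leftarrow>ps. P (a * q / p)))"
proof -
  define N where "N = (\<Prod>p\<leftarrow>ps. P (a * q / p))"
  have prod: "qpochs q ps k / qpochs q (map (\<lambda>p. a * q / p) ps) k = (\<Prod>p\<leftarrow>ps. qpoch q p k * P (a * q / p * q ^ k)) / N" for k
    using assms unfolding N_def
  proof (induction ps)
    case (Cons p ps)
    have "1 / qpoch q (a * q / p) k = P (a * q / p * q ^ k) / P (a * q / p)"
      using Cons.prems by (intro inverse_qpoch) simp
    then have "qpoch q p k * (1 / qpoch q (a * q / p) k) * (qpochs q ps k / qpochs q (map (\<lambda>p. a * q / p) ps) k)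
      = qpoch q p k * (P (a * q / p * q ^ k) / P (a * q / p)) * ((\<Prod>p\<leftarrow>ps. qpoch q p k * P (a * q / p * q ^ k)) / (\<Prod>p\<leftarrow>ps. P (a * q / p)))"
      using Cons.IH Cons.prems by simp
    then show ?case
      by (simp add: qpochs_def)
  qed (simp add: qpochs_def)
  have qq: "1 / qpoch q q k = P (q * q ^ k) / P q" for k
    by (rule inverse_qpoch[OF P_q_nz])
  have "(1 - a * q ^ (2 * k)) / (1 - a) * (qpochs q (a # ps) k / qpochs q (q # map (\<lambda>p. a * q / p) ps) k) * q ^ k
    = q ^ k * ((1 - a * (q ^ k * q ^ k)) * qpoch q a k * P (q * q ^ k)
      * (\<Prod>p\<leftarrow>ps. qpoch q p k * P (a * q / p * q ^ k))) / ((1 - a) * P q * N)" for k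
  proof -
    have "(1 - a * q ^ (2 * k)) / (1 - a) * (qpochs q (a # ps) k / qpochs q (q # map (\<lambda>p. a * q / p) ps) k) * q ^ k
      = (1 - a * (q ^ k * q ^ k)) / (1 - a) * qpoch q a k * (1 / qpoch q q k) * (qpochs q ps k / qpochs q (map (\<lambda>p. a * q / p) ps) k) * q ^ k"
      by (simp add: qpochs_def mult_2 power_add mult.assoc)
    then show ?thesis
      unfolding prod qq by (simp add: mult_ac)
  qed
  note F_term = this
  have sm: "summable (\<lambda>k. q ^ k * ((1 - a * (q ^ k * q ^ k)) * qpoch q a k * P (q * q ^ k)
      * (\<Prod>p\<leftarrow>ps. qpoch q p k * P (a * q / p * q ^ k))))"
  proof (rule summable_q_comparison)
    have "(\<lambda>k. (\<Prod>p\<leftarrow>ps. qpoch q p k * P (a * q / p * q ^ k))) \<longlonglongrightarrow> (\<Prod>p\<leftarrow>ps. P p * 1)"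
    proof (induction ps)
      case (Cons p ps)
      have "(\<lambda>k. qpoch q p k * P (a * q / p * q ^ k)) \<longlonglongrightarrow> P p * 1"
        by (intro tendsto_mult qpoch_tendsto_P tendsto_P_q_power)
      from tendsto_mult[OF this Cons] show ?case
        by simp
    qed simp
    then show "(\<lambda>k. (1 - a * (q ^ k * q ^ k)) * qpoch q a k * P (q * q ^ k)
      * (\<Prod>p\<leftarrow>ps. qpoch q p k * P (a * q / p * q ^ k))) \<longlonglongrightarrow> (1 - a * (0 * 0)) * P a * 1 * (\<Prod>p\<leftarrow>ps. P p * 1)"
      by (intro tendsto_mult tendsto_diff tendsto_const tendsto_q_power qpoch_tendsto_P tendsto_P_q_power)
  qed
  show ?thesis
    unfolding W_def F_term N_def[symmetric] by (rule suminf_divide[OF sm])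
qed

text \<open>Dominated convergence applies to the form without poles, and the prefactor is continuous
  where its denominator is nonzero.\<close>

lemma tendsto_W:
  assumes a: "as \<longlonglongrightarrow> a" and ps: "seq_list_tendsto fs ps" and reg: "W_regular q a ps"
  shows "(\<lambda>n. W q (as n) (map (\<lambda>f. f n) fs)) \<longlonglongrightarrow> W q a ps"
proof -
  define f where "f n k = (1 - as n * (q ^ k * q ^ k)) * qpoch q (as n) k * P (q * q ^ k)
      * (\<Prod>h\<leftarrow>fs. qpoch q (h n) k * P (as n * q / h n * q ^ k))" for n k
  define g where "g k = (1 - a * (q ^ k * q ^ k)) * qpoch q a k * P (q * q ^ k)
      * (\<Prod>p\<leftarrow>ps. qpoch q p k * P (a * q / p * q ^ k))" for k
  define N where "N n = (\<Prod>h\<leftarrow>fs. P (as n * q / h n))" for n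
  define N0 where "N0 = (\<Prod>p\<leftarrow>ps. P (a * q / p))"
  have p0: "p \<in> set ps \<Longrightarrow> p \<noteq> 0" for p
    using reg by (auto simp: W_regular_def)
  have pn: "P (a * q / p) \<noteq> 0" if "p \<in> set ps" for p
  proof (rule qpoch_nz_imp_P_nz)
    fix k
    have "qpochs q (q # map (\<lambda>p. a * q / p) ps) k \<noteq> 0"
      using reg by (auto simp: W_regular_def)
    then show "qpoch q (a * q / p) k \<noteq> 0"
      using that by (auto simp: qpochs_def prod_list_zero_iff image_iff)
  qed
  have a1: "a \<noteq> 1" using reg by (simp add: W_regular_def)
  \<comment> \<open>Regularity is given at the limit point only; by continuity the denominators are
    nonzero for all late \<open>n\<close>, where the series may be rewritten.\<close>
  have ev: "\<forall>\<^sub>F n in sequentially. \<forall>p \<in> set (map (\<lambda>f. f n) fs). P (as n * q / p) \<noteq> 0"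
    using ps p0 pn
  proof (induction rule: seq_list_induct)
    case (Cons h fs l ls)
    have "(\<lambda>n. P (as n * q / h n)) \<longlonglongrightarrow> P (a * q / l)"
      using Cons by (intro tendsto_intros a) auto
    then have "\<forall>\<^sub>F n in sequentially. P (as n * q / h n) \<noteq> 0"
      using Cons.prems by (intro tendsto_imp_eventually_ne) auto
    moreover have "\<forall>\<^sub>F n in sequentially. \<forall>p \<in> set (map (\<lambda>f. f n) fs). P (as n * q / p) \<noteq> 0"
      using Cons.IH Cons.prems by simp
    ultimately show ?case
      by eventually_elim auto
  qed simp
  have Nlim: "N \<longlonglongrightarrow> N0"
    unfolding N_def N0_def using ps p0
  proof (induction rule: seq_list_induct)
    case (Cons h fs l ls)
    then show ?case
      by (auto intro!: tendsto_intros a)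
  qed simp
  have N0: "N0 \<noteq> 0"
    unfolding N0_def using pn by (auto simp: prod_list_zero_iff)
  have "(\<lambda>n. \<Sum>k. q ^ k * f n k) \<longlonglongrightarrow> (\<Sum>k. q ^ k * g k)"
  proof (rule tannery_q)
    fix k
    have "(\<lambda>n. (\<Prod>h\<leftarrow>fs. qpoch q (h n) k * P (as n * q / h n * q ^ k))) \<longlonglongrightarrow> (\<Prod>p\<leftarrow>ps. qpoch q p k * P (a * q / p * q ^ k))"
      using ps p0
    proof (induction rule: seq_list_induct)
      case (Cons h fs l ls)
      then show ?case
        by (auto intro!: tendsto_intros a tendsto_qpoch)
    qed simp
    then show "(\<lambda>n. f n k) \<longlonglongrightarrow> g k"
      unfolding f_def g_def by (intro tendsto_mult tendsto_diff tendsto_const a tendsto_qpoch)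
  next
    have ba: "bdd2 (\<lambda>n k. as n)"
      using bdd2_sequence[OF a, of "\<lambda>n k. n"] .
    have "bdd2 (\<lambda>n k. (\<Prod>h\<leftarrow>fs. qpoch q (h n) k * P (as n * q / h n * q ^ k)))"
      using ps p0
    proof (induction rule: seq_list_induct)
      case Nil
      then show ?case by (simp add: bdd2_const)
    next
      case (Cons h fs l ls)
      have "(\<lambda>n. as n * q / h n) \<longlonglongrightarrow> a * q / l"
        using Cons by (intro tendsto_intros a) auto
      note b1 = bdd2_sequence[OF this, of "\<lambda>n k. n"]
      have b2: "bdd2 (\<lambda>n k. h n)"
        using bdd2_sequence[OF Cons.hyps(1), of "\<lambda>n k. n"] .
      have "bdd2 (\<lambda>n k. qpoch q (h n) k * P (as n * q / h n * q ^ k) * (\<Prod>h\<leftarrow>fs. qpoch q (h n) k * P (as n * q / h n * q ^ k)))"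
        using Cons by (intro bdd2_mult bdd2_P bdd2_qpoch b1 b2 bdd2_q_power) auto
      then show ?case by simp
    qed
    then show "bdd2 f"
      unfolding f_def by (intro bdd2_mult bdd2_diff bdd2_const ba bdd2_q_power bdd2_qpoch bdd2_P)
  qed
  then have "(\<lambda>n. (\<Sum>k. q ^ k * f n k) / ((1 - as n) * P q * N n)) \<longlonglongrightarrow> (\<Sum>k. q ^ k * g k) / ((1 - a) * P q * N0)"
    using a1 N0 P_q_nz by (intro tendsto_divide tendsto_mult tendsto_diff tendsto_const a Nlim) simp_all
  also have "(\<Sum>k. q ^ k * g k) / ((1 - a) * P q * N0) = W q a ps"
    unfolding g_def N0_def by (rule W_eq_regular[OF pn, symmetric])
  finally show ?thesis
  proof (rule Lim_transform_eventually)
    show "\<forall>\<^sub>F n in sequentially. (\<Sum>k. q ^ k * f n k) / ((1 - as n) * P q * N n) = W q (as n) (map (\<lambda>f. f n) fs)"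
      using ev
    proof eventually_elim
      case (elim n)
      show ?case
        unfolding f_def N_def using W_eq_regular[of "map (\<lambda>f. f n) fs" "as n"] elim by (simp add: o_def)
    qed
  qed
qed

lemma seq_list_length: "seq_list_tendsto fs ls \<Longrightarrow> length fs = length ls"
  unfolding seq_list_tendsto_def by (rule list_all2_lengthD)

lemma seq_list_nth: "seq_list_tendsto fs ls \<Longrightarrow> i < length ls \<Longrightarrow> (fs ! i) \<longlonglongrightarrow> ls ! i"
  unfolding seq_list_tendsto_def by (simp add: list_all2_conv_all_nth)

lemma seq_list_others: "seq_list_tendsto fs ls \<Longrightarrow> seq_list_tendsto (take i fs @ drop (Suc i) fs) (others i ls)"
  unfolding seq_list_tendsto_def others_def by (intro list_all2_appendI list_all2_takeI list_all2_dropI)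

lemma others_map: "others i (map f xs) = map f (take i xs @ drop (Suc i) xs)"
  by (simp add: others_def take_map drop_map)

lemma tendsto_Phi:
  assumes a: "as \<longlonglongrightarrow> a" and ps: "seq_list_tendsto fs ps" and i: "i < length ps" and reg: "Phi_regular q i a ps"
  shows "(\<lambda>n. Phi q i (as n) (map (\<lambda>f. f n) fs)) \<longlonglongrightarrow> Phi q i a ps"
proof -
  define p where "p = ps ! i"
  define h where "h = fs ! i"
  have len: "i < length fs"
    using i seq_list_length[OF ps] by simp
  have h: "h \<longlonglongrightarrow> p"
    unfolding h_def p_def by (rule seq_list_nth[OF ps i])
  have nth: "map (\<lambda>f. f n) fs ! i = h n" for n
    using len by (simp add: h_def)
  have a0: "a \<noteq> 0" and W1: "W_regular q a ps" and W2: "W_regular q (p\<^sup>2 / a) (Phi_params i a ps)" and den: "Phi_den q i a ps \<noteq> 0"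
    using reg by (simp_all add: Phi_regular_def p_def)
  have nz: "x \<in> set ps \<Longrightarrow> x \<noteq> 0" for x
    using W1 by (auto simp: W_regular_def)
  have p0: "p \<noteq> 0"
    using nz i by (simp add: p_def)
  have onz: "x \<in> set (others i ps) \<Longrightarrow> x \<noteq> 0" for x
    using nz unfolding others_def by (auto dest: in_set_takeD in_set_dropD)
  note os = seq_list_others[OF ps, of i]
  have num: "(\<lambda>n. Phi_num q i (as n) (map (\<lambda>f. f n) fs)) \<longlonglongrightarrow> Phi_num q i a ps"
  proof -
    have "(\<lambda>n. \<Prod>f\<leftarrow>take i fs @ drop (Suc i) fs. qpochs_inf q [f n, h n * q / f n]) \<longlonglongrightarrow> (\<Prod>x\<leftarrow>others i ps. qpochs_inf q [x, p * q / x])"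
      using os onz
    proof (induction rule: seq_list_induct)
      case (Cons f fs l ls)
      have "(\<lambda>n. P (f n) * P (h n * q / f n)) \<longlonglongrightarrow> P l * P (p * q / l)"
        using Cons by (intro tendsto_intros h) auto
      from tendsto_mult[OF this Cons.IH] Cons.prems show ?case
        by (simp add: qpochs_inf_def)
    qed simp
    moreover have "(\<lambda>n. qpochs_inf q [as n * q, h n / as n]) \<longlonglongrightarrow> qpochs_inf q [a * q, p / a]"
      unfolding qpochs_inf_def using a0 by (auto intro!: tendsto_intros a h)
    ultimately show ?thesis
      unfolding Phi_num_def Let_def nth p_def[symmetric] others_map list.map_comp o_def by (intro tendsto_mult)
  qed
  have den': "(\<lambda>n. Phi_den q i (as n) (map (\<lambda>f. f n) fs)) \<longlonglongrightarrow> Phi_den q i a ps"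
  proof -
    have "(\<lambda>n. \<Prod>f\<leftarrow>take i fs @ drop (Suc i) fs. qpochs_inf q [as n * q / f n, h n * f n / as n]) \<longlonglongrightarrow> (\<Prod>x\<leftarrow>others i ps. qpochs_inf q [a * q / x, p * x / a])"
      using os onz
    proof (induction rule: seq_list_induct)
      case (Cons f fs l ls)
      have "(\<lambda>n. P (as n * q / f n) * P (h n * f n / as n)) \<longlonglongrightarrow> P (a * q / l) * P (p * l / a)"
        using Cons a0 by (intro tendsto_intros h a) auto
      from tendsto_mult[OF this Cons.IH] Cons.prems show ?case
        by (simp add: qpochs_inf_def)
    qed simp
    moreover have "(\<lambda>n. qpochs_inf q [(h n)\<^sup>2 * q / as n, as n / h n]) \<longlonglongrightarrow> qpochs_inf q [p\<^sup>2 * q / a, a / p]"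
      unfolding qpochs_inf_def using a0 p0 by (auto intro!: tendsto_intros a h)
    ultimately show ?thesis
      unfolding Phi_den_def Let_def nth p_def[symmetric] others_map list.map_comp o_def by (intro tendsto_mult)
  qed
  define hs where "hs = h # map (\<lambda>f n. h n * f n / as n) (take i fs @ drop (Suc i) fs)"
  have par: "seq_list_tendsto hs (Phi_params i a ps)"
  proof -
    have "seq_list_tendsto (map (\<lambda>f n. h n * f n / as n) (take i fs @ drop (Suc i) fs)) (map (\<lambda>x. p * x / a) (others i ps))"
      using os
    proof (induction rule: seq_list_induct)
      case (Cons f fs l ls)
      then show ?case
        using a0 by (auto intro!: tendsto_intros h a)
    qed simp
    then show ?thesis
      unfolding hs_def Phi_params_def Let_def p_def[symmetric] using h by simp
  qed
  have hs: "map (\<lambda>f. f n) hs = Phi_params i (as n) (map (\<lambda>f. f n) fs)" for n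
    unfolding hs_def Phi_params_def Let_def nth others_map by (simp add: o_def)
  have "(\<lambda>n. (h n)\<^sup>2 / as n) \<longlonglongrightarrow> p\<^sup>2 / a"
    using a0 by (intro tendsto_intros h a)
  from tendsto_W[OF this par W2]
  have "(\<lambda>n. W q ((h n)\<^sup>2 / as n) (Phi_params i (as n) (map (\<lambda>f. f n) fs))) \<longlonglongrightarrow> W q (p\<^sup>2 / a) (Phi_params i a ps)"
    unfolding hs .
  then show ?thesis
    unfolding Phi_def nth p_def[symmetric]
    by (intro tendsto_add tendsto_mult tendsto_divide tendsto_W[OF a ps W1] num den' den)
qed

lemma tendsto_qpochs_inf_Cons:
  "f \<longlonglongrightarrow> l \<Longrightarrow> (\<lambda>n. qpochs_inf q (g n)) \<longlonglongrightarrow> qpochs_inf q ls \<Longrightarrow> (\<lambda>n. qpochs_inf q (f n # g n)) \<longlonglongrightarrow> qpochs_inf q (l # ls)"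
  by (simp add: qpochs_inf_def tendsto_mult tendsto_P)

lemma tendsto_qpochs_inf_Nil: "(\<lambda>n. qpochs_inf q []) \<longlonglongrightarrow> qpochs_inf q []"
  by simp

text \<open>Independent parameters approximate the given ones, the identity holds along the
  sequence, and every ingredient is continuous at the limit because its denominators do not vanish
  there.\<close>

theorem three_term:
  fixes A B C D E F G H :: complex
  assumes nz: "A \<noteq> 0" "B \<noteq> 0" "C \<noteq> 0" "D \<noteq> 0" "E \<noteq> 0" "F \<noteq> 0" "G \<noteq> 0" "H \<noteq> 0"
    and bal: "B * C * D * E * F * G * H = A ^ 3 * q\<^sup>2"
    and reg: "Phi_regular q 5 A [B, C, D, E, F, G, H]"
      "Phi_regular q 6 (q/A) [q/B, q/C, q/D, q/E, q/F, q/G, q/H]"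
      "Phi_regular q 0 (G\<^sup>2/A) [G*B/A, G*C/A, G*D/A, G*E/A, G*F/A, G, G*H/A]"
    and den: "K1_den q A B C D E F G H \<noteq> 0" "K2_den q A B C D E F G H \<noteq> 0" "K2_bracket_den q A B C D E F \<noteq> 0"
  shows "Phi q 5 A [B, C, D, E, F, G, H]
    = K1 q A B C D E F G H * Phi q 6 (q/A) [q/B, q/C, q/D, q/E, q/F, q/G, q/H]
    + K2 q A B C D E F G H * Phi q 0 (G\<^sup>2/A) [G*B/A, G*C/A, G*D/A, G*E/A, G*F/A, G, G*H/A]"
proof -
  \<comment> \<open>A square root of \<open>A\<close> restores the symmetric parameters, and the
    balancing condition becomes the statement that their product is \<open>q^2\<close>.\<close>
  define t where "t = csqrt A"
  have t: "t * t = A" "t \<noteq> 0"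
    using nz power2_csqrt[of A] by (auto simp: t_def power2_eq_square)
  have "t * (B / t) * (C / t) * (D / t) * (E / t) * (F / t) * (G / t) * (H / t) = B * C * D * E * F * G * H / (t * t) ^ 3"
    using t(2) by (simp add: power3_eq_cube)
  also have "\<dots> = q\<^sup>2"
    unfolding bal t(1) using nz by simp
  finally obtain u b c d e f g h where
    ind: "\<And>n. indep [u n, b n, c n, d n, e n, f n, g n, h n]" and
    u: "u \<longlonglongrightarrow> t" and lim: "b \<longlonglongrightarrow> B / t" "c \<longlonglongrightarrow> C / t" "d \<longlonglongrightarrow> D / t" "e \<longlonglongrightarrow> E / t" "f \<longlonglongrightarrow> F / t" "g \<longlonglongrightarrow> G / t" "h \<longlonglongrightarrow> H / t"
    using generic_sequence[of t "B / t" "C / t" "D / t" "E / t" "F / t" "G / t" "H / t"] by metis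
  define A' B' C' D' E' F' G' H' where "A' n = (u n)\<^sup>2" and "B' n = u n * b n" and "C' n = u n * c n" and "D' n = u n * d n"
    and "E' n = u n * e n" and "F' n = u n * f n" and "G' n = u n * g n" and "H' n = u n * h n" for n
  have L: "A' \<longlonglongrightarrow> A" "B' \<longlonglongrightarrow> B" "C' \<longlonglongrightarrow> C" "D' \<longlonglongrightarrow> D" "E' \<longlonglongrightarrow> E" "F' \<longlonglongrightarrow> F" "G' \<longlonglongrightarrow> G" "H' \<longlonglongrightarrow> H"
  proof -
    have "(\<lambda>n. u n * u n) \<longlonglongrightarrow> A"
      unfolding t(1)[symmetric] by (intro tendsto_intros u)
    then show "A' \<longlonglongrightarrow> A"
      unfolding A'_def power2_eq_square .
    have m: "(\<lambda>n. u n * x n) \<longlonglongrightarrow> X" if "x \<longlonglongrightarrow> X / t" for x X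
      using tendsto_mult[OF u that] t(2) by simp
    show "B' \<longlonglongrightarrow> B" "C' \<longlonglongrightarrow> C" "D' \<longlonglongrightarrow> D" "E' \<longlonglongrightarrow> E" "F' \<longlonglongrightarrow> F" "G' \<longlonglongrightarrow> G" "H' \<longlonglongrightarrow> H"
      unfolding B'_def C'_def D'_def E'_def F'_def G'_def H'_def by (intro m lim)+
  qed
  have eq: "Phi q 5 (A' n) [B' n, C' n, D' n, E' n, F' n, G' n, H' n]
    = K1 q (A' n) (B' n) (C' n) (D' n) (E' n) (F' n) (G' n) (H' n)
        * Phi q 6 (q / A' n) [q / B' n, q / C' n, q / D' n, q / E' n, q / F' n, q / G' n, q / H' n]
    + K2 q (A' n) (B' n) (C' n) (D' n) (E' n) (F' n) (G' n) (H' n)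
        * Phi q 0 ((G' n)\<^sup>2 / A' n) [G' n * B' n / A' n, G' n * C' n / A' n, G' n * D' n / A' n, G' n * E' n / A' n, G' n * F' n / A' n, G' n, G' n * H' n / A' n]" for n
    by (rule three_term_generic[OF ind[of n]]) (simp_all only: A'_def B'_def C'_def D'_def E'_def F'_def G'_def H'_def)
  have lim5: "(\<lambda>n. Phi q 5 (A' n) [B' n, C' n, D' n, E' n, F' n, G' n, H' n]) \<longlonglongrightarrow> Phi q 5 A [B, C, D, E, F, G, H]"
  proof -
    have s: "seq_list_tendsto [B', C', D', E', F', G', H'] [B, C, D, E, F, G, H]"
      using L by simp
    show ?thesis
      using tendsto_Phi[OF L(1) s _ reg(1)] by simp
  qed
  have lim6: "(\<lambda>n. Phi q 6 (q / A' n) [q / B' n, q / C' n, q / D' n, q / E' n, q / F' n, q / G' n, q / H' n])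
      \<longlonglongrightarrow> Phi q 6 (q/A) [q/B, q/C, q/D, q/E, q/F, q/G, q/H]"
  proof -
    have d: "(\<lambda>n. q / x n) \<longlonglongrightarrow> q / X" if "x \<longlonglongrightarrow> X" "X \<noteq> 0" for x X
      using that by (intro tendsto_intros)
    have s: "seq_list_tendsto [\<lambda>n. q / B' n, \<lambda>n. q / C' n, \<lambda>n. q / D' n, \<lambda>n. q / E' n, \<lambda>n. q / F' n, \<lambda>n. q / G' n, \<lambda>n. q / H' n]
        [q/B, q/C, q/D, q/E, q/F, q/G, q/H]"
      unfolding seq_list_simps using nz by (intro conjI d L) simp_all
    show ?thesis
      using tendsto_Phi[OF d[OF L(1) nz(1)] s _ reg(2)] by simp
  qed
  have lim0: "(\<lambda>n. Phi q 0 ((G' n)\<^sup>2 / A' n) [G' n * B' n / A' n, G' n * C' n / A' n, G' n * D' n / A' n, G' n * E' n / A' n, G' n * F' n / A' n, G' n, G' n * H' n / A' n])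
      \<longlonglongrightarrow> Phi q 0 (G\<^sup>2/A) [G*B/A, G*C/A, G*D/A, G*E/A, G*F/A, G, G*H/A]"
  proof -
    have d: "(\<lambda>n. G' n * x n / A' n) \<longlonglongrightarrow> G * X / A" if "x \<longlonglongrightarrow> X" for x X
      using that nz(1) by (intro tendsto_intros L)
    have s: "seq_list_tendsto [\<lambda>n. G' n * B' n / A' n, \<lambda>n. G' n * C' n / A' n, \<lambda>n. G' n * D' n / A' n, \<lambda>n. G' n * E' n / A' n, \<lambda>n. G' n * F' n / A' n, G', \<lambda>n. G' n * H' n / A' n]
        [G*B/A, G*C/A, G*D/A, G*E/A, G*F/A, G, G*H/A]"
      unfolding seq_list_simps by (intro conjI d L) simp_all
    have a: "(\<lambda>n. (G' n)\<^sup>2 / A' n) \<longlonglongrightarrow> G\<^sup>2 / A"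
      using nz(1) by (intro tendsto_intros L)
    show ?thesis
      using tendsto_Phi[OF a s _ reg(3)] by simp
  qed
  note ti = tendsto_qpochs_inf_Cons tendsto_qpochs_inf_Nil tendsto_mult tendsto_divide tendsto_power tendsto_const L
  have K1: "(\<lambda>n. K1 q (A' n) (B' n) (C' n) (D' n) (E' n) (F' n) (G' n) (H' n)) \<longlonglongrightarrow> K1 q A B C D E F G H"
  proof -
    have "(\<lambda>n. K1_num q (A' n) (B' n) (C' n) (D' n) (E' n) (F' n) (G' n) (H' n)) \<longlonglongrightarrow> K1_num q A B C D E F G H"
      unfolding K1_num_def by (intro ti) (use nz in simp_all)
    moreover have "(\<lambda>n. K1_den q (A' n) (B' n) (C' n) (D' n) (E' n) (F' n) (G' n) (H' n)) \<longlonglongrightarrow> K1_den q A B C D E F G H"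
      unfolding K1_den_def by (intro ti) (use nz in simp_all)
    ultimately show ?thesis
      unfolding K1_def using den(1) by (intro tendsto_divide)
  qed
  have K2: "(\<lambda>n. K2 q (A' n) (B' n) (C' n) (D' n) (E' n) (F' n) (G' n) (H' n)) \<longlonglongrightarrow> K2 q A B C D E F G H"
  proof -
    have "(\<lambda>n. K2_num q (A' n) (B' n) (C' n) (D' n) (E' n) (F' n) (G' n) (H' n)) \<longlonglongrightarrow> K2_num q A B C D E F G H"
      unfolding K2_num_def by (intro ti) (use nz in simp_all)
    moreover have "(\<lambda>n. K2_den q (A' n) (B' n) (C' n) (D' n) (E' n) (F' n) (G' n) (H' n)) \<longlonglongrightarrow> K2_den q A B C D E F G H"
      unfolding K2_den_def by (intro ti) (use nz in simp_all)
    moreover have "(\<lambda>n. K2_bracket_num q (A' n) (B' n) (C' n) (D' n) (E' n) (F' n)) \<longlonglongrightarrow> K2_bracket_num q A B C D E F"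
      unfolding K2_bracket_num_def by (intro ti) (use nz in simp_all)
    moreover have "(\<lambda>n. K2_bracket_den q (A' n) (B' n) (C' n) (D' n) (E' n) (F' n)) \<longlonglongrightarrow> K2_bracket_den q A B C D E F"
      unfolding K2_bracket_den_def by (intro ti) (use nz in simp_all)
    ultimately show ?thesis
      unfolding K2_def using den(2,3) by (intro tendsto_mult tendsto_diff tendsto_divide tendsto_const)
  qed
  show ?thesis
    using LIMSEQ_unique[OF lim5, unfolded eq, OF tendsto_add[OF tendsto_mult[OF K1 lim6] tendsto_mult[OF K2 lim0]]] .
qed

end

theorem mainTheorem6:
  fixes q A B C D E F G H :: complex
  assumes "0 < norm q" "norm q < 1"
    and "A \<noteq> 0" "B \<noteq> 0" "C \<noteq> 0" "D \<noteq> 0" "E \<noteq> 0" "F \<noteq> 0" "G \<noteq> 0" "H \<noteq> 0"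
    and "B * C * D * E * F * G * H = A ^ 3 * q\<^sup>2"
    and "Phi_regular q 5 A [B, C, D, E, F, G, H]"
    and "Phi_regular q 6 (q/A) [q/B, q/C, q/D, q/E, q/F, q/G, q/H]"
    and "Phi_regular q 0 (G\<^sup>2/A) [G*B/A, G*C/A, G*D/A, G*E/A, G*F/A, G, G*H/A]"
    and "K1_den q A B C D E F G H \<noteq> 0"
    and "K2_den q A B C D E F G H \<noteq> 0"
    and "K2_bracket_den q A B C D E F \<noteq> 0"
  shows "Phi q 5 A [B, C, D, E, F, G, H]
    = K1 q A B C D E F G H * Phi q 6 (q/A) [q/B, q/C, q/D, q/E, q/F, q/G, q/H]
    + K2 q A B C D E F G H * Phi q 0 (G\<^sup>2/A) [G*B/A, G*C/A, G*D/A, G*E/A, G*F/A, G, G*H/A]"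
proof -
  interpret q_disc q
    using assms(1,2) by unfold_locales auto
  show ?thesis
    by (rule three_term[OF assms(3-)])
qed

end
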